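(* Let $\mathbb{K}$ be a field of characteristic $0$, let $S=\mathbb{K}[x_1,\dots,x_l]$ with the standard grading, let $I$ be a homogeneous ideal of $S$, let $1\le k\le l$, and let $\ell_1,\dots,\ell_k\in S_1$ be linear forms. Then $(S/I,\ell_1,\dots,\ell_k)$ has the $k$-SLP if and only if for every $d\ge0$, $0\le j\le k-1$ and $s\ge1$ $$\operatorname{HF}(S/(I+\langle\ell_1,\dots,\ell_j,\ell_{j+1}^s\rangle),d)=\operatorname{HF}(S/(\operatorname{rgin}(I)+\langle x_l,\dots,x_{l-j+1},x_{l-j}^s\rangle),d)=\max\{\mathcal{M}_{S/I}(l-j,d)-\mathcal{M}_{S/I}(l-j,d-s),\,0\},$$ where $\mathcal{M}_{S/I}(l-j,r)=0$ for all $r<0$ (and for $j=0$ the lists $\ell_1,\dots,\ell_j$ and $x_l,\dots,x_{l-j+1}$ are empty).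
   Context: $\operatorname{HF}(S/I,d)=\dim_{\mathbb{K}}(S/I)_d$. The sectional matrix of $S/I$ is $\mathcal{M}_{S/I}(i,d)=\operatorname{HF}(S/(I+\langle h_1,\dots,h_{l-i}\rangle),d)$ for $1\le i\le l$, $d\ge0$, where $h_1,\dots,h_{l-i}$ are generic linear forms of $S$ (the value is constant on a nonempty Zariski open set of choices). $\operatorname{rgin}(I)$ is the generic initial ideal of $I$ with respect to the degree reverse lexicographic order DegRevLex with $x_1>x_2>\dots>x_l$, i.e. the common value of the leading term ideal $\mathrm{LT}_{\mathrm{DegRevLex}}(g(I))$ for $g$ in a nonempty Zariski open subset of $\mathrm{GL}(l)$ (Galligo). A linear map is full-rank if it is injective or surjective. A graded ring $R=\bigoplus_{i\ge0}R_i$ over $\mathbb{K}$ with $\dim_{\mathbb{K}}R_i<\infty$ (not necessarily Artinian) has the SLP with Lefschetz element $\ell\in R_1$ if $\times\ell^s\colon R_i\to R_{i+s}$ is full-rank for all $i\ge 0$, $s\ge1$. $(R,\ell_1,\dots,\ell_k)$ has the $k$-SLP if $R$ has the SLP with Lefschetz element $\ell_1$ and, for all $i=2,\dots,k$, $R/\langle\ell_1,\dots,\ell_{i-1}\rangle$ has the SLP with Lefschetz element (the class of) $\ell_i$. Linear forms of $S$ are identified with their classes in quotients. *)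

theory Defs
  imports
    "HOL-Library.Poly_Mapping"
    "HOL-Algebra.QuotRing"
    "HOL-Algebra.Embedded_Algebras"
    "Jordan_Normal_Form.Matrix"
begin

section \<open>Polynomials\<close>

text \<open>Polynomials over \<open>'k\<close> with variables in \<open>'x\<close>, as finitely supported functions on
  exponent vectors; the ring operations are those of \<^theory>\<open>HOL-Library.Poly_Mapping\<close>.\<close>

type_synonym 'x monomial = "'x \<Rightarrow>\<^sub>0 nat"
type_synonym ('x, 'k) mpoly = "'x monomial \<Rightarrow>\<^sub>0 'k"

definition Const :: "'k \<Rightarrow> ('x, 'k::comm_ring_1) mpoly" where
  "Const c = Poly_Mapping.single 0 c"

definition Var :: "'x \<Rightarrow> ('x, 'k::comm_ring_1) mpoly" where
  "Var i = Poly_Mapping.single (Poly_Mapping.single i 1) 1"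

definition vars :: "('x, 'k::zero) mpoly \<Rightarrow> 'x set" where
  "vars f = (\<Union>m \<in> Poly_Mapping.keys f. Poly_Mapping.keys m)"

definition mdeg :: "'x monomial \<Rightarrow> nat" where
  "mdeg m = (\<Sum>i \<in> Poly_Mapping.keys m. Poly_Mapping.lookup m i)"

text \<open>Evaluation at the point \<open>\<phi>\<close>, coefficients being mapped by \<open>h\<close>.\<close>

definition subst_mpoly ::
    "('k \<Rightarrow> 'a) \<Rightarrow> ('x \<Rightarrow> 'a) \<Rightarrow> ('x, 'k::zero) mpoly \<Rightarrow> 'a::comm_ring_1" where
  "subst_mpoly h \<phi> f = (\<Sum>m \<in> Poly_Mapping.keys f.
     h (Poly_Mapping.lookup f m) * (\<Prod>i \<in> Poly_Mapping.keys m. \<phi> i ^ Poly_Mapping.lookup m i))"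

text \<open>The ring \<open>S = K[x\<^sub>1, \<dots>, x\<^sub>l]\<close>, where \<open>x\<^sub>i\<close> is \<open>Var i\<close>.\<close>

definition poly_ring :: "nat \<Rightarrow> (nat, 'k::comm_ring_1) mpoly ring" where
  "poly_ring l = \<lparr>carrier = {f. vars f \<subseteq> {1..l}}, monoid.mult = (*), one = 1, zero = 0, add = (+)\<rparr>"

definition homog_part :: "nat \<Rightarrow> nat \<Rightarrow> (nat, 'k::comm_ring_1) mpoly set" where
  "homog_part l d = {f \<in> carrier (poly_ring l). \<forall>m \<in> Poly_Mapping.keys f. mdeg m = d}"

definition homogeneous_ideal :: "nat \<Rightarrow> (nat, 'k::comm_ring_1) mpoly set \<Rightarrow> bool" where
  "homogeneous_ideal l I \<longleftrightarrow>
     (\<exists>G \<subseteq> (\<Union>d. homog_part l d). I = Idl\<^bsub>poly_ring l\<^esub> G)"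


section \<open>Quotients of the polynomial ring and Hilbert functions\<close>

text \<open>\<open>(S/J)\<^sub>d\<close>, as a set of cosets.\<close>

definition quot_part ::
    "nat \<Rightarrow> (nat, 'k::comm_ring_1) mpoly set \<Rightarrow> nat \<Rightarrow> (nat, 'k) mpoly set set" where
  "quot_part l J d = (\<lambda>f. J +>\<^bsub>poly_ring l\<^esub> f) ` homog_part l d"

text \<open>The scalars of \<open>S/J\<close> are the classes of the constants. When \<open>J = S\<close> they do not form a
  subfield, but then \<open>S/J\<close> is the zero ring, and \<^const>\<open>ring.dimension\<close> gives dimension \<open>0\<close>.\<close>

definition HF :: "nat \<Rightarrow> (nat, 'k::field) mpoly set \<Rightarrow> nat \<Rightarrow> nat" where
  "HF l J d = (THE n. ring.dimension (poly_ring l Quot J) n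
     ((\<lambda>c. J +>\<^bsub>poly_ring l\<^esub> Const c) ` UNIV) (quot_part l J d))"

text \<open>\<open>J + \<langle>G\<rangle>\<close>\<close>

definition add_gens ::
    "nat \<Rightarrow> (nat, 'k::comm_ring_1) mpoly set \<Rightarrow> (nat, 'k) mpoly set \<Rightarrow> (nat, 'k) mpoly set" where
  "add_gens l J G = J <+>\<^bsub>poly_ring l\<^esub> (Idl\<^bsub>poly_ring l\<^esub> G)"


section \<open>Genericity\<close>

text \<open>Zariski open subsets of the affine space of \<open>m \<times> n\<close> matrices. The variable \<open>(i, j)\<close> stands
  for the entry \<open>(i, j)\<close>, so it has to be in range.\<close>

definition zariski_open :: "nat \<Rightarrow> nat \<Rightarrow> 'k::field mat set \<Rightarrow> bool" where
  "zariski_open m n U \<longleftrightarrow>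
     (\<exists>F :: (nat \<times> nat, 'k) mpoly set. (\<forall>f\<in>F. vars f \<subseteq> {..<m} \<times> {..<n}) \<and>
        U = {A \<in> carrier_mat m n. \<exists>f\<in>F. subst_mpoly id (\<lambda>p. A $$ p) f \<noteq> 0})"

definition GL :: "nat \<Rightarrow> 'k::field mat set" where
  "GL l = {g \<in> carrier_mat l l. invertible_mat g}"

text \<open>Vectors and matrices are indexed from \<open>0\<close>, variables from \<open>1\<close>.\<close>

definition linear_form :: "nat \<Rightarrow> 'k::comm_ring_1 vec \<Rightarrow> (nat, 'k) mpoly" where
  "linear_form l v = (\<Sum>i<l. Const (v $ i) * Var (Suc i))"

text \<open>A tuple \<open>h\<^sub>1, \<dots>, h\<^sub>r\<close> of linear forms is given by its \<open>r \<times> l\<close> matrix of coefficients;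
  the value of \<open>\<M>\<^bsub>S/I\<^esub>(i, d)\<close> is the one taken on a nonempty open set of such matrices with
  \<open>r = l - i\<close>.\<close>

definition sectional_matrix ::
    "nat \<Rightarrow> (nat, 'k::field) mpoly set \<Rightarrow> nat \<Rightarrow> nat \<Rightarrow> nat" where
  "sectional_matrix l I i d = (THE n. \<exists>U. zariski_open (l - i) l U \<and> U \<noteq> {} \<and>
     (\<forall>A\<in>U. HF l (add_gens l I {linear_form l (row A a) |a. a < l - i}) d = n))"

text \<open>The value at a degree which may be negative.\<close>

definition sectional_matrix_int ::
    "nat \<Rightarrow> (nat, 'k::field) mpoly set \<Rightarrow> nat \<Rightarrow> int \<Rightarrow> int" where
  "sectional_matrix_int l I i r = (if r < 0 then 0 else int (sectional_matrix l I i (nat r)))"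


section \<open>The generic initial ideal\<close>

text \<open>DegRevLex with \<open>x\<^sub>1 > x\<^sub>2 > \<dots>\<close>: among monomials of the same degree, the smaller one has the
  larger exponent at the last variable where they differ.\<close>

definition degrevlex_less :: "nat monomial \<Rightarrow> nat monomial \<Rightarrow> bool" where
  "degrevlex_less m m' \<longleftrightarrow> mdeg m < mdeg m' \<or>
     mdeg m = mdeg m' \<and>
     (\<exists>i. Poly_Mapping.lookup m i > Poly_Mapping.lookup m' i \<and>
          (\<forall>j>i. Poly_Mapping.lookup m j = Poly_Mapping.lookup m' j))"

definition leading_monomial :: "(nat, 'k::zero) mpoly \<Rightarrow> nat monomial" where
  "leading_monomial f = (THE m. m \<in> Poly_Mapping.keys f \<and>
     (\<forall>m' \<in> Poly_Mapping.keys f. m' \<noteq> m \<longrightarrow> degrevlex_less m' m))"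

definition LT_ideal :: "nat \<Rightarrow> (nat, 'k::field) mpoly set \<Rightarrow> (nat, 'k) mpoly set" where
  "LT_ideal l I = Idl\<^bsub>poly_ring l\<^esub> {Poly_Mapping.single (leading_monomial f) 1 |f. f \<in> I \<and> f \<noteq> 0}"

text \<open>\<open>g\<close> acts on \<open>S\<close> as the \<open>K\<close>-algebra map sending \<open>x\<^sub>i\<close> to the linear form whose coefficients
  are the \<open>i\<close>-th column of \<open>g\<close>.\<close>

definition GL_act :: "nat \<Rightarrow> 'k::field mat \<Rightarrow> (nat, 'k) mpoly \<Rightarrow> (nat, 'k) mpoly" where
  "GL_act l g = subst_mpoly Const (\<lambda>i. linear_form l (col g (i - 1)))"

text \<open>The open subsets of \<open>GL(l)\<close> are its intersections with the open subsets of the space of all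
  \<open>l \<times> l\<close> matrices.\<close>

definition rgin :: "nat \<Rightarrow> (nat, 'k::field) mpoly set \<Rightarrow> (nat, 'k) mpoly set" where
  "rgin l I = (THE J. \<exists>U. zariski_open l l U \<and> U \<inter> GL l \<noteq> {} \<and>
     (\<forall>g \<in> U \<inter> GL l. LT_ideal l (GL_act l g ` I) = J))"


section \<open>Lefschetz properties\<close>

definition full_rank :: "('a \<Rightarrow> 'b) \<Rightarrow> 'a set \<Rightarrow> 'b set \<Rightarrow> bool" where
  "full_rank f A B \<longleftrightarrow> inj_on f A \<or> f ` A = B"

text \<open>In the following, \<open>gr i\<close> is the component of degree \<open>i\<close> of the graded ring \<open>R\<close>.\<close>

definition SLP :: "('a, 'm) ring_scheme \<Rightarrow> (nat \<Rightarrow> 'a set) \<Rightarrow> 'a \<Rightarrow> bool" where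
  "SLP R gr a \<longleftrightarrow> a \<in> gr 1 \<and>
     (\<forall>i s. s \<ge> 1 \<longrightarrow> full_rank (\<lambda>x. a [^]\<^bsub>R\<^esub> (s::nat) \<otimes>\<^bsub>R\<^esub> x) (gr i) (gr (i + s)))"

definition k_SLP ::
    "('a, 'm) ring_scheme \<Rightarrow> (nat \<Rightarrow> 'a set) \<Rightarrow> nat \<Rightarrow> (nat \<Rightarrow> 'a) \<Rightarrow> bool" where
  "k_SLP R gr k a \<longleftrightarrow> SLP R gr (a 1) \<and>
     (\<forall>i\<in>{2..k}. let J = Idl\<^bsub>R\<^esub> (a ` {1..<i}) in
        SLP (R Quot J) (\<lambda>d. (\<lambda>x. J +>\<^bsub>R\<^esub> x) ` gr d) (J +>\<^bsub>R\<^esub> a i))"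

end

theory Submission
  imports Defs "Jordan_Normal_Form.Determinant"
begin

text \<open>For a homogeneous ideal \<open>J\<close> and a linear form \<open>a\<close>, multiplication by
  \<open>a\<^sup>s\<close> on \<open>S/J\<close> has full rank in all degrees iff the Hilbert function of
  \<open>S/(J + \<langle>a\<^sup>s\<rangle>)\<close> is the least one permitted by rank-nullity, so the
  \<open>k\<close>-SLP is a statement about Hilbert functions of the ideals
  \<open>I + \<langle>\<ell>\<^sub>1, \<dots>, \<ell>\<^sub>j, \<ell>\<^bsub>j+1\<^esub>\<^sup>s\<rangle>\<close>. Such a value can only
  drop when the forms are replaced by generic ones, and the generic value still respects the bound;
  hence under the \<open>k\<close>-SLP the given forms attain the generic values, by induction on
  \<open>j\<close>. Finally the generic value is the one of
  \<open>rgin(I) + \<langle>x\<^sub>l, \<dots>, x\<^bsub>l-j\<^esub>\<^sup>s\<rangle>\<close>: in a fixed degree the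
  monomials of \<open>\<langle>x\<^sub>l, \<dots>, x\<^bsub>l-j\<^esub>\<^sup>s\<rangle>\<close> are the smallest ones
  for DegRevLex, so adding them commutes with taking leading terms, and a generic coordinate change
  moves generic linear forms to the last variables.\<close>

text \<open>Both \<open>rgin\<close> and \<open>sectional_matrix\<close> are definite descriptions,
  so a generic value has to be shown to exist and to be unique before anything can be said about
  them. Every generic quantity is therefore written as the rank of finitely many vectors whose
  coefficients are polynomial functions of a parameter point: the maximal rank is attained wherever
  some polynomial function does not vanish, and two nonempty open sets meet. The same scheme yields
  Galligo's theorem, because a set of leading monomials is determined by the dimensions of
  \<open>V + supp B\<close> with \<open>B\<close> an initial segment for DegRevLex. The obstacle in
  comparing generic forms with generic coordinate changes is that the forms are columns of the
  inverse of \<open>g\<close>. Instead of transporting open sets along inversion, both values are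
  characterised as extremal over all parameters, so that it is enough to pass to the inverse at
  single points. The converse direction needs the Hilbert function of \<open>I\<close> plus the
  first \<open>j\<close> forms, which the equations do not mention: taking \<open>s > d\<close>
  makes the power invisible in degree \<open>d\<close>.\<close>

abbreviation (input) lookup where "lookup \<equiv> Poly_Mapping.lookup"

abbreviation (input) keys where "keys \<equiv> Poly_Mapping.keys"

abbreviation (input) polys :: "nat \<Rightarrow> (nat, 'k::comm_ring_1) mpoly set" where
  "polys l \<equiv> carrier (poly_ring l)"

abbreviation (input) gen_ideal :: "nat \<Rightarrow> (nat, 'k::comm_ring_1) mpoly set \<Rightarrow> (nat, 'k) mpoly set" where
  "gen_ideal l G \<equiv> Idl\<^bsub>poly_ring l\<^esub> G"

section \<open>Linear algebra\<close>

locale kspace = Vector_Spaces.vector_space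
begin

text \<open>The polynomial ring is infinite-dimensional, and \<open>dim\<close> is 0 on a space with
  an infinite basis. The dimension counts below are made for sets inside some finitely spanned
  space, such as a graded piece.\<close>

definition fdim :: "'b set \<Rightarrow> bool" where
  "fdim V \<longleftrightarrow> (\<exists>F. finite F \<and> V \<subseteq> span F)"

lemma fdim_subset: "fdim W \<Longrightarrow> V \<subseteq> W \<Longrightarrow> fdim V"
  unfolding fdim_def by blast

lemma fdim_finite: "finite F \<Longrightarrow> fdim F"
  unfolding fdim_def by (meson span_superset)

lemma fdim_Un: "fdim V \<Longrightarrow> fdim W \<Longrightarrow> fdim (V \<union> W)"
proof -
  assume "fdim V" "fdim W"
  then obtain F G where "finite F" "V \<subseteq> span F" "finite G" "W \<subseteq> span G" unfolding fdim_def by blast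
  moreover have "span F \<subseteq> span (F \<union> G)" "span G \<subseteq> span (F \<union> G)" by (auto intro: span_mono[THEN subsetD])
  ultimately show ?thesis unfolding fdim_def by (intro exI[of _ "F \<union> G"]) blast
qed

lemma fdim_span: "fdim V \<Longrightarrow> fdim (span V)"
  unfolding fdim_def by (meson span_minimal subspace_span)

lemma fdim_basis:
  assumes "fdim V"
  obtains B where "finite B" "B \<subseteq> V" "independent B" "span B = span V" "card B = dim V"
proof -
  obtain B where B: "B \<subseteq> V" "independent B" "V \<subseteq> span B" "card B = dim V"
    by (rule basis_exists)
  moreover obtain F where "finite F" "V \<subseteq> span F" using assms fdim_def by blast
  then have "finite B" using independent_span_bound B by blast
  moreover have "span B = span V"
    by (rule equalityI[OF span_mono[OF B(1)] span_minimal[OF B(3) subspace_span]])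
  ultimately show ?thesis using that by blast
qed

lemma fdim_basis_subspace:
  assumes "subspace V" "fdim V"
  obtains B where "finite B" "B \<subseteq> V" "independent B" "span B = V" "card B = dim V"
  by (rule fdim_basis[OF assms(2), unfolded span_eq_iff[THEN iffD2, OF assms(1)]])

lemma independent_card_le:
  assumes "fdim V" "independent B" "B \<subseteq> span V"
  shows "finite B \<and> card B \<le> dim V"
proof -
  obtain A where A: "finite A" "span A = span V" "card A = dim V"
    using fdim_basis[OF assms(1)] by metis
  then show ?thesis using independent_span_bound[OF A(1) assms(2)] assms(3) by simp
qed

lemma dim_mono_fdim:
  assumes "fdim W" "V \<subseteq> span W" shows "dim V \<le> dim W"
proof -
  have "fdim V" by (rule fdim_subset[OF fdim_span[OF assms(1)] assms(2)])
  then obtain B where "finite B" "B \<subseteq> V" "independent B" "card B = dim V"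
    using fdim_basis by metis
  then show ?thesis using independent_card_le[OF assms(1)] assms(2) by force
qed

lemma dim_insert_fdim:
  assumes "fdim V" "x \<notin> span V" shows "dim (insert x V) = Suc (dim V)"
proof -
  obtain B where B: "finite B" "B \<subseteq> V" "independent B" "span B = span V" "card B = dim V"
    using fdim_basis[OF assms(1)] by metis
  have "independent (insert x B)" using B assms(2) independent_insertI by metis
  moreover have "span (insert x B) = span (insert x V)"
    using B(4) by (metis span_insert)
  moreover have "x \<notin> B" using assms(2) B(4) span_base by blast
  ultimately show ?thesis
    using dim_eq_card[of "insert x B" "insert x V"] B by simp
qed

lemma subspace_eq_of_dim:
  assumes "subspace V" "subspace W" "V \<subseteq> W" "fdim W" "dim W \<le> dim V"
  shows "V = W"
proof (rule ccontr)
  assume "V \<noteq> W"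
  then obtain x where x: "x \<in> W" "x \<notin> V" using assms(3) by blast
  then have "dim (insert x V) = Suc (dim V)"
    using dim_insert_fdim fdim_subset assms by (metis span_eq_iff)
  moreover have "dim (insert x V) \<le> dim W"
    by (rule dim_mono_fdim[OF assms(4)]) (use x assms(3) span_base in blast)
  ultimately show False using assms(5) by simp
qed

text \<open>Rank-nullity for the map from \<open>V\<close> to \<open>(T V + W) / W\<close> induced
  by \<open>T\<close>, whose kernel is the second set; the quotient is avoided by counting
  \<open>T V + W\<close> itself. With \<open>T\<close> multiplication by a form and \<open>W\<close>
  a graded piece of an ideal it becomes the formula for Hilbert functions.\<close>

lemma dim_image_sum_preimage:
  assumes T: "Vector_Spaces.linear scale scale T"
    and V: "subspace V" "fdim V" and W: "subspace W" "fdim W"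
  shows "dim {T v + w |v w. v \<in> V \<and> w \<in> W} + dim {v \<in> V. T v \<in> W} = dim V + dim W"
proof -
  interpret T: Vector_Spaces.linear scale scale T by fact
  let ?N = "{v \<in> V. T v \<in> W}"
  have N: "subspace ?N"
    using subspace_inter[OF V(1) T.subspace_linear_preimage[OF W(1)]] by (simp add: Int_def)
  have fN: "fdim ?N" using V(2) fdim_subset by (metis (no_types, lifting) mem_Collect_eq subsetI)
  obtain A where A: "finite A" "A \<subseteq> ?N" "independent A" "span A = ?N" "card A = dim ?N"
    by (rule fdim_basis_subspace[OF N fN])
  \<comment> \<open>A basis \<open>A\<close> of the kernel is extended to a basis \<open>B\<close>
    of \<open>V\<close>; the images of \<open>B - A\<close> are then a basis of
    \<open>T V + W\<close> modulo \<open>W\<close>.\<close>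
  obtain B where B: "A \<subseteq> B" "B \<subseteq> V" "independent B" "V \<subseteq> span B"
    using maximal_independent_subset_extend[of A V] A by auto
  have fB: "finite B" "card B = dim V"
    using independent_card_le[OF V(2) B(3)] subset_trans[OF B(2) span_superset]
      basis_card_eq_dim[OF B(2,4,3)] by auto
  \<comment> \<open>Each further image raises the dimension by one: if \<open>T c\<close> depended
    on the earlier images and \<open>W\<close>, some \<open>c - v\<close> would lie in the kernel
    \<open>span A\<close>, and \<open>c\<close> would depend on \<open>B - {c}\<close>.\<close>
  have main: "finite C \<Longrightarrow> C \<subseteq> B - A \<Longrightarrow> dim (T ` C \<union> W) = card C + dim W" for C
  proof (induction C rule: finite_induct)
    case (insert c C)
    have "T c \<notin> span (T ` C \<union> W)"
    proof
      assume "T c \<in> span (T ` C \<union> W)"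
      then obtain v w where vw: "v \<in> span C" "w \<in> W" "T c = T v + w"
        unfolding span_Un using T.span_image W(1) by (auto simp: span_eq_iff[THEN iffD2])
      have cV: "c \<in> V" using insert.prems B(2) by blast
      have "C \<subseteq> V" using insert.prems B(2) by blast
      then have "v \<in> V" using vw(1) V(1) span_minimal by blast
      then have "c - v \<in> ?N" using cV vw V(1) by (auto simp: T.diff subspace_diff)
      then have "c - v \<in> span (A \<union> C)" using A(4) span_mono[of A "A \<union> C"] by blast
      moreover have "v \<in> span (A \<union> C)" using vw(1) span_mono[of C "A \<union> C"] by blast
      ultimately have "c \<in> span (A \<union> C)" using span_add by fastforce
      then have "c \<in> span (B - {c})"
        using span_mono[of "A \<union> C" "B - {c}"] insert B(1) by blast
      then show False using B(3) insert.prems unfolding dependent_def by blast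
    qed
    moreover have "fdim (T ` C \<union> W)" using fdim_Un fdim_finite insert.hyps W(2) by blast
    ultimately show ?case using insert dim_insert_fdim by simp
  qed simp
  have "{T v + w |v w. v \<in> V \<and> w \<in> W} = span (T ` (B - A) \<union> W)"
  proof (intro equalityI subsetI)
    fix x assume "x \<in> {T v + w |v w. v \<in> V \<and> w \<in> W}"
    then obtain v w where vw: "v \<in> V" "w \<in> W" "x = T v + w" by blast
    have "v \<in> span (A \<union> (B - A))" using vw(1) B by (metis Un_Diff_cancel subset_Un_eq subsetD)
    then obtain a b where ab: "a \<in> span A" "b \<in> span (B - A)" "v = a + b"
      unfolding span_Un by blast
    have "T a \<in> W" using ab(1) A(4) by blast
    then have "T a + w \<in> span (T ` (B - A) \<union> W)"
      using W(1) vw(2) span_base subspace_add by (metis Un_iff)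
    moreover have "T b \<in> span (T ` (B - A) \<union> W)"
      using ab(2) T.span_image span_mono[of "T ` (B - A)" "T ` (B - A) \<union> W"] by blast
    ultimately have "T b + (T a + w) \<in> span (T ` (B - A) \<union> W)" by (rule span_add[rotated])
    then show "x \<in> span (T ` (B - A) \<union> W)" using vw(3) ab(3) by (simp add: T.add ac_simps)
  next
    fix x assume "x \<in> span (T ` (B - A) \<union> W)"
    then obtain v w where "v \<in> span (B - A)" "w \<in> W" "x = T v + w"
      unfolding span_Un using T.span_image W(1) by (auto simp: span_eq_iff[THEN iffD2])
    moreover have "span (B - A) \<subseteq> V" using B(2) V(1) span_minimal by blast
    ultimately show "x \<in> {T v + w |v w. v \<in> V \<and> w \<in> W}" by blast
  qed
  then have "dim {T v + w |v w. v \<in> V \<and> w \<in> W} = card (B - A) + dim W"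
    using main[of "B - A"] fB by simp
  then show ?thesis
    using A fB card_mono[OF fB(1) B(1)] card_Diff_subset[OF A(1) B(1)] by simp
qed

lemma dim_inj_image:
  assumes T: "Vector_Spaces.linear scale scale T"
    and V: "subspace V" "fdim V" and inj: "\<And>v. v \<in> V \<Longrightarrow> T v = 0 \<Longrightarrow> v = 0"
  shows "dim (T ` V) = dim V"
proof -
  interpret T: Vector_Spaces.linear scale scale T by fact
  have "{v \<in> V. T v \<in> {0}} = {0}" using inj V(1) by (auto simp: subspace_0)
  moreover have "{T v + w |v w. v \<in> V \<and> w \<in> {0}} = T ` V" by auto
  ultimately show ?thesis
    using dim_image_sum_preimage[OF T V subspace_single_0] fdim_finite[of "{0}"] by simp
qed

text \<open>A vector in both spans has a representation over \<open>C\<close> supported in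
  \<open>C - A\<close> and one supported in \<open>A\<close>; they agree by uniqueness, so all
  coefficients vanish.\<close>

lemma independent_span_disjoint:
  assumes C: "independent C" and A: "A \<subseteq> C"
  shows "span (C - A) \<inter> span A \<subseteq> {0}"
proof
  fix x assume x: "x \<in> span (C - A) \<inter> span A"
  have 1: "representation C x = representation A x"
    by (rule representation_extend[OF C]) (use x A in auto)
  have 2: "representation C x = representation (C - A) x"
    by (rule representation_extend[OF C]) (use x in auto)
  have "representation A x b = 0" for b
    using representation_ne_zero[of A x b] representation_ne_zero[of "C - A" x b] 1 2 by force
  moreover have "(\<Sum>b | representation A x b \<noteq> 0. scale (representation A x b) b) = x"
    by (rule sum_nonzero_representation_eq) (use x independent_mono[OF C A] in auto)
  ultimately show "x \<in> {0}" by simp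
qed

text \<open>Independence of an indexed family, not of the set of its values: vectors that depend on
  a parameter may coincide at some points, and there the family has to count as dependent.\<close>

definition indep_fam :: "'i set \<Rightarrow> ('i \<Rightarrow> 'b) \<Rightarrow> bool" where
  "indep_fam T v \<longleftrightarrow> (\<forall>c. (\<Sum>i\<in>T. scale (c i) (v i)) = 0 \<longrightarrow> (\<forall>i\<in>T. c i = 0))"

lemma indep_fam_card_le:
  assumes T: "finite T" "indep_fam T v" and V: "fdim V" "\<And>i. i \<in> T \<Longrightarrow> v i \<in> span V"
  shows "card T \<le> dim V"
proof -
  have inj: "inj_on v T"
  proof (rule inj_onI)
    fix i j assume ij: "i \<in> T" "j \<in> T" "v i = v j"
    show "i = j"
    proof (rule ccontr)
      assume ne: "i \<noteq> j"
      define c :: "'c \<Rightarrow> 'a" where "c = (\<lambda>t. if t = i then 1 else if t = j then - 1 else 0)"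
      have "(\<Sum>t\<in>T. scale (c t) (v t)) = (\<Sum>t\<in>{i, j}. scale (c t) (v t))"
        by (rule sum.mono_neutral_right) (use T ij in \<open>auto simp: c_def\<close>)
      also have "\<dots> = 0" using ne ij(3) by (simp add: c_def)
      finally have "c i = 0" using T(2) ij(1) unfolding indep_fam_def by blast
      then show False by (simp add: c_def)
    qed
  qed
  have "independent (v ` T)"
  proof (rule independent_if_scalars_zero)
    fix f x assume "(\<Sum>x\<in>v ` T. scale (f x) x) = 0" "x \<in> v ` T"
    then show "f x = 0" using T(2) inj unfolding indep_fam_def
      by (auto simp: sum.reindex)
  qed (use T in simp)
  then have "card (v ` T) \<le> dim V" using independent_card_le[OF V(1)] V(2) by blast
  then show ?thesis using card_image[OF inj] by simp
qed

text \<open>One index is chosen for each vector of a basis taken from the values of the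
  family.\<close>

lemma ex_indep_fam:
  assumes "finite T"
  obtains T' where "T' \<subseteq> T" "indep_fam T' v" "card T' = dim (span (v ` T))"
proof -
  obtain B where B: "B \<subseteq> v ` T" "independent B" "v ` T \<subseteq> span B" "card B = dim (v ` T)"
    by (rule basis_exists)
  then obtain T' where T': "T' \<subseteq> T" "inj_on v T'" "B = v ` T'"
    by (meson subset_image_inj)
  have fin: "finite T'" using T'(1) assms finite_subset by blast
  have "indep_fam T' v" unfolding indep_fam_def
  proof (intro allI impI ballI)
    fix c i assume c: "(\<Sum>i\<in>T'. scale (c i) (v i)) = 0" and i: "i \<in> T'"
    have "(\<Sum>x\<in>B. scale (c (the_inv_into T' v x)) x) = (\<Sum>i\<in>T'. scale (c i) (v i))"
      unfolding T'(3) sum.reindex[OF T'(2)] by (rule sum.cong) (auto simp: the_inv_into_f_f T')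
    then have "c (the_inv_into T' v (v i)) = 0"
      using independentD[OF B(2), of B "\<lambda>x. c (the_inv_into T' v x)" "v i"] c i fin T'(3) by auto
    then show "c i = 0" using the_inv_into_f_f[OF T'(2) i] by simp
  qed
  moreover have "card T' = dim (span (v ` T))" using B T' by (simp add: card_image)
  ultimately show ?thesis using that T' by blast
qed

end


section \<open>Polynomials and ideals\<close>

lemma lookup_Const_times: "lookup (Const c * f) m = c * lookup f m"
  unfolding Const_def mult_map_scale_conv_mult[symmetric]
  by (simp add: Poly_Mapping.map.rep_eq when_def)

lemma Const_add: "Const (a + b) = Const a + Const b"
  by (simp add: Const_def single_add)

lemma Const_mult: "Const (a * b) = Const a * Const b"
  by (simp add: Const_def mult_single)

lemma Const_0 [simp]: "Const 0 = 0" and Const_1 [simp]: "Const 1 = 1"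
  by (simp_all add: Const_def)

lemma Const_times_single: "Const c * Poly_Mapping.single m b = Poly_Mapping.single m (c * b)"
  by (simp add: Const_def mult_single)

text \<open>Scalars act through constant polynomials, in agreement with \<open>HF\<close>, whose
  scalars are the classes of constants.\<close>

global_interpretation mp: kspace "\<lambda>(c::'k::field) (f::('x, 'k) mpoly). Const c * f"
  by unfold_locales (simp_all add: algebra_simps Const_add Const_mult)

lemma linear_times: "Vector_Spaces.linear (\<lambda>(c::'k::field) (f::('x, 'k) mpoly). Const c * f) (\<lambda>c f. Const c * f) ((*) g)"
  by unfold_locales (simp_all add: algebra_simps)

lemma mpoly_expand: "f = (\<Sum>m\<in>keys f. Poly_Mapping.single m (lookup f m))"
  by (rule poly_mapping_eqI)
    (auto simp: lookup_sum lookup_single when_def in_keys_iff)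

lemma mpoly_induct [case_names single add]:
  assumes "\<And>m c. P (Poly_Mapping.single m c)" "\<And>f g. P f \<Longrightarrow> P g \<Longrightarrow> P (f + g)"
  shows "P (f :: ('x, 'k::comm_monoid_add) mpoly)"
proof -
  have "finite A \<Longrightarrow> P (\<Sum>m\<in>A. Poly_Mapping.single m (lookup f m))" for A
    by (induction A rule: finite_induct) (use assms(1)[of 0 0] in \<open>simp_all add: assms\<close>)
  then show ?thesis using mpoly_expand[of f] by (metis finite_keys)
qed

text \<open>The carrier of the ring, its graded pieces and the monomial ideals all have this form,
  so inclusions, intersections and dimensions of such spaces are read off from sets of
  monomials.\<close>

definition supp :: "'x monomial set \<Rightarrow> ('x, 'k::zero) mpoly set" where
  "supp X = {f. keys f \<subseteq> X}"

lemma supp_iff: "f \<in> supp X \<longleftrightarrow> (\<forall>m. lookup f m \<noteq> 0 \<longrightarrow> m \<in> X)"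
  unfolding supp_def by (auto simp: in_keys_iff)

lemma supp_mono: "X \<subseteq> Y \<Longrightarrow> supp X \<subseteq> supp Y"
  unfolding supp_def by blast

lemma supp_Int: "supp X \<inter> supp Y = supp (X \<inter> Y)"
  unfolding supp_def by blast

lemma supp_add: "f \<in> supp X \<Longrightarrow> g \<in> supp X \<Longrightarrow> f + g \<in> (supp X :: ('x, 'k::comm_ring_1) mpoly set)"
  unfolding supp_def using keys_add[of f g] by blast

lemma zero_in_supp [simp]: "0 \<in> supp X"
  by (simp add: supp_def)

lemma subspace_supp: "mp.subspace (supp X :: ('x, 'k::field) mpoly set)"
proof (rule mp.subspaceI)
  fix c and f :: "('x, 'k) mpoly" assume "f \<in> supp X"
  then show "Const c * f \<in> supp X" by (simp add: supp_iff lookup_Const_times)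
qed (simp_all add: supp_add)

lemma supp_sum: "(\<And>i. i \<in> A \<Longrightarrow> f i \<in> supp X) \<Longrightarrow> sum f A \<in> (supp X :: ('x, 'k::comm_ring_1) mpoly set)"
  by (induction A rule: infinite_finite_induct) (auto simp: supp_add)

lemma supp_mult:
  assumes "f \<in> supp X" "g \<in> supp Y" "\<And>a b. a \<in> X \<Longrightarrow> b \<in> Y \<Longrightarrow> a + b \<in> Z"
  shows "f * g \<in> supp Z"
  using assms keys_mult[of f g] unfolding supp_def by blast

lemma single_in_supp [simp]: "m \<in> X \<Longrightarrow> Poly_Mapping.single m c \<in> supp X"
  by (simp add: supp_def)

abbreviation xmon :: "'x monomial \<Rightarrow> ('x, 'k::field) mpoly" where
  "xmon m \<equiv> Poly_Mapping.single m 1"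

lemma supp_subset_span: "(supp X :: ('x, 'k::field) mpoly set) \<subseteq> mp.span (xmon ` X)"
proof
  fix f :: "('x, 'k) mpoly" assume f: "f \<in> supp X"
  have "(\<Sum>m\<in>keys f. Const (lookup f m) * xmon m) \<in> mp.span (xmon ` X)"
    by (intro mp.span_sum mp.span_scale mp.span_base) (use f in \<open>auto simp: supp_def\<close>)
  then show "f \<in> mp.span (xmon ` X)"
    using mpoly_expand[of f] by (simp add: Const_times_single)
qed

lemma independent_xmon: "mp.independent (xmon ` X :: ('x, 'k::field) mpoly set)"
  unfolding mp.independent_explicit_finite_subsets
proof (intro allI impI ballI)
  fix S :: "('x, 'k) mpoly set" and u v
  assume S: "S \<subseteq> xmon ` X" "finite S" "(\<Sum>v\<in>S. Const (u v) * v) = 0" "v \<in> S"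
  obtain m where m: "v = xmon m" using S by blast
  have "0 = lookup (\<Sum>v\<in>S. Const (u v) * v) m" using S by simp
  also have "\<dots> = (\<Sum>w\<in>S. u w * lookup w m)"
    by (simp add: lookup_sum lookup_Const_times)
  also have "\<dots> = (\<Sum>w\<in>{v}. u w * lookup w m)"
  proof (rule sum.mono_neutral_right)
    show "\<forall>w\<in>S - {v}. u w * lookup w m = 0"
    proof
      fix w assume w: "w \<in> S - {v}"
      then obtain n where "w = xmon n" using S(1) by blast
      then show "u w * lookup w m = 0"
        using w m by (cases "n = m") (auto simp: lookup_single)
    qed
  qed (use S in auto)
  finally show "u v = 0" using m by simp
qed

lemma span_xmon_eq: "mp.span (xmon ` X) = (supp X :: ('x, 'k::field) mpoly set)"
  by (rule mp.span_subspace) (auto simp: supp_subset_span subspace_supp)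

lemma fdim_supp: "finite X \<Longrightarrow> mp.fdim (supp X :: ('x, 'k::field) mpoly set)"
  unfolding mp.fdim_def using supp_subset_span by blast

lemma dim_supp: "mp.dim (supp X :: ('x, 'k::field) mpoly set) = card X"
proof -
  have "inj_on (xmon :: 'x monomial \<Rightarrow> ('x, 'k) mpoly) X"
    by (rule inj_onI) (metis keys_single singleton_inject zero_neq_one)
  then have "card (xmon ` X :: ('x, 'k) mpoly set) = card X" by (rule card_image)
  moreover have "mp.dim (mp.span (xmon ` X :: ('x, 'k) mpoly set)) = card (xmon ` X :: ('x, 'k) mpoly set)"
    by (rule mp.dim_span_eq_card_independent[OF independent_xmon])
  ultimately show ?thesis by (simp only: span_xmon_eq)
qed

section \<open>Degrees, and the monomials of a given degree\<close>

lemma mdeg_eq_sum: "finite A \<Longrightarrow> keys m \<subseteq> A \<Longrightarrow> mdeg m = (\<Sum>i\<in>A. lookup m i)"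
  unfolding mdeg_def by (rule sum.mono_neutral_left) (auto simp: in_keys_iff)

lemma keys_add_monomial: "keys (m + n) = keys m \<union> keys (n :: 'x monomial)"
  by (auto simp: in_keys_iff lookup_add)

lemma mdeg_add [simp]: "mdeg (m + n) = mdeg m + mdeg n"
  using mdeg_eq_sum[of "keys m \<union> keys n" m]
    mdeg_eq_sum[of "keys m \<union> keys n" n]
    mdeg_eq_sum[of "keys m \<union> keys n" "m + n"]
  by (simp add: keys_add_monomial lookup_add sum.distrib)

lemma mdeg_0 [simp]: "mdeg 0 = 0"
  by (simp add: mdeg_def)

lemma mdeg_single [simp]: "mdeg (Poly_Mapping.single i k) = k"
  by (cases "k = 0") (simp_all add: mdeg_def)

definition mons :: "nat \<Rightarrow> nat monomial set" where
  "mons l = {m. keys m \<subseteq> {1..l}}"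

definition mon :: "nat \<Rightarrow> nat \<Rightarrow> nat monomial set" where
  "mon l d = {m \<in> mons l. mdeg m = d}"

lemma mons_add: "m \<in> mons l \<Longrightarrow> n \<in> mons l \<Longrightarrow> m + n \<in> mons l"
  by (simp add: mons_def keys_add_monomial)

lemma mon_add: "m \<in> mon l d \<Longrightarrow> n \<in> mon l e \<Longrightarrow> m + n \<in> mon l (d + e)"
  by (simp add: mon_def mons_add)

lemma mon_subset: "mon l d \<subseteq> mons l"
  by (auto simp: mon_def)

lemma finite_mon: "finite (mon l d)"
proof -
  have "inj_on (\<lambda>m. restrict (lookup m) {1..l}) (mon l d)"
  proof (rule inj_onI)
    fix m n assume mn: "m \<in> mon l d" "n \<in> mon l d"
      "restrict (lookup m) {1..l} = restrict (lookup n) {1..l}"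
    show "m = n"
    proof (rule poly_mapping_eqI)
      fix i show "lookup m i = lookup n i"
      proof (cases "i \<in> {1..l}")
        case True
        then show ?thesis using fun_cong[OF mn(3), of i] by (simp only: restrict_apply if_True)
      next
        case False
        then have "i \<notin> keys m" "i \<notin> keys n"
          using mn(1,2) by (auto simp: mon_def mons_def)
        then show ?thesis by (simp add: in_keys_iff)
      qed
    qed
  qed
  moreover have "(\<lambda>m. restrict (lookup m) {1..l}) ` mon l d \<subseteq> {1..l} \<rightarrow>\<^sub>E {..d}"
  proof clarify
    fix m assume m: "m \<in> mon l d"
    have "lookup m i \<le> d" for i
    proof (cases "i \<in> keys m")
      case True
      then have "lookup m i \<le> mdeg m" unfolding mdeg_def by (intro member_le_sum) auto
      then show ?thesis using m by (simp add: mon_def)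
    qed (simp add: in_keys_iff)
    then show "restrict (lookup m) {1..l} \<in> {1..l} \<rightarrow>\<^sub>E {..d}" by auto
  qed
  ultimately show ?thesis
    by (meson finite_PiE finite_atLeastAtMost finite_atMost finite_imageD finite_subset)
qed

section \<open>The graded polynomial ring and its ideals\<close>

lemma carrier_poly_ring: "polys l = supp (mons l)"
  by (auto simp: poly_ring_def supp_def mons_def vars_def)

lemma homog_part_eq: "homog_part l d = supp (mon l d)"
  unfolding homog_part_def carrier_poly_ring by (auto simp: supp_def mon_def)

lemma poly_ring_simps [simp]: "monoid.mult (poly_ring l) = (*)" "one (poly_ring l) = 1" "zero (poly_ring l) = 0" "add (poly_ring l) = (+)"
  by (simp_all add: poly_ring_def)

lemma homog_mult: "f \<in> homog_part l d \<Longrightarrow> g \<in> homog_part l e \<Longrightarrow> f * g \<in> homog_part l (d + e)"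
  unfolding homog_part_eq by (rule supp_mult) (auto simp: mon_add)

lemma homog_carrier: "homog_part l d \<subseteq> polys l"
  unfolding homog_part_eq carrier_poly_ring by (rule supp_mono[OF mon_subset])

lemma Const_homog [simp]: "Const c \<in> homog_part l 0"
  by (simp add: homog_part_eq Const_def mon_def mons_def)

lemma Var_homog [simp]: "i \<in> {1..l} \<Longrightarrow> Var i \<in> homog_part l 1"
  by (simp add: homog_part_eq Var_def mon_def mons_def)

lemma homog_power: "f \<in> homog_part l d \<Longrightarrow> f ^ n \<in> homog_part l (n * d)"
  by (induction n) (auto simp: homog_mult Const_homog[of 1, simplified])

lemma carrier_mult: "f \<in> polys l \<Longrightarrow> g \<in> polys l \<Longrightarrow> f * g \<in> polys l"
  unfolding carrier_poly_ring by (rule supp_mult) (auto simp: mons_add)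

lemma Const_carrier [simp]: "Const c \<in> polys l"
  using Const_homog homog_carrier by blast

lemma one_carrier [simp]: "1 \<in> polys l"
  using Const_carrier[of 1] by simp

lemma cring_poly_ring: "cring (poly_ring l :: (nat, 'k::comm_ring_1) mpoly ring)"
proof (rule cringI)
  show "abelian_group (poly_ring l :: (nat, 'k) mpoly ring)"
  proof (rule abelian_groupI)
    fix x :: "(nat, 'k) mpoly" assume x: "x \<in> polys l"
    then have "- x \<in> polys l" by (simp add: carrier_poly_ring supp_def)
    then show "\<exists>y\<in>polys l. y \<oplus>\<^bsub>poly_ring l\<^esub> x = \<zero>\<^bsub>poly_ring l\<^esub>" by (intro bexI[of _ "- x"]) auto
  qed (auto simp: carrier_poly_ring supp_add ac_simps)
  show "Group.comm_monoid (poly_ring l :: (nat, 'k) mpoly ring)"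
    by (rule Group.comm_monoidI) (auto simp: carrier_mult ac_simps)
qed (simp add: algebra_simps)

lemma ring_poly_ring: "ring (poly_ring l :: (nat, 'k::comm_ring_1) mpoly ring)"
  using cring_poly_ring cring.axioms(1) by blast

text \<open>Negatives are multiples by the constant -1, so closure under sums and under
  multiplication by ring elements is enough.\<close>

lemma ideal_poly_ring_iff:
  "ideal J (poly_ring l :: (nat, 'k::comm_ring_1) mpoly ring) \<longleftrightarrow>
    J \<subseteq> polys l \<and> 0 \<in> J \<and> (\<forall>f\<in>J. \<forall>g\<in>J. f + g \<in> J) \<and> (\<forall>f\<in>J. \<forall>a\<in>polys l. a * f \<in> J)"
  (is "_ \<longleftrightarrow> ?R")
proof
  assume "ideal J (poly_ring l)"
  then interpret ideal J "poly_ring l" .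
  show ?R
    using a_subset additive_subgroup.zero_closed[OF additive_subgroup_axioms]
      additive_subgroup.a_closed[OF additive_subgroup_axioms] I_l_closed by auto
next
  assume R: ?R
  have neg: "- f \<in> J" if "f \<in> J" for f
  proof -
    have "Const (- 1) * f \<in> J" using R that by auto
    then show ?thesis by (simp add: Const_def single_uminus)
  qed
  show "ideal J (poly_ring l)"
  proof (rule idealI[OF ring_poly_ring])
    interpret G: ring "poly_ring l :: (nat, 'k) mpoly ring" by (rule ring_poly_ring)
    show "subgroup J (add_monoid (poly_ring l))"
    proof (rule group.subgroupI[OF G.a_group])
      fix f assume f: "f \<in> J"
      then have "f \<in> polys l" "- f \<in> polys l"
        using R neg by blast+
      then have "inv\<^bsub>add_monoid (poly_ring l)\<^esub> f = - f"
        unfolding a_inv_def[symmetric] by (intro G.minus_equality) simp_all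
      then show "inv\<^bsub>add_monoid (poly_ring l)\<^esub> f \<in> J" using neg[OF f] by simp
    qed (use R in auto)
  qed (use R in \<open>auto simp: mult.commute\<close>)
qed

lemma zero_carrier: "0 \<in> polys l"
  by (simp add: carrier_poly_ring)

lemma ideal_carrier: "ideal J (poly_ring l) \<Longrightarrow> J \<subseteq> carrier (poly_ring l :: (nat, 'k::comm_ring_1) mpoly ring)"
  by (simp add: ideal_poly_ring_iff)

lemma ideal_mult: "ideal J (poly_ring l) \<Longrightarrow> a \<in> polys l \<Longrightarrow> f \<in> J \<Longrightarrow> a * f \<in> (J :: (nat, 'k::comm_ring_1) mpoly set)"
  by (simp add: ideal_poly_ring_iff)

lemma ideal_poly_ring_subspace:
  "ideal J (poly_ring l :: (nat, 'k::field) mpoly ring) \<Longrightarrow> mp.subspace J"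
  unfolding ideal_poly_ring_iff by (rule mp.subspaceI) auto


section \<open>Hilbert functions\<close>

definition hc :: "nat \<Rightarrow> ('x, 'k::comm_monoid_add) mpoly \<Rightarrow> ('x, 'k) mpoly" where
  "hc d f = (\<Sum>m \<in> {m \<in> keys f. mdeg m = d}. Poly_Mapping.single m (lookup f m))"

lemma lookup_hc: "lookup (hc d f) m = (if mdeg m = d then lookup f m else 0)"
proof -
  have "lookup (hc d f) m =
    (\<Sum>n \<in> {n \<in> keys f. mdeg n = d}. if n = m then lookup f m else 0)"
    unfolding hc_def lookup_sum by (rule sum.cong) (auto simp: lookup_single when_def)
  then show ?thesis by (auto simp: in_keys_iff)
qed

lemma hc_add: "hc d (f + g) = hc d f + hc d g"
  by (rule poly_mapping_eqI) (simp add: lookup_hc lookup_add)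

lemma hc_0 [simp]: "hc d 0 = 0"
  by (rule poly_mapping_eqI) (simp add: lookup_hc)

lemma hc_sum: "hc d (\<Sum>i\<in>A. f i) = (\<Sum>i\<in>A. hc d (f i))"
  by (induction A rule: infinite_finite_induct) (auto simp: hc_add)

lemma hc_single: "hc d (Poly_Mapping.single m c) = (if mdeg m = d then Poly_Mapping.single m c else 0)"
  by (rule poly_mapping_eqI) (auto simp: lookup_hc lookup_single when_def)

lemma hc_supp: "f \<in> supp X \<Longrightarrow> hc d f \<in> supp {m \<in> X. mdeg m = d}"
  unfolding supp_iff by (auto simp: lookup_hc split: if_splits)

lemma hc_homog: "f \<in> polys l \<Longrightarrow> hc d f \<in> homog_part l d"
  unfolding carrier_poly_ring homog_part_eq mon_def by (rule hc_supp)

lemma hc_of_homog: "f \<in> homog_part l d \<Longrightarrow> hc e f = (if e = d then f else 0)"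
  unfolding homog_part_eq supp_iff
  by (intro poly_mapping_eqI) (auto simp: lookup_hc mon_def)

lemma sum_hc: "finite D \<Longrightarrow> mdeg ` keys f \<subseteq> D \<Longrightarrow> f = (\<Sum>d\<in>D. hc d f)"
  by (rule poly_mapping_eqI) (auto simp: lookup_sum lookup_hc, metis image_eqI in_keys_iff subsetD)

lemma hc_mult_single:
  "hc d (Poly_Mapping.single m c * f) =
    (if mdeg m \<le> d then Poly_Mapping.single m c * hc (d - mdeg m) (f :: ('x, 'k::comm_ring_1) mpoly) else 0)"
proof (induction f rule: mpoly_induct)
  case (single n b)
  show ?case by (auto simp: mult_single hc_single)
qed (auto simp: algebra_simps hc_add)

lemma hc_mult_homog:
  assumes g: "g \<in> homog_part l s"
  shows "hc d (g * f) = (if s \<le> d then g * hc (d - s) f else 0)"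
proof -
  have "hc d (g * f) = (\<Sum>m\<in>keys g. hc d (Poly_Mapping.single m (lookup g m) * f))"
    by (subst mpoly_expand[of g]) (simp only: sum_distrib_right hc_sum)
  also have "\<dots> = (\<Sum>m\<in>keys g. if s \<le> d then Poly_Mapping.single m (lookup g m) * hc (d - s) f else 0)"
    by (rule sum.cong) (use g in \<open>auto simp: hc_mult_single homog_part_def\<close>)
  also have "\<dots> = (if s \<le> d then g * hc (d - s) f else 0)"
    by (subst (3) mpoly_expand[of g]) (simp add: sum_distrib_right)
  finally show ?thesis .
qed

text \<open>Homogeneity without a choice of generators: sums of ideals and images under coordinate
  changes are easily seen to keep this property.\<close>

definition homog_ideal :: "nat \<Rightarrow> (nat, 'k::comm_ring_1) mpoly set \<Rightarrow> bool" where
  "homog_ideal l J \<longleftrightarrow> ideal J (poly_ring l) \<and> (\<forall>f\<in>J. \<forall>d. hc d f \<in> J)"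

lemma homog_ideal_ideal: "homog_ideal l J \<Longrightarrow> ideal J (poly_ring l)"
  by (simp add: homog_ideal_def)

lemma ideal_sum:
  "ideal J (poly_ring l) \<Longrightarrow> (\<And>i. i \<in> A \<Longrightarrow> f i \<in> J) \<Longrightarrow> sum f A \<in> (J :: (nat, 'k::comm_ring_1) mpoly set)"
  unfolding ideal_poly_ring_iff by (induction A rule: infinite_finite_induct) auto

text \<open>The polynomials all of whose components lie in the generated ideal form an ideal
  themselves, and it contains the homogeneous generators.\<close>

lemma homog_ideal_genideal:
  assumes G: "G \<subseteq> (\<Union>d. homog_part l d :: (nat, 'k::comm_ring_1) mpoly set)"
  shows "homog_ideal l (gen_ideal l G)"
proof -
  interpret R: ring "poly_ring l :: (nat, 'k) mpoly ring" by (rule ring_poly_ring)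
  have Gc: "G \<subseteq> polys l" using G homog_carrier by blast
  let ?J = "gen_ideal l G"
  have J: "ideal ?J (poly_ring l)" by (rule R.genideal_ideal[OF Gc])
  let ?Q = "{f \<in> polys l. \<forall>d. hc d f \<in> ?J}"
  have "ideal ?Q (poly_ring l)" unfolding ideal_poly_ring_iff
  proof (intro conjI ballI)
    show "0 \<in> ?Q" using J unfolding ideal_poly_ring_iff by (simp add: carrier_poly_ring)
    show "f + g \<in> ?Q" if "f \<in> ?Q" "g \<in> ?Q" for f g
      using J that unfolding ideal_poly_ring_iff by (simp add: carrier_poly_ring hc_add supp_add)
    show "a * f \<in> ?Q" if f: "f \<in> ?Q" and a: "a \<in> polys l" for f a
    proof -
      have "hc d (a * f) \<in> ?J" for d
      proof -
        have "hc d (a * f) = hc d (\<Sum>e\<in>mdeg ` keys a. hc e a * f)"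
          by (subst sum_hc[of "mdeg ` keys a" a]) (auto simp: sum_distrib_right)
        also have "\<dots> = (\<Sum>e\<in>mdeg ` keys a. hc d (hc e a * f))" by (rule hc_sum)
        also have "\<dots> \<in> ?J"
        proof (rule ideal_sum[OF J])
          fix e
          have "hc e a \<in> polys l" using hc_homog[OF a] homog_carrier by blast
          then show "hc d (hc e a * f) \<in> ?J"
            using J f unfolding hc_mult_homog[OF hc_homog[OF a]] ideal_poly_ring_iff by auto
        qed
        finally show ?thesis .
      qed
      then show ?thesis using a f by (auto simp: carrier_mult)
    qed
  qed auto
  moreover have "G \<subseteq> ?Q"
  proof
    fix g assume g: "g \<in> G"
    then obtain d where "g \<in> homog_part l d" using G by blast
    then have "hc e g \<in> ?J" for e
      using hc_of_homog[of g l d e] R.genideal_self[OF Gc] g J unfolding ideal_poly_ring_iff by auto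
    then show "g \<in> ?Q" using g Gc by blast
  qed
  ultimately have "?J \<subseteq> ?Q" by (rule R.genideal_minimal)
  then show ?thesis using J unfolding homog_ideal_def by blast
qed

lemma homogeneous_ideal_imp: "homogeneous_ideal l I \<Longrightarrow> homog_ideal l I"
  unfolding homogeneous_ideal_def using homog_ideal_genideal by blast

section \<open>Enlarging an ideal by generators\<close>

lemma
  assumes J: "ideal J (poly_ring l)" and G: "G \<subseteq> carrier (poly_ring l :: (nat, 'k::comm_ring_1) mpoly ring)"
  shows ideal_add_gens: "ideal (add_gens l J G) (poly_ring l)"
    and add_gens_eq: "add_gens l J G = {a + b |a b. a \<in> J \<and> b \<in> gen_ideal l G}"
    and subset_add_gens: "J \<subseteq> add_gens l J G"
    and gens_subset_add_gens: "G \<subseteq> add_gens l J G"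
proof -
  interpret R: ring "poly_ring l :: (nat, 'k) mpoly ring" by (rule ring_poly_ring)
  have I: "ideal (gen_ideal l G) (poly_ring l)" by (rule R.genideal_ideal[OF G])
  show "ideal (add_gens l J G) (poly_ring l)" unfolding add_gens_def by (rule R.add_ideals[OF J I])
  show eq: "add_gens l J G = {a + b |a b. a \<in> J \<and> b \<in> gen_ideal l G}"
    unfolding add_gens_def set_add_def' by auto
  have 0: "0 \<in> J" "0 \<in> gen_ideal l G" using I J unfolding ideal_poly_ring_iff by blast+
  have "x = x + 0" "x = 0 + x" for x :: "(nat, 'k) mpoly" by simp_all
  then show "J \<subseteq> add_gens l J G" "G \<subseteq> add_gens l J G"
    unfolding eq using 0 R.genideal_self[OF G] by blast+
qed

lemma add_gens_minimal:
  assumes K: "ideal K (poly_ring l)" "J \<subseteq> K" "G \<subseteq> K"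
  shows "add_gens l J G \<subseteq> (K :: (nat, 'k::comm_ring_1) mpoly set)"
proof -
  interpret R: ring "poly_ring l :: (nat, 'k) mpoly ring" by (rule ring_poly_ring)
  have "gen_ideal l G \<subseteq> K" by (rule R.genideal_minimal[OF K(1,3)])
  then have "x + y \<in> K" if "x \<in> J" "y \<in> gen_ideal l G" for x y
    using that K unfolding ideal_poly_ring_iff by (meson subsetD)
  then show ?thesis unfolding add_gens_def set_add_def' by auto
qed

lemma add_gens_Un:
  assumes J: "ideal J (poly_ring l)" and G: "G \<subseteq> polys l" "H \<subseteq> carrier (poly_ring l :: (nat, 'k::comm_ring_1) mpoly ring)"
  shows "add_gens l J (G \<union> H) = add_gens l (add_gens l J G) H"
proof
  note 1 = ideal_add_gens[OF J G(1)]
  note 2 = ideal_add_gens[OF 1 G(2)]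
  show "add_gens l J (G \<union> H) \<subseteq> add_gens l (add_gens l J G) H"
    by (rule add_gens_minimal[OF 2])
      (use subset_add_gens[OF 1 G(2)] subset_add_gens[OF J G(1)] gens_subset_add_gens[OF 1 G(2)]
        gens_subset_add_gens[OF J G(1)] in auto)
  have GH: "G \<union> H \<subseteq> polys l" using G by blast
  note 3 = ideal_add_gens[OF J GH]
  show "add_gens l (add_gens l J G) H \<subseteq> add_gens l J (G \<union> H)"
    by (intro add_gens_minimal 3) (use subset_add_gens[OF J GH] gens_subset_add_gens[OF J GH] in auto)
qed

lemma add_gens_empty:
  assumes J: "ideal J (poly_ring l)"
  shows "add_gens l J {} = (J :: (nat, 'k::comm_ring_1) mpoly set)"
  using add_gens_minimal[OF J, of J "{}"] subset_add_gens[OF J, of "{}"] by blast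

lemma homog_ideal_add_gens:
  assumes J: "homog_ideal l J" and G: "G \<subseteq> (\<Union>d. homog_part l d :: (nat, 'k::comm_ring_1) mpoly set)"
  shows "homog_ideal l (add_gens l J G)"
proof -
  have Gc: "G \<subseteq> polys l" using G homog_carrier by blast
  note J' = homog_ideal_ideal[OF J]
  show ?thesis unfolding homog_ideal_def
  proof (intro conjI ballI allI)
    fix f d assume "f \<in> add_gens l J G"
    then obtain a b where "f = a + b" "a \<in> J" "b \<in> gen_ideal l G"
      unfolding add_gens_eq[OF J' Gc] by blast
    then have "hc d f = hc d a + hc d b" "hc d a \<in> J" "hc d b \<in> gen_ideal l G"
      using J homog_ideal_genideal[OF G] by (auto simp: hc_add homog_ideal_def)
    then show "hc d f \<in> add_gens l J G" unfolding add_gens_eq[OF J' Gc] by blast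
  qed (rule ideal_add_gens[OF J' Gc])
qed

lemma add_gens_single:
  assumes J: "ideal J (poly_ring l)" and g: "g \<in> carrier (poly_ring l :: (nat, 'k::comm_ring_1) mpoly ring)"
  shows "add_gens l J {g} = {g * a + b |a b. a \<in> polys l \<and> b \<in> J}"
proof -
  interpret R: cring "poly_ring l :: (nat, 'k) mpoly ring" by (rule cring_poly_ring)
  have "gen_ideal l {g} = {g * a |a. a \<in> polys l}"
    using R.cgenideal_eq_genideal[OF g] unfolding cgenideal_def by (simp add: mult.commute)
  then show ?thesis using add_gens_eq[OF J, of "{g}"] g by (auto simp: add.commute)
qed

text \<open>Take the component of degree \<open>d\<close> in \<open>f = g * a + b\<close>: as
  \<open>g\<close> is homogeneous, only the component of \<open>a\<close> in the complementary
  degree contributes. Below the degree of \<open>g\<close> nothing is added; this case is separate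
  because \<open>d - s\<close> is truncated.\<close>

lemma add_gens_homog_part:
  assumes J: "homog_ideal l J" and g: "g \<in> (homog_part l s :: (nat, 'k::comm_ring_1) mpoly set)"
  shows "add_gens l J {g} \<inter> homog_part l d =
    (if s \<le> d then {g * a + b |a b. a \<in> homog_part l (d - s) \<and> b \<in> J \<inter> homog_part l d}
     else J \<inter> homog_part l d)"
proof -
  note J' = homog_ideal_ideal[OF J]
  have gc: "g \<in> polys l" using g homog_carrier by blast
  have 1: "f \<in> (if s \<le> d then {g * a + b |a b. a \<in> homog_part l (d - s) \<and> b \<in> J \<inter> homog_part l d}
     else J \<inter> homog_part l d)" if f: "f \<in> add_gens l J {g}" "f \<in> homog_part l d" for f
  proof -
    obtain a b where ab: "f = g * a + b" "a \<in> polys l" "b \<in> J"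
      using f(1) unfolding add_gens_single[OF J' gc] by blast
    have "f = hc d f" using hc_of_homog[OF f(2), of d] by simp
    then have "f = (if s \<le> d then g * hc (d - s) a else 0) + hc d b"
      unfolding ab(1) by (simp add: hc_add hc_mult_homog[OF g])
    moreover have "b \<in> polys l" "hc d b \<in> J"
      using ab(3) J J' unfolding homog_ideal_def ideal_poly_ring_iff by (blast, simp)
    moreover from this have "hc d b \<in> J \<inter> homog_part l d" using hc_homog by blast
    ultimately show ?thesis using hc_homog[OF ab(2), of "d - s"] by auto
  qed
  have 2: "g * a + b \<in> add_gens l J {g} \<inter> homog_part l d"
    if "s \<le> d" "a \<in> homog_part l (d - s)" "b \<in> J \<inter> homog_part l d" for a b
  proof -
    have "g * a \<in> homog_part l d" using homog_mult[OF g that(2)] that(1) by simp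
    then show ?thesis using that homog_carrier[of l "d - s"] unfolding add_gens_single[OF J' gc] homog_part_eq
      by (auto simp: supp_add)
  qed
  have 3: "J \<subseteq> add_gens l J {g}" using subset_add_gens[OF J', of "{g}"] gc by simp
  show ?thesis using 1 2 3 by (cases "s \<le> d") (auto 0 3)
qed

section \<open>Dimensions of the graded pieces of a quotient\<close>

lemma subspace_homog: "mp.subspace (homog_part l d :: (nat, 'k::field) mpoly set)"
  unfolding homog_part_eq by (rule subspace_supp)

lemma fdim_homog: "mp.fdim (homog_part l d :: (nat, 'k::field) mpoly set)"
  unfolding homog_part_eq by (rule fdim_supp[OF finite_mon])

lemma subspace_ideal_part: "ideal J (poly_ring l) \<Longrightarrow> mp.subspace (J \<inter> homog_part l d :: (nat, 'k::field) mpoly set)"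
  using ideal_poly_ring_subspace subspace_homog mp.subspace_inter by blast

lemma fdim_ideal_part: "mp.fdim (J \<inter> homog_part l d :: (nat, 'k::field) mpoly set)"
  using fdim_homog mp.fdim_subset Int_lower2 by blast

lemma coset_eq_iff:
  assumes J: "ideal J (poly_ring l)" and "f \<in> polys l" "g \<in> polys l"
  shows "J +>\<^bsub>poly_ring l\<^esub> f = J +>\<^bsub>poly_ring l\<^esub> g \<longleftrightarrow> f - g \<in> (J :: (nat, 'k::comm_ring_1) mpoly set)"
proof -
  interpret R: ring "poly_ring l :: (nat, 'k) mpoly ring" by (rule ring_poly_ring)
  have "- g \<in> polys l" using assms(3) by (simp add: carrier_poly_ring supp_def)
  then have "\<ominus>\<^bsub>poly_ring l\<^esub> g = - g" by (intro R.minus_equality) (use assms(3) in simp_all)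
  then have "f \<ominus>\<^bsub>poly_ring l\<^esub> g = f - g" by (simp add: a_minus_def)
  then show ?thesis using R.quotient_eq_iff_same_a_r_cos[OF assms] by simp
qed

text \<open>Translates \<open>ring.dimension\<close> in the quotient into the vector space of
  polynomials: a basis of \<open>E\<close> lifts to an independent set whose span meets
  \<open>J\<close> only in 0. The proof is by induction on the rules of
  \<open>ring.dimension\<close>, since the classes of constants are no subfield when
  \<open>J\<close> is the whole ring.\<close>

lemma dimension_quot_aux:
  fixes J :: "(nat, 'k::field) mpoly set"
  assumes J: "ideal J (poly_ring l)" and V: "mp.subspace V" "V \<subseteq> polys l"
  defines "Q \<equiv> poly_ring l Quot J" and "h \<equiv> (\<lambda>f. J +>\<^bsub>poly_ring l\<^esub> f)"
  shows dimension_quotD: "ring.dimension Q n ((\<lambda>c. h (Const c)) ` UNIV) E \<Longrightarrow> E \<subseteq> h ` V \<Longrightarrow>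
      \<exists>B. finite B \<and> card B = n \<and> B \<subseteq> V \<and> E = h ` mp.span B \<and> mp.independent B \<and> mp.span B \<inter> J = {0}"
    and dimension_quotI: "finite B \<Longrightarrow> B \<subseteq> V \<Longrightarrow> mp.independent B \<Longrightarrow> mp.span B \<inter> J = {0} \<Longrightarrow>
      ring.dimension Q (card B) ((\<lambda>c. h (Const c)) ` UNIV) (h ` mp.span B)"
proof -
  interpret J: ideal J "poly_ring l" by (rule J)
  interpret h: ring_hom_ring "poly_ring l" Q h unfolding Q_def h_def by (rule J.rcos_ring_hom_ring)
  have Q: "ring Q" by (rule h.S.ring_axioms)
  have heq: "h f = h g \<longleftrightarrow> f - g \<in> J" if "f \<in> V" "g \<in> V" for f g
    unfolding h_def by (rule coset_eq_iff[OF J]) (use that V(2) in auto)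
  let ?K = "(\<lambda>c. h (Const c)) ` UNIV"
  have line: "ring.line_extension Q ?K (h v) (h ` mp.span B) = h ` mp.span (insert v B)"
    if "v \<in> V" "B \<subseteq> V" for v B
  proof -
    have spV: "mp.span B \<subseteq> V" by (rule mp.span_minimal[OF that(2) V(1)])
    have hline: "h (Const c) \<otimes>\<^bsub>Q\<^esub> h v \<oplus>\<^bsub>Q\<^esub> h b = h (Const c * v + b)" if "b \<in> mp.span B" for c b
    proof -
      have "v \<in> polys l" "b \<in> polys l"
        using that spV \<open>v \<in> V\<close> V(2) by auto
      then show ?thesis using carrier_mult[OF Const_carrier, of v l c]
          h.hom_mult[of "Const c" v] h.hom_add[of "Const c * v" b] by simp
    qed
    have "ring.line_extension Q ?K (h v) (h ` mp.span B) = {h (Const c * v + b) |c b. b \<in> mp.span B}"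
      unfolding h.S.line_extension_def set_add_def' r_coset_def using hline
      by (auto; metis)
    also have "\<dots> = h ` mp.span (insert v B)"
    proof -
      have "mp.span (insert v B) = {Const c * v + b |c b. b \<in> mp.span B}"
        unfolding mp.span_insert
        by (auto; metis add.commute diff_add_cancel add_diff_cancel_left')
      then show ?thesis by auto
    qed
    finally show ?thesis .
  qed
  have h0: "{\<zero>\<^bsub>Q\<^esub>} = h ` mp.span {}" using h.hom_zero by simp
  \<comment> \<open>One step of the induction: a vector keeps the set independent modulo
    \<open>J\<close> exactly when its class is outside the space reached so far, which is the
    premise under which \<open>ring.dimension\<close> grows.\<close>
  have step: "mp.independent (insert v B) \<and> mp.span (insert v B) \<inter> J = {0} \<and> v \<notin> B \<longleftrightarrow> h v \<notin> h ` mp.span B"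
    if v: "v \<in> V" and B: "B \<subseteq> V" "mp.independent B" "mp.span B \<inter> J = {0}" for v B
  proof
    have spV: "mp.span B \<subseteq> V" by (rule mp.span_minimal[OF B(1) V(1)])
    assume L: "mp.independent (insert v B) \<and> mp.span (insert v B) \<inter> J = {0} \<and> v \<notin> B"
    show "h v \<notin> h ` mp.span B"
    proof
      assume "h v \<in> h ` mp.span B"
      then obtain b where b: "b \<in> mp.span B" "v - b \<in> J" using heq v spV by blast
      have "b \<in> mp.span (insert v B)" using b(1) mp.span_mono[of B "insert v B"] by blast
      from mp.span_diff[OF mp.span_base this] have "v - b \<in> mp.span (insert v B)" by simp
      then have "v - b \<in> {0}" using L b(2) by blast
      then have "v = b" by simp
      moreover have "v \<notin> mp.span B" using L mp.independent_insert[of v B] by metis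
      ultimately show False using b(1) by blast
    qed
  next
    have spV: "mp.span B \<subseteq> V" by (rule mp.span_minimal[OF B(1) V(1)])
    assume nv: "h v \<notin> h ` mp.span B"
    then have 1: "v \<notin> mp.span B" by blast
    have "mp.span (insert v B) \<inter> J \<subseteq> {0}"
    proof
      fix x assume x: "x \<in> mp.span (insert v B) \<inter> J"
      then obtain c where c: "x - Const c * v \<in> mp.span B" unfolding mp.span_insert by blast
      have "c = 0"
      proof (rule ccontr)
        assume c0: "c \<noteq> 0"
        \<comment> \<open>The decomposition of \<open>x\<close> solved for \<open>v\<close>: since
          \<open>x\<close> lies in \<open>J\<close>, dividing by \<open>c\<close> makes
          \<open>v\<close> congruent to \<open>?b\<close> modulo \<open>J\<close>.\<close>
        let ?b = "Const (- inverse c) * (x - Const c * v)"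
        have b: "?b \<in> mp.span B" using c mp.span_scale by blast
        have "v - ?b = Const (inverse c) * x"
          using c0 by (simp add: algebra_simps Const_mult[symmetric] mult.assoc[symmetric])
            (simp add: Const_def single_uminus)
        then have "v - ?b \<in> J" using x J unfolding ideal_poly_ring_iff by auto
        then show False using nv b heq[of v ?b] v spV by blast
      qed
      then show "x \<in> {0}" using c x B(3) by auto
    qed
    moreover have "0 \<in> mp.span (insert v B) \<inter> J"
      using mp.span_zero J unfolding ideal_poly_ring_iff by simp
    ultimately have "mp.span (insert v B) \<inter> J = {0}" by auto
    moreover have "mp.independent (insert v B)" by (rule mp.independent_insertI[OF 1 B(2)])
    moreover have "v \<notin> B" using 1 mp.span_base by blast
    ultimately show "mp.independent (insert v B) \<and> mp.span (insert v B) \<inter> J = {0} \<and> v \<notin> B"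
      by blast
  qed
  have carr: "E \<subseteq> carrier Q \<and> \<zero>\<^bsub>Q\<^esub> \<in> E" if "h.S.dimension n ?K E" for n E
    using that
  proof (induction n ?K E rule: h.S.dimension.induct)
    case (Suc_dim v E n)
    have K: "h (Const c) \<in> carrier Q" for c by (rule h.hom_closed) simp
    have "h (Const 0) \<otimes>\<^bsub>Q\<^esub> v \<oplus>\<^bsub>Q\<^esub> \<zero>\<^bsub>Q\<^esub> = \<zero>\<^bsub>Q\<^esub>"
      using Suc_dim.hyps(1) h.hom_zero by auto
    moreover have "h (Const c) \<otimes>\<^bsub>Q\<^esub> v \<oplus>\<^bsub>Q\<^esub> e \<in> carrier Q" if "e \<in> E" for c e
      using K Suc_dim that by auto
    ultimately show ?case
      using Suc_dim unfolding h.S.line_extension_def set_add_def' r_coset_def by (auto; metis)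
  qed simp
  have D: "\<exists>B. finite B \<and> card B = n \<and> B \<subseteq> V \<and> E = h ` mp.span B \<and> mp.independent B \<and> mp.span B \<inter> J = {0}"
    if "h.S.dimension n ?K E" "E \<subseteq> h ` V"
    using that
  proof (induction n ?K E rule: h.S.dimension.induct)
    case zero_dim
    have "0 \<in> J" using J ideal_poly_ring_iff by blast
    then show ?case using h0 mp.independent_empty by (intro exI[of _ "{}"]) auto
  next
    case (Suc_dim v E n)
    note E = carr[OF Suc_dim.hyps(3)]
    have "E \<subseteq> h.S.line_extension ?K v E"
    proof
      fix e assume e: "e \<in> E"
      have "h (Const 0) \<otimes>\<^bsub>Q\<^esub> v \<oplus>\<^bsub>Q\<^esub> e = e"
        using Suc_dim.hyps(1) E e h.hom_zero by auto
      then show "e \<in> h.S.line_extension ?K v E"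
        using e unfolding h.S.line_extension_def set_add_def' r_coset_def by (auto; metis)
    qed
    then have "E \<subseteq> h ` V" using Suc_dim.prems by blast
    then obtain B where B: "finite B" "card B = n" "B \<subseteq> V" "E = h ` mp.span B" "mp.independent B" "mp.span B \<inter> J = {0}"
      using Suc_dim by blast
    have "h (Const 1) \<otimes>\<^bsub>Q\<^esub> v \<oplus>\<^bsub>Q\<^esub> \<zero>\<^bsub>Q\<^esub> = v"
      using Suc_dim.hyps(1) h.hom_one by auto
    then have "v \<in> h.S.line_extension ?K v E"
      using E unfolding h.S.line_extension_def set_add_def' r_coset_def by (auto; metis)
    then obtain w where w: "w \<in> V" "v = h w" using Suc_dim.prems by blast
    note st = step[OF w(1) B(3,5,6)]
    have "mp.independent (insert w B) \<and> mp.span (insert w B) \<inter> J = {0} \<and> w \<notin> B"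
      using st Suc_dim.hyps w B(4) by blast
    then show ?case using B w line[OF w(1) B(3)]
      by (intro exI[of _ "insert w B"]) auto
  qed
  have I: "h.S.dimension (card B) ?K (h ` mp.span B)"
    if "finite B" "B \<subseteq> V" "mp.independent B" "mp.span B \<inter> J = {0}"
    using that
  proof (induction B rule: finite_induct)
    case empty
    then show ?case using h.S.dimension.zero_dim h0 by simp
  next
    case (insert v B)
    have B: "B \<subseteq> V" "mp.independent B" "mp.span B \<inter> J = {0}" and v: "v \<in> V"
      using insert.prems mp.independent_mono[of "insert v B" B] mp.span_mono[of B "insert v B"] mp.span_zero
        J ideal_poly_ring_iff by auto
    have "h v \<notin> h ` mp.span B" using step[OF v B] insert.prems insert.hyps by blast
    moreover have "h v \<in> carrier Q" using v V(2) h.hom_closed by blast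
    ultimately show ?case
      using h.S.dimension.Suc_dim[of "h v" "h ` mp.span B" "card B" ?K] insert.IH[OF B] line[OF v B(1)] insert.hyps by simp
  qed
  show "h.S.dimension n ?K E \<Longrightarrow> E \<subseteq> h ` V \<Longrightarrow>
      \<exists>B. finite B \<and> card B = n \<and> B \<subseteq> V \<and> E = h ` mp.span B \<and> mp.independent B \<and> mp.span B \<inter> J = {0}"
    by (rule D)
  show "finite B \<Longrightarrow> B \<subseteq> V \<Longrightarrow> mp.independent B \<Longrightarrow> mp.span B \<inter> J = {0} \<Longrightarrow>
      h.S.dimension (card B) ?K (h ` mp.span B)"
    by (rule I)
qed

text \<open>A basis of the degree \<open>d\<close> part of \<open>J\<close> and lifts of a basis of
  the quotient part together form a basis of all forms of degree \<open>d\<close>; this determines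
  the \<open>THE\<close> in \<open>HF\<close>. The additive form avoids truncated
  subtraction.\<close>

lemma HF_dim:
  fixes J :: "(nat, 'k::field) mpoly set"
  assumes J: "ideal J (poly_ring l)"
  shows "HF l J d + mp.dim (J \<inter> homog_part l d) = card (mon l d)"
proof -
  let ?S = "homog_part l d :: (nat, 'k) mpoly set" and ?J = "J \<inter> homog_part l d"
  let ?h = "\<lambda>f. J +>\<^bsub>poly_ring l\<^esub> f"
  obtain A where A: "finite A" "A \<subseteq> ?J" "mp.independent A" "mp.span A = ?J" "card A = mp.dim ?J"
    by (rule mp.fdim_basis_subspace[OF subspace_ideal_part[OF J] fdim_ideal_part])
  \<comment> \<open>Vectors that are independent modulo \<open>J\<close> stay independent when the
    basis \<open>A\<close> of \<open>?J\<close> is added to them.\<close>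
  have compl: "card (A \<union> B) = card A + card B \<and> mp.independent (A \<union> B)"
    if B: "finite B" "B \<subseteq> ?S" "mp.independent B" "mp.span B \<inter> J = {0}" for B
  proof -
    have "finite C \<Longrightarrow> C \<subseteq> B \<Longrightarrow> card (A \<union> C) = card A + card C \<and> mp.independent (A \<union> C)" for C
    proof (induction C rule: finite_induct)
      case (insert c C)
      have "c \<notin> mp.span (A \<union> C)"
      proof
        assume "c \<in> mp.span (A \<union> C)"
        then obtain a b where ab: "a \<in> ?J" "b \<in> mp.span C" "c = a + b"
          unfolding mp.span_Un A(4) by blast
        have "c - b \<in> mp.span B"
          using insert.prems ab(2) mp.span_mono[of C B] mp.span_base[of c B] mp.span_diff by blast
        then have "a = 0" using ab B(4) by auto
        then have "c \<in> mp.span (B - {c})"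
          using ab mp.span_mono[of C "B - {c}"] insert by auto
        then show False using B(3) insert.prems unfolding mp.dependent_def by blast
      qed
      moreover then have "c \<notin> A \<union> C" using mp.span_base by blast
      ultimately show ?case using insert mp.independent_insertI[of c "A \<union> C"] A(1) by auto
    qed (use A in simp)
    then show ?thesis using B(1) by blast
  qed
  have main: "ring.dimension (poly_ring l Quot J) n ((\<lambda>c. ?h (Const c)) ` UNIV) (quot_part l J d)
    \<longleftrightarrow> n + mp.dim ?J = card (mon l d)" for n
  proof
    assume dim: "ring.dimension (poly_ring l Quot J) n ((\<lambda>c. ?h (Const c)) ` UNIV) (quot_part l J d)"
    have "quot_part l J d \<subseteq> ?h ` ?S" unfolding quot_part_def by (rule order_refl)
    from dimension_quotD[OF J subspace_homog homog_carrier dim this] obtain B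
      where B: "finite B" "card B = n" "B \<subseteq> ?S" "quot_part l J d = ?h ` mp.span B"
        "mp.independent B" "mp.span B \<inter> J = {0}" by metis
    have "?S \<subseteq> mp.span (A \<union> B)"
    proof
      fix f assume f: "f \<in> ?S"
      then have "?h f \<in> ?h ` mp.span B" using B(4) unfolding quot_part_def by (metis imageI)
      then obtain b where b: "b \<in> mp.span B" "?h f = ?h b" by blast
      have bS: "b \<in> ?S" using b(1) mp.span_minimal[OF B(3) subspace_homog] by blast
      then have "f - b \<in> J" using b(2) coset_eq_iff[OF J] f homog_carrier by blast
      then have "f - b \<in> mp.span A" using mp.subspace_diff[OF subspace_homog f bS] A(4) by blast
      then have "f - b + b \<in> mp.span (A \<union> B)"
        using b(1) mp.span_mono[of A "A \<union> B"] mp.span_mono[of B "A \<union> B"] by (intro mp.span_add) auto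
      then show "f \<in> mp.span (A \<union> B)" by simp
    qed
    then have "card (A \<union> B) = mp.dim ?S"
      by (intro mp.basis_card_eq_dim) (use A B compl[OF B(1,3,5,6)] in auto)
    then show "n + mp.dim ?J = card (mon l d)"
      using compl[OF B(1,3,5,6)] A(5) B(2) unfolding homog_part_eq dim_supp by simp
  next
    \<comment> \<open>Conversely, extending \<open>A\<close> to a basis of \<open>?S\<close> yields
      a complement of \<open>?J\<close>, and the extending vectors are the lifts that
      \<open>dimension_quotI\<close> asks for.\<close>
    assume n: "n + mp.dim ?J = card (mon l d)"
    obtain C where C: "A \<subseteq> C" "C \<subseteq> ?S" "mp.independent C" "?S \<subseteq> mp.span C"
      using mp.maximal_independent_subset_extend[of A ?S] A by auto
    have fC: "finite C" using mp.independent_card_le[OF fdim_homog C(3)] mp.span_base C(2) by blast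
    have cC: "card C = card (mon l d)"
      using mp.basis_card_eq_dim[OF C(2,4,3)] unfolding homog_part_eq dim_supp .
    let ?B = "C - A"
    have B: "finite ?B" "?B \<subseteq> ?S" "mp.independent ?B"
      using fC C(2) mp.independent_mono[OF C(3), of ?B] by auto
    have "mp.span ?B \<inter> J \<subseteq> {0}"
    proof
      fix x assume x: "x \<in> mp.span ?B \<inter> J"
      then have "x \<in> mp.span A" using mp.span_minimal[OF B(2) subspace_homog] A(4) by blast
      then show "x \<in> {0}"
        using x mp.independent_span_disjoint[OF C(3,1)] by blast
    qed
    then have B4: "mp.span ?B \<inter> J = {0}" using mp.span_zero J ideal_poly_ring_iff by blast
    have "card ?B = n" using n cC A(5) card_Diff_subset[OF A(1) C(1)] card_mono[OF fC C(1)] by simp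
    moreover have "quot_part l J d = ?h ` mp.span ?B"
    proof -
      have "?h f \<in> ?h ` mp.span ?B" if f: "f \<in> ?S" for f
      proof -
        have "f \<in> mp.span (A \<union> ?B)" using f C by (metis Un_Diff_cancel subset_Un_eq subsetD)
        then obtain a b where ab: "a \<in> ?J" "b \<in> mp.span ?B" "f = a + b"
          unfolding mp.span_Un A(4) by blast
        have "b \<in> ?S" using ab(2) mp.span_minimal[OF B(2) subspace_homog] by blast
        moreover have "f - b \<in> J" using ab by simp
        ultimately have "?h f = ?h b" using coset_eq_iff[OF J, of f b] f homog_carrier[of l d] by blast
        then show ?thesis using ab(2) by blast
      qed
      then show ?thesis using mp.span_minimal[OF B(2) subspace_homog] unfolding quot_part_def by blast
    qed
    ultimately show "ring.dimension (poly_ring l Quot J) n ((\<lambda>c. ?h (Const c)) ` UNIV) (quot_part l J d)"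
      using dimension_quotI[OF J subspace_homog homog_carrier B(1-3) B4] by simp
  qed
  have le: "mp.dim ?J \<le> card (mon l d)"
    using mp.dim_mono_fdim[OF fdim_homog, of ?J l d] mp.span_superset
    unfolding homog_part_eq dim_supp by blast
  have "HF l J d = card (mon l d) - mp.dim ?J" unfolding HF_def main
    by (rule the_equality) (use le in auto)
  then show ?thesis using le by simp
qed


section \<open>Polynomial functions and genericity\<close>

definition eval_monom :: "('x \<Rightarrow> 'a::comm_ring_1) \<Rightarrow> 'x monomial \<Rightarrow> 'a" where
  "eval_monom \<phi> m = (\<Prod>i \<in> keys m. \<phi> i ^ lookup m i)"

lemma eval_monom_superset:
  "finite A \<Longrightarrow> keys m \<subseteq> A \<Longrightarrow> eval_monom \<phi> m = (\<Prod>i\<in>A. \<phi> i ^ lookup m i)"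
  unfolding eval_monom_def by (rule prod.mono_neutral_left) (auto simp: in_keys_iff)

lemma eval_monom_add: "eval_monom \<phi> (m + n) = eval_monom \<phi> m * eval_monom \<phi> n"
  using eval_monom_superset[of "keys m \<union> keys n" m \<phi>]
    eval_monom_superset[of "keys m \<union> keys n" n \<phi>]
    eval_monom_superset[of "keys m \<union> keys n" "m + n" \<phi>]
  by (simp add: keys_add_monomial lookup_add power_add prod.distrib)

lemma subst_mpoly_superset:
  assumes "finite A" "keys f \<subseteq> A" "h 0 = 0"
  shows "subst_mpoly h \<phi> f = (\<Sum>m\<in>A. h (lookup f m) * eval_monom \<phi> m)"
  unfolding subst_mpoly_def eval_monom_def[symmetric]
  by (rule sum.mono_neutral_left) (use assms in \<open>auto simp: in_keys_iff\<close>)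

lemma subst_mpoly_add:
  assumes "h 0 = 0" "\<And>a b. h (a + b) = h a + h b"
  shows "subst_mpoly h \<phi> (f + g) = subst_mpoly h \<phi> f + subst_mpoly h \<phi> g"
  using subst_mpoly_superset[of "keys f \<union> keys g" f h \<phi>]
    subst_mpoly_superset[of "keys f \<union> keys g" g h \<phi>]
    subst_mpoly_superset[of "keys f \<union> keys g" "f + g" h \<phi>]
  by (simp add: assms keys_add lookup_add distrib_right sum.distrib)

lemma subst_mpoly_single:
  "h 0 = 0 \<Longrightarrow> subst_mpoly h \<phi> (Poly_Mapping.single m c) = h c * eval_monom \<phi> m"
  by (subst subst_mpoly_superset[of "{m}"]) auto

lemma subst_mpoly_0 [simp]: "subst_mpoly h \<phi> 0 = 0"
  by (simp add: subst_mpoly_def)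

lemma subst_mpoly_mult:
  assumes h: "h 0 = 0" "\<And>a b. h (a + b) = h a + h b" "\<And>a b. h (a * b) = h a * h b"
  shows "subst_mpoly h \<phi> (f * g) = subst_mpoly h \<phi> f * subst_mpoly h \<phi> (g :: ('x, 'k::comm_ring_1) mpoly)"
proof (induction f rule: mpoly_induct)
  case (single m c)
  show ?case
  proof (induction g rule: mpoly_induct)
    case (single n b)
    show ?case by (simp add: mult_single subst_mpoly_single[of h] h eval_monom_add mult_ac)
  qed (simp add: algebra_simps subst_mpoly_add[of h] h)
qed (simp add: algebra_simps subst_mpoly_add[of h] h)

lemma eval_monom_single [simp]: "eval_monom \<phi> (Poly_Mapping.single i k) = \<phi> i ^ k"
  by (cases "k = 0") (simp_all add: eval_monom_def)

lemma eval_monom_0 [simp]: "eval_monom \<phi> 0 = 1"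
  by (simp add: eval_monom_def)

text \<open>Points are total functions, but by \<open>polyfn_restrict\<close> only the coordinates
  in \<open>X\<close> influence the value; this is what allows points and matrices to be exchanged
  later.\<close>

definition polyfn :: "'x set \<Rightarrow> (('x \<Rightarrow> 'k::comm_ring_1) \<Rightarrow> 'k) \<Rightarrow> bool" where
  "polyfn X \<phi> \<longleftrightarrow> (\<exists>f. vars f \<subseteq> X \<and> (\<forall>p. \<phi> p = subst_mpoly id p f))"

lemma vars_subset_iff: "vars f \<subseteq> X \<longleftrightarrow> f \<in> supp {m. keys m \<subseteq> X}"
  by (auto simp: vars_def supp_def)

lemma polyfn_const [simp]: "polyfn X (\<lambda>p. c)"
  unfolding polyfn_def
  by (rule exI[of _ "Poly_Mapping.single 0 c"]) (simp add: vars_subset_iff subst_mpoly_single)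

lemma polyfn_var [simp]: "i \<in> X \<Longrightarrow> polyfn X (\<lambda>p. p i)"
  unfolding polyfn_def
  by (rule exI[of _ "Var i"]) (simp add: Var_def vars_subset_iff subst_mpoly_single)

lemma polyfn_add [simp]: "polyfn X \<phi> \<Longrightarrow> polyfn X \<psi> \<Longrightarrow> polyfn X (\<lambda>p. \<phi> p + \<psi> p)"
  unfolding polyfn_def vars_subset_iff by (metis id_apply subst_mpoly_add supp_add)

lemma polyfn_mult [simp]:
  assumes "polyfn X \<phi>" "polyfn X \<psi>" shows "polyfn X (\<lambda>p. \<phi> p * \<psi> p)"
proof -
  obtain f g where fg: "vars f \<subseteq> X" "\<forall>p. \<phi> p = subst_mpoly id p f" "vars g \<subseteq> X" "\<forall>p. \<psi> p = subst_mpoly id p g"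
    using assms unfolding polyfn_def by blast
  have "vars (f * g) \<subseteq> X" using fg(1,3) unfolding vars_subset_iff
    by (rule supp_mult) (simp add: keys_add_monomial)
  moreover have "subst_mpoly id p (f * g) = \<phi> p * \<psi> p" for p
    using fg subst_mpoly_mult[of id p f g] by simp
  ultimately show ?thesis unfolding polyfn_def by metis
qed

lemma polyfn_diff [simp]: "polyfn X \<phi> \<Longrightarrow> polyfn X \<psi> \<Longrightarrow> polyfn X (\<lambda>p. \<phi> p - \<psi> p)"
  using polyfn_add[of X \<phi> "\<lambda>p. - 1 * \<psi> p"] polyfn_mult[of X "\<lambda>_. - 1" \<psi>] by simp

lemma polyfn_sum: "(\<And>i. i \<in> A \<Longrightarrow> polyfn X (\<phi> i)) \<Longrightarrow> polyfn X (\<lambda>p. \<Sum>i\<in>A. \<phi> i p)"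
  by (induction A rule: infinite_finite_induct) auto

lemma polyfn_prod: "(\<And>i. i \<in> A \<Longrightarrow> polyfn X (\<phi> i)) \<Longrightarrow> polyfn X (\<lambda>p. \<Prod>i\<in>A. \<phi> i p)"
  by (induction A rule: infinite_finite_induct) auto

lemma polyfn_mono: "polyfn X \<phi> \<Longrightarrow> X \<subseteq> Y \<Longrightarrow> polyfn Y \<phi>"
  unfolding polyfn_def by blast

text \<open>Reduces nonvanishing on an affine space to one variable, where a nonzero polynomial has
  finitely many roots.\<close>

lemma polyfn_line:
  assumes "polyfn X \<phi>"
  obtains q where "\<And>t. \<phi> (\<lambda>i. a i + t * b i) = poly q t"
proof -
  obtain f where f: "\<forall>p. \<phi> p = subst_mpoly id p f" using assms unfolding polyfn_def by blast
  let ?q = "\<Sum>m\<in>keys f. [:lookup f m:] * (\<Prod>i\<in>keys m. [:a i, b i:] ^ lookup m i)"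
  have "\<phi> (\<lambda>i. a i + t * b i) = poly ?q t" for t
    by (simp add: f subst_mpoly_def poly_sum poly_prod)
  then show ?thesis using that by blast
qed

lemma polyfn_restrict:
  assumes "polyfn X \<phi>" "\<And>i. i \<in> X \<Longrightarrow> p i = q i"
  shows "\<phi> p = \<phi> q"
proof -
  obtain f where f: "vars f \<subseteq> X" "\<forall>p. \<phi> p = subst_mpoly id p f" using assms unfolding polyfn_def by blast
  have "subst_mpoly id p f = subst_mpoly id q f"
    unfolding subst_mpoly_def
  proof (intro sum.cong refl arg_cong2[where f = "(*)"] prod.cong)
    fix m i assume "m \<in> keys f" "i \<in> keys m"
    then have "i \<in> X" using f(1) unfolding vars_def by blast
    then show "p i ^ lookup m i = q i ^ lookup m i" using assms(2) by simp
  qed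
  then show ?thesis using f by simp
qed

text \<open>Truth on a nonempty basic open set. One function suffices, because a nonempty open set
  contains a nonempty basic one, and intersections become products of functions. That such sets meet
  uses that the field is infinite.\<close>

definition generic :: "'x set \<Rightarrow> (('x \<Rightarrow> 'k::field_char_0) \<Rightarrow> bool) \<Rightarrow> bool" where
  "generic X P \<longleftrightarrow> (\<exists>\<phi>. polyfn X \<phi> \<and> (\<exists>p. \<phi> p \<noteq> 0) \<and> (\<forall>p. \<phi> p \<noteq> 0 \<longrightarrow> P p))"

lemma generic_ex: "generic X P \<Longrightarrow> \<exists>p. P p"
  unfolding generic_def by blast

lemma generic_True: "(\<And>p. P p) \<Longrightarrow> generic X P"
  unfolding generic_def by (rule exI[of _ "\<lambda>_. 1"]) simp

lemma generic_mono: "generic X P \<Longrightarrow> X \<subseteq> Y \<Longrightarrow> (\<And>p. P p \<Longrightarrow> Q p) \<Longrightarrow> generic Y Q"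
  unfolding generic_def using polyfn_mono by blast

text \<open>The affine space is irreducible: join a point where the first polynomial does not vanish to
  one where the second does not, and compare with the finitely many roots on that line.\<close>

lemma polyfn_common_nonzero:
  fixes \<phi> \<psi> :: "('x \<Rightarrow> 'k::field_char_0) \<Rightarrow> 'k"
  assumes "polyfn X \<phi>" "polyfn Y \<psi>" "\<phi> a \<noteq> 0" "\<psi> b \<noteq> 0"
  obtains p where "\<phi> p \<noteq> 0" "\<psi> p \<noteq> 0"
proof -
  obtain q where q: "\<And>t. \<phi> (\<lambda>i. a i + t * (b i - a i)) = poly q t"
    using polyfn_line[OF assms(1), of a "\<lambda>i. b i - a i"] by blast
  obtain r where r: "\<And>t. \<psi> (\<lambda>i. a i + t * (b i - a i)) = poly r t"
    using polyfn_line[OF assms(2), of a "\<lambda>i. b i - a i"] by blast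
  have "poly q 0 \<noteq> 0" "poly r 1 \<noteq> 0" using q[of 0] r[of 1] assms(3,4) by simp_all
  then have "q * r \<noteq> 0" by auto
  then have "finite {t. poly (q * r) t = 0}" by (rule poly_roots_finite)
  then obtain t where "poly (q * r) t \<noteq> 0"
    using infinite_UNIV_char_0[where 'a = 'k] by (metis (mono_tags, lifting) UNIV_eq_I mem_Collect_eq)
  then show ?thesis using that[of "\<lambda>i. a i + t * (b i - a i)"] q r by simp
qed

lemma generic_conj:
  assumes "generic X P" "generic X Q"
  shows "generic X (\<lambda>p. P p \<and> Q p)"
proof -
  obtain \<phi> a where 1: "polyfn X \<phi>" "\<phi> a \<noteq> 0" "\<And>p. \<phi> p \<noteq> 0 \<Longrightarrow> P p"
    using assms(1) unfolding generic_def by blast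
  obtain \<psi> b where 2: "polyfn X \<psi>" "\<psi> b \<noteq> 0" "\<And>p. \<psi> p \<noteq> 0 \<Longrightarrow> Q p"
    using assms(2) unfolding generic_def by blast
  obtain p where "\<phi> p \<noteq> 0" "\<psi> p \<noteq> 0" using polyfn_common_nonzero 1 2 by blast
  then show ?thesis unfolding generic_def
    by (intro exI[of _ "\<lambda>p. \<phi> p * \<psi> p"]) (use 1 2 in auto)
qed

lemma generic_ball:
  "finite A \<Longrightarrow> (\<And>a. a \<in> A \<Longrightarrow> generic X (P a)) \<Longrightarrow> generic X (\<lambda>p. \<forall>a\<in>A. P a p)"
proof (induction A rule: finite_induct)
  case (insert a A)
  then have "generic X (\<lambda>p. P a p \<and> (\<forall>a\<in>A. P a p))" by (intro generic_conj) auto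
  then show ?case by simp
qed (simp add: generic_True)

text \<open>Polynomials whose coefficients are polynomial functions of the parameter, as finite sums
  over fixed polynomials \<open>f\<close>. This shape gives closure under products by induction, and
  \<open>polyvec_lookup\<close> extracts what the rank arguments use.\<close>

inductive polyvec :: "'x set \<Rightarrow> (('x \<Rightarrow> 'k::comm_ring_1) \<Rightarrow> ('y, 'k) mpoly) \<Rightarrow> bool" for X where
  zero: "polyvec X (\<lambda>p. 0)"
| step: "polyvec X v \<Longrightarrow> polyfn X \<phi> \<Longrightarrow> polyvec X (\<lambda>p. v p + Const (\<phi> p) * f)"

lemma polyvec_const [simp]: "polyvec X (\<lambda>p. f)"
  using polyvec.step[OF polyvec.zero polyfn_const[of X 1], of f] by simp

lemma polyvec_Const [simp]: "polyfn X \<phi> \<Longrightarrow> polyvec X (\<lambda>p. Const (\<phi> p))"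
  using polyvec.step[OF polyvec.zero, of X \<phi> 1] by simp

lemma polyvec_add [simp]: "polyvec X w \<Longrightarrow> polyvec X v \<Longrightarrow> polyvec X (\<lambda>p. v p + w p)"
proof (induction w rule: polyvec.induct)
  case (step w \<phi> f)
  then show ?case using polyvec.step[of X "\<lambda>p. v p + w p" \<phi> f] by (simp add: add.assoc)
qed simp

lemma polyvec_term:
  assumes "polyvec X v" "polyfn X \<phi>" shows "polyvec X (\<lambda>p. v p * (Const (\<phi> p) * f))"
  using assms(1)
proof (induction rule: polyvec.induct)
  case (step v \<psi> g)
  have "(v p + Const (\<psi> p) * g) * (Const (\<phi> p) * f) =
    v p * (Const (\<phi> p) * f) + Const (\<psi> p * \<phi> p) * (g * f)" for p
    by (simp add: algebra_simps Const_mult)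
  then show ?case using polyvec.step[OF step.IH polyfn_mult[OF step.hyps(2) assms(2)], of "g * f"] by simp
qed simp

lemma polyvec_mult [simp]:
  assumes "polyvec X v" "polyvec X w" shows "polyvec X (\<lambda>p. v p * w p)"
  using assms(2)
proof (induction rule: polyvec.induct)
  case (step w \<phi> f)
  then show ?case using polyvec_term[OF assms(1)] by (simp add: distrib_left)
qed simp

lemma polyvec_sum: "(\<And>i. i \<in> A \<Longrightarrow> polyvec X (v i)) \<Longrightarrow> polyvec X (\<lambda>p. \<Sum>i\<in>A. v i p)"
  by (induction A rule: infinite_finite_induct) auto

lemma polyvec_prod: "(\<And>i. i \<in> A \<Longrightarrow> polyvec X (v i)) \<Longrightarrow> polyvec X (\<lambda>p. \<Prod>i\<in>A. v i p)"
  by (induction A rule: infinite_finite_induct) auto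

lemma polyvec_power [simp]: "polyvec X v \<Longrightarrow> polyvec X (\<lambda>p. v p ^ n)"
  by (induction n) auto

lemma polyvec_lookup: "polyvec X v \<Longrightarrow> polyfn X (\<lambda>p. lookup (v p) m)"
  by (induction rule: polyvec.induct) (auto simp: lookup_add lookup_Const_times)

text \<open>Fraction-free elimination of a nonzero coordinate of one vector from all the others.\<close>

lemma indep_fam_open:
  assumes "finite T" "\<And>i m. i \<in> T \<Longrightarrow> polyfn X (\<lambda>p. lookup (v i p) m)"
    and "mp.indep_fam T (\<lambda>i. v i a :: ('y, 'k::field) mpoly)"
  shows "\<exists>\<phi>. polyfn X \<phi> \<and> \<phi> a \<noteq> 0 \<and> (\<forall>p. \<phi> p \<noteq> 0 \<longrightarrow> mp.indep_fam T (\<lambda>i. v i p))"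
  using assms
proof (induction T arbitrary: v rule: finite_induct)
  case empty
  show ?case by (intro exI[of _ "\<lambda>_. 1"]) (simp add: mp.indep_fam_def)
next
  case (insert t T)
  have ind: "\<forall>i\<in>insert t T. c i = 0" if "(\<Sum>i\<in>insert t T. Const (c i) * v i a) = 0" for c
    using insert.prems(2) that unfolding mp.indep_fam_def by blast
  have "v t a \<noteq> 0"
  proof
    assume "v t a = 0"
    then have "(\<Sum>i\<in>insert t T. Const (if i = t then 1 else 0) * v i a) = 0"
      by (intro sum.neutral) auto
    from ind[OF this] show False by auto
  qed
  then obtain m where m: "lookup (v t a) m \<noteq> 0"
    by (metis lookup_zero poly_mapping_eqI)
  \<comment> \<open>The pivot: the coordinate \<open>m\<close> of \<open>v t\<close>, nonzero at
    \<open>a\<close>. Multiplying by it instead of dividing keeps all coordinates of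
    \<open>w\<close> polynomial.\<close>
  define \<alpha> where "\<alpha> = (\<lambda>p. lookup (v t p) m)"
  define \<beta> where "\<beta> = (\<lambda>i p. lookup (v i p) m)"
  define w where "w = (\<lambda>i p. Const (\<alpha> p) * v i p - Const (\<beta> i p) * v t p)"
  have w: "(\<Sum>i\<in>T. Const (c i) * w i p) =
      (\<Sum>i\<in>T. Const (c i * \<alpha> p) * v i p) - Const (\<Sum>i\<in>T. c i * \<beta> i p) * v t p" for c p
  proof -
    have "Const (\<Sum>i\<in>T. c i * \<beta> i p) = (\<Sum>i\<in>T. Const (c i) * Const (\<beta> i p) :: ('y, 'k) mpoly)"
      using insert.hyps(1) by (induction T rule: finite_induct) (auto simp: Const_add Const_mult)
    moreover have "Const (c i) * w i p = Const (c i * \<alpha> p) * v i p - Const (c i) * Const (\<beta> i p) * v t p" for i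
      unfolding w_def right_diff_distrib Const_mult by (simp only: mult.assoc)
    then have "(\<Sum>i\<in>T. Const (c i) * w i p) =
        (\<Sum>i\<in>T. Const (c i * \<alpha> p) * v i p) - (\<Sum>i\<in>T. Const (c i) * Const (\<beta> i p) * v t p)"
      by (simp only: sum_subtractf)
    ultimately show ?thesis by (simp only: sum_distrib_right)
  qed
  have "mp.indep_fam T (\<lambda>i. w i a)" unfolding mp.indep_fam_def
  proof (intro allI impI ballI)
    fix c i assume c: "(\<Sum>i\<in>T. Const (c i) * w i a) = 0" and i: "i \<in> T"
    \<comment> \<open>A relation among the \<open>w i\<close> rewritten in the \<open>v i\<close>:
      each \<open>c i\<close> gains the factor \<alpha>, and the pivot vector collects the remaining
      terms.\<close>
    define c' where "c' = (\<lambda>i. if i = t then - (\<Sum>i\<in>T. c i * \<beta> i a) else c i * \<alpha> a)"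
    have "(\<Sum>i\<in>insert t T. Const (c' i) * v i a) = Const (c' t) * v t a + (\<Sum>i\<in>T. Const (c' i) * v i a)"
      using insert.hyps by simp
    also have "(\<Sum>i\<in>T. Const (c' i) * v i a) = (\<Sum>i\<in>T. Const (c i * \<alpha> a) * v i a)"
      by (rule sum.cong) (use insert.hyps in \<open>auto simp: c'_def\<close>)
    also have "Const (c' t) * v t a + (\<Sum>i\<in>T. Const (c i * \<alpha> a) * v i a) = 0"
    proof -
      have "Const (c' t) = - (Const (\<Sum>i\<in>T. c i * \<beta> i a) :: ('y, 'k) mpoly)" by (simp add: c'_def Const_def single_uminus)
      moreover have "(\<Sum>i\<in>T. Const (c i * \<alpha> a) * v i a) = Const (\<Sum>i\<in>T. c i * \<beta> i a) * v t a"
        using c unfolding w by (simp only: right_minus_eq)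
      ultimately show ?thesis by (simp only: mult_minus_left left_minus)
    qed
    finally have "c' i = 0" using ind i by blast
    then show "c i = 0" using i insert.hyps m by (auto simp: c'_def \<alpha>_def split: if_splits)
  qed
  moreover have "polyfn X (\<lambda>p. lookup (w i p) n)" if "i \<in> T" for i n
    unfolding w_def \<alpha>_def \<beta>_def lookup_minus lookup_Const_times
    by (intro polyfn_diff polyfn_mult insert.prems(1)) (use that in auto)
  ultimately obtain \<phi> where \<phi>: "polyfn X \<phi>" "\<phi> a \<noteq> 0" "\<And>p. \<phi> p \<noteq> 0 \<Longrightarrow> mp.indep_fam T (\<lambda>i. w i p)"
    using insert.IH[of w] by blast
  have "mp.indep_fam (insert t T) (\<lambda>i. v i p)" if p: "\<phi> p * \<alpha> p \<noteq> 0" for p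
    unfolding mp.indep_fam_def
  proof (intro allI impI)
    fix c assume "(\<Sum>i\<in>insert t T. Const (c i) * v i p) = 0"
    then have c: "Const (c t) * v t p + (\<Sum>i\<in>T. Const (c i) * v i p) = 0" using insert.hyps by simp
    \<comment> \<open>Coordinate \<open>m\<close> of the relation. It makes the given relation among
      the \<open>v i\<close> a relation among the \<open>w i\<close>, and at the end it forces
      \<open>c t = 0\<close> because the pivot is nonzero at \<open>p\<close>.\<close>
    from arg_cong[OF this, of "\<lambda>f. lookup f m"]
    have 1: "c t * \<alpha> p + (\<Sum>i\<in>T. c i * \<beta> i p) = 0"
      by (simp add: lookup_add lookup_sum lookup_Const_times \<alpha>_def \<beta>_def)
    have "(\<Sum>i\<in>T. Const (c i * \<alpha> p) * v i p) = Const (\<alpha> p) * (\<Sum>i\<in>T. Const (c i) * v i p)"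
      unfolding sum_distrib_left Const_mult by (simp only: mult_ac)
    also have "(\<Sum>i\<in>T. Const (c i) * v i p) = - (Const (c t) * v t p)"
      using c by (simp only: eq_neg_iff_add_eq_0 add.commute)
    finally have "(\<Sum>i\<in>T. Const (c i) * w i p) = - (Const (c t * \<alpha> p + (\<Sum>i\<in>T. c i * \<beta> i p)) * v t p)"
      unfolding w Const_add Const_mult by (simp only: algebra_simps minus_add_distrib mult_minus_right add.right_inverse add_0_right add_0_left)
    then have "(\<Sum>i\<in>T. Const (c i) * w i p) = 0" using 1 by simp
    then have T: "\<forall>i\<in>T. c i = 0" using \<phi>(3) p unfolding mp.indep_fam_def by auto
    then have "c t = 0" using 1 p by simp
    then show "\<forall>i\<in>insert t T. c i = 0" using T by simp
  qed
  moreover have "polyfn X (\<lambda>p. \<phi> p * \<alpha> p)"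
    using \<phi>(1) insert.prems(1)[of t m] unfolding \<alpha>_def by simp
  ultimately show ?case using \<phi>(2) m by (intro exI[of _ "\<lambda>p. \<phi> p * \<alpha> p"]) (auto simp: \<alpha>_def)
qed

text \<open>Semicontinuity of the rank: ranks are bounded by \<open>card T\<close>, so a maximum is
  attained at some \<open>a\<close>, and the independence of a maximal subfamily at \<open>a\<close>
  persists on an open set.\<close>

lemma generic_max_dim:
  fixes v :: "'i \<Rightarrow> ('x \<Rightarrow> 'k::field_char_0) \<Rightarrow> ('y, 'k) mpoly"
  assumes T: "finite T" and v: "\<And>i. i \<in> T \<Longrightarrow> polyvec X (v i)"
  shows "generic X (\<lambda>p. \<forall>q. mp.dim (mp.span ((\<lambda>i. v i q) ` T)) \<le> mp.dim (mp.span ((\<lambda>i. v i p) ` T)))"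
proof -
  let ?r = "\<lambda>p. mp.dim (mp.span ((\<lambda>i. v i p) ` T))"
  have "?r p \<le> card T" for p
    using mp.dim_le_card[of "mp.span ((\<lambda>i. v i p) ` T)" "(\<lambda>i. v i p) ` T"] T card_image_le[OF T]
    by (meson finite_imageI order_refl order_trans)
  then have "finite (range ?r)" by (meson finite_atMost finite_subset atMost_iff image_subsetI)
  then obtain a where a: "\<And>q. ?r q \<le> ?r a"
    using Max_in[of "range ?r"] Max_ge[of "range ?r"] by fastforce
  obtain T' where T': "T' \<subseteq> T" "mp.indep_fam T' (\<lambda>i. v i a)" "card T' = ?r a"
    by (rule mp.ex_indep_fam[OF T])
  have fT': "finite T'" using T' T finite_subset by blast
  obtain \<phi> where \<phi>: "polyfn X \<phi>" "\<phi> a \<noteq> 0" "\<And>p. \<phi> p \<noteq> 0 \<Longrightarrow> mp.indep_fam T' (\<lambda>i. v i p)"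
    using indep_fam_open[of T' X v a] fT' T'(2) polyvec_lookup v T'(1) by blast
  have "?r q \<le> ?r p" if "\<phi> p \<noteq> 0" for p q
  proof -
    have "card T' \<le> mp.dim ((\<lambda>i. v i p) ` T)"
      by (rule mp.indep_fam_card_le[OF fT' \<phi>(3)[OF that]])
        (use T T'(1) in \<open>auto intro!: mp.fdim_finite mp.span_base\<close>)
    then show ?thesis using a[of q] T'(3) by (simp only: mp.dim_span)
  qed
  then show ?thesis unfolding generic_def using \<phi> by blast
qed


section \<open>Leading monomials\<close>

abbreviation drl :: "nat monomial \<Rightarrow> nat monomial \<Rightarrow> bool"  (infix "\<prec>" 50) where
  "m \<prec> n \<equiv> degrevlex_less m n"

lemma drl_irrefl [simp]: "\<not> m \<prec> m"
  by (simp add: degrevlex_less_def)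

lemma drl_trans:
  assumes "m \<prec> n" "n \<prec> k" shows "m \<prec> k"
proof (cases "mdeg m = mdeg n \<and> mdeg n = mdeg k")
  case True
  obtain i where i: "lookup m i > lookup n i"
    "\<forall>j>i. lookup m j = lookup n j"
    using assms(1) True unfolding degrevlex_less_def by auto
  obtain j where j: "lookup n j > lookup k j"
    "\<forall>i>j. lookup n i = lookup k i"
    using assms(2) True unfolding degrevlex_less_def by auto
  \<comment> \<open>The later of the two deciding positions decides between \<open>m\<close> and
    \<open>k\<close>.\<close>
  have "lookup m (max i j) > lookup k (max i j) \<and>
    (\<forall>a>max i j. lookup m a = lookup k a)"
    using i j by (cases i j rule: linorder_cases) (auto simp: max_def)
  then show ?thesis using True unfolding degrevlex_less_def by auto
next
  case False
  then show ?thesis using assms unfolding degrevlex_less_def by auto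
qed

lemma drl_total:
  assumes "m \<noteq> n" shows "m \<prec> n \<or> n \<prec> m"
proof (cases "mdeg m = mdeg n")
  case True
  let ?D = "{i. lookup m i \<noteq> lookup n i}"
  have "?D \<subseteq> keys m \<union> keys n" by (auto simp: in_keys_iff)
  then have fin: "finite ?D" by (rule finite_subset) simp
  have "?D \<noteq> {}" using assms by (auto intro: poly_mapping_eqI)
  then have "Max ?D \<in> ?D" using Max_in[OF fin] by blast
  moreover have "\<forall>j>Max ?D. lookup m j = lookup n j"
    using Max_ge[OF fin] by (metis (mono_tags, lifting) mem_Collect_eq not_le)
  ultimately show ?thesis using True unfolding degrevlex_less_def
    by (metis (mono_tags, lifting) mem_Collect_eq nat_neq_iff)
qed (auto simp: degrevlex_less_def)

lemma drl_add_right: "m \<prec> n \<Longrightarrow> m + k \<prec> n + k"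
  unfolding degrevlex_less_def by (auto simp: lookup_add)

lemma drl_ex_max:
  assumes "finite A" "A \<noteq> {}"
  obtains m where "m \<in> A" "\<And>n. n \<in> A \<Longrightarrow> n \<noteq> m \<Longrightarrow> n \<prec> m"
proof -
  have "\<exists>m\<in>A. \<forall>n\<in>A. n \<noteq> m \<longrightarrow> n \<prec> m"
    using assms
  proof (induction A rule: finite_ne_induct)
    case (insert a A)
    then obtain m where m: "m \<in> A" "\<forall>n\<in>A. n \<noteq> m \<longrightarrow> n \<prec> m" by blast
    show ?case
    proof (cases "a \<prec> m")
      case False
      then have "m \<prec> a" using drl_total m(1) insert.hyps by metis
      then show ?thesis using m drl_trans by (metis insert_iff)
    qed (use m in blast)
  qed simp
  then show ?thesis using that by blast
qed

lemma leading_monomial_eqI: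
  assumes "m \<in> keys f" "\<And>n. n \<in> keys f \<Longrightarrow> n \<noteq> m \<Longrightarrow> n \<prec> m"
  shows "leading_monomial f = m"
  unfolding leading_monomial_def
proof (rule the_equality)
  fix n assume n: "n \<in> keys f \<and> (\<forall>m'\<in>keys f. m' \<noteq> n \<longrightarrow> m' \<prec> n)"
  show "n = m"
  proof (rule ccontr)
    assume "n \<noteq> m"
    then have "m \<prec> n" "n \<prec> m" using n assms(1) assms(2)[of n] by auto
    then have "m \<prec> m" by (rule drl_trans)
    then show False by simp
  qed
qed (use assms in blast)

lemma
  assumes "f \<noteq> 0"
  shows leading_monomial_in_keys: "leading_monomial f \<in> keys f"
    and leading_monomial_greater: "n \<in> keys f \<Longrightarrow> n \<noteq> leading_monomial f \<Longrightarrow> n \<prec> leading_monomial f"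
proof -
  obtain m where m: "m \<in> keys f" "\<And>n. n \<in> keys f \<Longrightarrow> n \<noteq> m \<Longrightarrow> n \<prec> m"
    using drl_ex_max[of "keys f"] assms by auto
  then have "leading_monomial f = m" by (rule leading_monomial_eqI)
  then show "leading_monomial f \<in> keys f"
    "n \<in> keys f \<Longrightarrow> n \<noteq> leading_monomial f \<Longrightarrow> n \<prec> leading_monomial f" using m by blast+
qed

lemma leading_monomial_xmon [simp]: "leading_monomial (xmon m) = m"
  by (rule leading_monomial_eqI) auto

lemma lookup_single_times: "lookup (Poly_Mapping.single n c * f) (n + m) = c * lookup (f :: ('x, 'k::comm_ring_1) mpoly) m"
proof (induction f rule: mpoly_induct)
  case (single k b)
  show ?case by (simp add: mult_single lookup_single when_def)
qed (simp add: lookup_add algebra_simps)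

lemma leading_monomial_mult:
  assumes "f \<noteq> 0"
  shows "xmon n * f \<noteq> 0" and "leading_monomial (xmon n * f) = n + leading_monomial (f :: (nat, 'k::field) mpoly)"
proof -
  have k: "n + leading_monomial f \<in> keys (xmon n * f)"
    using leading_monomial_in_keys[OF assms] by (simp add: in_keys_iff lookup_single_times)
  then show "xmon n * f \<noteq> 0" by auto
  show "leading_monomial (xmon n * f) = n + leading_monomial f"
  proof (rule leading_monomial_eqI[OF k])
    fix m assume "m \<in> keys (xmon n * f)" "m \<noteq> n + leading_monomial f"
    moreover then obtain m' where "m = n + m'" "m' \<in> keys f"
      using keys_mult[of "xmon n" f] by auto
    ultimately show "m \<prec> n + leading_monomial f"
      using leading_monomial_greater[OF assms, of m'] drl_add_right[of m' "leading_monomial f" n]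
      by (metis add.commute)
  qed
qed

text \<open>The monomials of the initial ideal when \<open>V\<close> is an ideal; arbitrary
  subspaces are allowed so that one graded piece can be treated at a time.\<close>

definition lms :: "(nat, 'k::zero) mpoly set \<Rightarrow> nat monomial set" where
  "lms V = {leading_monomial f |f. f \<in> V \<and> f \<noteq> 0}"

lemma lms_subset: "V \<subseteq> supp X \<Longrightarrow> lms V \<subseteq> X"
  unfolding lms_def supp_def using leading_monomial_in_keys by blast

text \<open>Gaussian elimination from the top: let \<open>n\<close> be the greatest monomial of
  \<open>X\<close>. The elements of \<open>V\<close> without the term \<open>n\<close> either
  exhaust \<open>V\<close>, or they have one dimension less and exactly the leading monomial
  \<open>n\<close> is lost.\<close>

lemma dim_eq_card_lms:
  assumes "finite X" "mp.subspace V" "V \<subseteq> (supp X :: (nat, 'k::field) mpoly set)"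
  shows "mp.dim V = card (lms V)"
  using assms
proof (induction "card X" arbitrary: X V)
  case 0
  then have V: "V = {0}" using mp.subspace_0 by (fastforce simp: supp_def)
  then have "lms V = {}" by (simp add: lms_def)
  moreover have "mp.dim {0} = 0"
    using mp.dim_span_eq_card_independent[OF mp.independent_empty] by simp
  ultimately show ?case using V by simp
next
  case (Suc k)
  then have "X \<noteq> {}" by auto
  then obtain n where n: "n \<in> X" "\<And>m. m \<in> X \<Longrightarrow> m \<noteq> n \<Longrightarrow> m \<prec> n"
    using drl_ex_max[OF Suc.prems(1)] by blast
  define V' where "V' = V \<inter> supp (X - {n})"
  have V': "mp.subspace V'" "V' \<subseteq> supp (X - {n})"
    unfolding V'_def using mp.subspace_inter[OF Suc.prems(2) subspace_supp] by auto
  have IH: "mp.dim V' = card (lms V')"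
    by (rule Suc.hyps(1)[OF _ _ V']) (use Suc.hyps(2) Suc.prems(1) n(1) in auto)
  show ?case
  proof (cases "V = V'")
    case False
    then obtain f where f: "f \<in> V" "f \<notin> V'" unfolding V'_def by blast
    have mem: "g \<in> V' \<longleftrightarrow> lookup g n = 0" if "g \<in> V" for g
      using that Suc.prems(3) unfolding V'_def supp_def by (auto simp: in_keys_iff)
    have top: "leading_monomial g = n" if "g \<in> V" "lookup g n \<noteq> 0" for g
    proof (rule leading_monomial_eqI)
      show "n \<in> keys g" using that(2) by (simp add: in_keys_iff)
      fix m assume "m \<in> keys g" "m \<noteq> n"
      then show "m \<prec> n" using that(1) Suc.prems(3) n(2)[of m] by (auto simp: supp_def)
    qed
    have lms: "lms V = insert n (lms V')"
    proof
      show "lms V \<subseteq> insert n (lms V')" unfolding lms_def using top mem by blast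
      have "f \<noteq> 0" "leading_monomial f = n" using f mem[of f] top[of f] by auto
      then show "insert n (lms V') \<subseteq> lms V" using f(1) unfolding lms_def V'_def by blast
    qed
    have "n \<notin> lms V'" using lms_subset[OF V'(2)] by blast
    moreover have "finite (lms V')" using lms_subset[OF V'(2)] Suc.prems(1) finite_subset by blast
    moreover have "mp.dim V = Suc (mp.dim V')"
    proof -
      have "V \<subseteq> mp.span (insert f V')"
      proof
        fix g assume g: "g \<in> V"
        \<comment> \<open>Chosen to cancel the term \<open>n\<close>, so that \<open>V\<close> is
          spanned by \<open>f\<close> and \<open>V'\<close>.\<close>
        define c where "c = lookup g n / lookup f n"
        have "g - Const c * f \<in> V" using g f Suc.prems(2) mp.subspace_diff mp.subspace_scale by blast
        moreover have "lookup (g - Const c * f) n = 0"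
          using f mem by (simp add: c_def lookup_minus lookup_Const_times)
        ultimately have "g - Const c * f \<in> V'" using mem by blast
        then show "g \<in> mp.span (insert f V')" unfolding mp.span_insert using mp.span_base by blast
      qed
      moreover have "mp.span (insert f V') \<subseteq> V"
        using f(1) V'_def by (intro mp.span_minimal Suc.prems(2)) blast
      ultimately have "mp.dim V = mp.dim (insert f V')" by (metis mp.dim_span subset_antisym)
      moreover have "f \<notin> mp.span V'" using f(2) V'(1) by (simp add: mp.span_eq_iff[THEN iffD2])
      moreover have "mp.fdim V'" using V'(2) fdim_supp[of "X - {n}"] Suc.prems(1) mp.fdim_subset by blast
      ultimately show ?thesis using mp.dim_insert_fdim by simp
    qed
    ultimately show ?thesis using lms IH by simp
  qed (use IH in simp)
qed

definition lsum :: "('x, 'k::comm_ring_1) mpoly set \<Rightarrow> ('x, 'k) mpoly set \<Rightarrow> ('x, 'k) mpoly set" where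
  "lsum V W = {v + w |v w. v \<in> V \<and> w \<in> W}"

lemma subspace_lsum: "mp.subspace V \<Longrightarrow> mp.subspace W \<Longrightarrow> mp.subspace (lsum V W)"
  unfolding lsum_def by (rule mp.subspace_sums)

lemma lsum_subset: "V \<subseteq> supp X \<Longrightarrow> W \<subseteq> supp X \<Longrightarrow> lsum V W \<subseteq> supp X"
  unfolding lsum_def using supp_add by blast

text \<open>Initial segments of \<open>X\<close> for DegRevLex. Working modulo \<open>supp B\<close>
  forgets all terms in such a segment, which leaves every leading monomial outside \<open>B\<close>
  in place.\<close>

definition lower :: "nat monomial set \<Rightarrow> nat monomial set \<Rightarrow> bool" where
  "lower X B \<longleftrightarrow> B \<subseteq> X \<and> (\<forall>b\<in>B. \<forall>n\<in>X - B. b \<prec> n)"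

text \<open>A leading monomial of \<open>v + w\<close> outside \<open>B\<close> can only come from
  \<open>v\<close>, and it also leads \<open>v\<close>, because the terms of \<open>v\<close> in
  \<open>B\<close> are smaller and the others are terms of \<open>v + w\<close>.\<close>

lemma lms_lsum_lower:
  assumes V: "mp.subspace V" "V \<subseteq> (supp X :: (nat, 'k::field) mpoly set)" and B: "lower X B"
  shows "lms (lsum V (supp B)) = lms V \<union> B"
proof (intro equalityI subsetI)
  fix m assume "m \<in> lms (lsum V (supp B))"
  then obtain v w where vw: "v \<in> V" "w \<in> supp B" "v + w \<noteq> 0" "m = leading_monomial (v + w)"
    unfolding lms_def lsum_def by blast
  show "m \<in> lms V \<union> B"
  proof (cases "m \<in> B")
    case False
    have w: "lookup w n = 0" if "n \<notin> B" for n using vw(2) that by (auto simp: supp_iff)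
    have mv: "m \<in> keys v"
      using leading_monomial_in_keys[OF vw(3)] vw(4) w[OF False] by (simp add: in_keys_iff lookup_add)
    have "leading_monomial v = m"
    proof (rule leading_monomial_eqI[OF mv])
      fix n assume n: "n \<in> keys v" "n \<noteq> m"
      show "n \<prec> m"
      proof (cases "n \<in> B")
        case True
        have "m \<in> X" using mv V(2) vw(1) by (auto simp: supp_def)
        then show ?thesis using True False B unfolding lower_def by blast
      next
        case False
        then have "n \<in> keys (v + w)" using n w by (simp add: in_keys_iff lookup_add)
        then show ?thesis using leading_monomial_greater[OF vw(3)] n vw(4) by blast
      qed
    qed
    moreover have "v \<noteq> 0" using mv by auto
    ultimately show ?thesis using vw(1) unfolding lms_def by blast
  qed simp
next
  fix m assume "m \<in> lms V \<union> B"
  then show "m \<in> lms (lsum V (supp B))"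
  proof
    assume "m \<in> lms V"
    then obtain f where "f \<in> V" "f \<noteq> 0" "m = leading_monomial f" unfolding lms_def by blast
    moreover have "f + 0 \<in> lsum V (supp B)" unfolding lsum_def using \<open>f \<in> V\<close> zero_in_supp by blast
    ultimately show ?thesis unfolding lms_def by auto
  next
    assume "m \<in> B"
    then have "0 + xmon m \<in> lsum V (supp B)" unfolding lsum_def
      using mp.subspace_0[OF V(1)] single_in_supp by blast
    moreover have "xmon m \<noteq> (0 :: (nat, 'k) mpoly)" by (metis keys_eq_empty keys_single insert_not_empty zero_neq_one)
    ultimately show ?thesis unfolding lms_def by (metis (mono_tags, lifting) add_0 leading_monomial_xmon mem_Collect_eq)
  qed
qed

lemma dim_lsum_lower:
  assumes "finite X" "mp.subspace V" "V \<subseteq> (supp X :: (nat, 'k::field) mpoly set)" "lower X B"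
  shows "mp.dim (lsum V (supp B)) = card (lms V \<union> B)"
proof -
  have "supp B \<subseteq> supp X" using assms(4) supp_mono unfolding lower_def by blast
  then show ?thesis
    using dim_eq_card_lms[OF assms(1) subspace_lsum[OF assms(2) subspace_supp] lsum_subset[OF assms(3)], of B]
      lms_lsum_lower[OF assms(2-4)] by simp
qed

text \<open>The dimension of \<open>V + supp B\<close> counts \<open>lms V\<close> together with
  \<open>B\<close>, so enlarging \<open>B\<close> by one monomial detects whether that monomial
  leads an element of \<open>V\<close>. Thus \<open>lms V\<close> is determined by dimensions, which
  are accessible to rank arguments.\<close>

lemma lms_eqI:
  assumes X: "finite X" and V: "mp.subspace V" "V \<subseteq> (supp X :: (nat, 'k::field) mpoly set)"
    and W: "mp.subspace W" "W \<subseteq> (supp X :: (nat, 'k::field) mpoly set)"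
    and dims: "\<And>B. lower X B \<Longrightarrow> mp.dim (lsum V (supp B)) = mp.dim (lsum W (supp B))"
  shows "lms V = lms W"
proof -
  have *: "lms V \<subseteq> lms W"
    if V: "mp.subspace V" "V \<subseteq> supp X" and W: "mp.subspace W" "W \<subseteq> supp X"
      and dims: "\<And>B. lower X B \<Longrightarrow> mp.dim (lsum V (supp B)) = mp.dim (lsum W (supp B))"
    for V W :: "(nat, 'k) mpoly set"
  proof (rule subsetI, rule ccontr)
    fix m assume m: "m \<in> lms V" "m \<notin> lms W"
    have mX: "m \<in> X" using m(1) lms_subset[OF V(2)] by blast
    \<comment> \<open>The segment strictly below \<open>m\<close>, to be compared with the one that
      includes \<open>m\<close>: adding \<open>m\<close> changes the count for \<open>W\<close> but
      not for \<open>V\<close>.\<close>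
    let ?B = "{b \<in> X. b \<prec> m}"
    have not_less: "m \<prec> n \<or> n = m" if "\<not> n \<prec> m" for n using that drl_total by blast
    have low: "lower X ?B" "lower X (insert m ?B)"
      unfolding lower_def using mX not_less drl_trans[of _ m] by auto
    have "card (lms W \<union> insert m ?B) = card (lms V \<union> insert m ?B)"
      using dims[OF low(2)] dim_lsum_lower[OF X V low(2)] dim_lsum_lower[OF X W low(2)] by simp
    also have "\<dots> = card (lms V \<union> ?B)" using m(1) by (simp add: insert_absorb)
    also have "\<dots> = card (lms W \<union> ?B)"
      using dims[OF low(1)] dim_lsum_lower[OF X V low(1)] dim_lsum_lower[OF X W low(1)] by simp
    finally have "card (insert m (lms W \<union> ?B)) = card (lms W \<union> ?B)" by simp
    moreover have "finite (lms W \<union> ?B)" using lms_subset[OF W(2)] X finite_subset by auto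
    moreover have "m \<notin> lms W \<union> ?B" using m(2) by simp
    ultimately show False by simp
  qed
  show ?thesis using *[OF V W dims] *[OF W V dims[symmetric]] by blast
qed

text \<open>One coordinate at a time: pass to a monotone subsequence, and if it decreases, drop an
  initial part so that it becomes constant. Subsequences keep what was achieved for earlier
  coordinates.\<close>

lemma monotone_subseq_coordinates:
  fixes s :: "nat \<Rightarrow> 'a \<Rightarrow> nat"
  assumes "finite A"
  shows "\<exists>r::nat \<Rightarrow> nat. strict_mono r \<and> (\<forall>a\<in>A. \<forall>i j. i \<le> j \<longrightarrow> s (r i) a \<le> s (r j) a)"
  using assms
proof (induction A rule: finite_induct)
  case empty
  show ?case by (rule exI[of _ id]) (simp add: strict_mono_def)
next
  case (insert a A)
  then obtain r :: "nat \<Rightarrow> nat" where r: "strict_mono r" "\<forall>a\<in>A. \<forall>i j. i \<le> j \<longrightarrow> s (r i) a \<le> s (r j) a" by metis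
  obtain q where q: "strict_mono q" "monoseq (\<lambda>n. s (r (q n)) a)"
    using seq_monosub[of "\<lambda>n. s (r n) a"] by auto
  have "\<exists>k. \<forall>i j. i \<le> j \<longrightarrow> s (r (q (i + k))) a \<le> s (r (q (j + k))) a"
  proof (cases "\<forall>m n. m \<le> n \<longrightarrow> s (r (q m)) a \<le> s (r (q n)) a")
    case True
    then show ?thesis by auto
  next
    case False
    then have dec: "\<forall>m n. m \<le> n \<longrightarrow> s (r (q n)) a \<le> s (r (q m)) a"
      using q(2) unfolding monoseq_def by auto
    \<comment> \<open>An index where the decreasing sequence attains its minimum; from
      \<open>k\<close> on it is constant.\<close>
    obtain k where k: "\<And>n. s (r (q k)) a \<le> s (r (q n)) a"
      using ex_has_least_nat[of "\<lambda>_. True" 0 "\<lambda>n. s (r (q n)) a"] by blast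
    have "s (r (q (i + k))) a \<le> s (r (q (j + k))) a" for i j
      using dec k[of "j + k"] by (meson le_add2 le_trans)
    then show ?thesis by blast
  qed
  then obtain k where k: "\<And>i j. i \<le> j \<Longrightarrow> s (r (q (i + k))) a \<le> s (r (q (j + k))) a" by blast
  have "strict_mono (\<lambda>i. r (q (i + k)))" using r(1) q(1) by (simp add: strict_mono_def)
  moreover have "s (r (q (i + k))) b \<le> s (r (q (j + k))) b" if "b \<in> A" "i \<le> j" for b i j
    using r(2) that q(1) by (simp add: strict_mono_less_eq)
  ultimately show ?case using k by (intro exI[of _ "\<lambda>i. r (q (i + k))"]) auto
qed

text \<open>Dickson's lemma in the form used for rgin: the members of \<open>E\<close> of bounded
  degree already divide all the others. Otherwise there are witnesses, each divisible by no member
  of small degree, and a subsequence increasing in every coordinate contradicts this.\<close>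

lemma dickson:
  assumes E: "E \<subseteq> mons l"
  shows "\<exists>D. \<forall>m\<in>E. \<exists>n\<in>E. mdeg n \<le> D \<and> (\<exists>r\<in>mons l. m = n + r)"
proof (rule ccontr)
  assume "\<not> ?thesis"
  then have "\<forall>D. \<exists>m\<in>E. \<forall>n\<in>E. mdeg n \<le> D \<longrightarrow> \<not> (\<exists>r\<in>mons l. m = n + r)" by blast
  then obtain w where w: "\<And>D. w D \<in> E"
    "\<And>D n. n \<in> E \<Longrightarrow> mdeg n \<le> D \<Longrightarrow> \<not> (\<exists>r\<in>mons l. w D = n + r)" by metis
  \<comment> \<open>The bounds grow past the degree of each witness, so that \<open>w (D j)\<close>
    must not be a multiple of an earlier \<open>w (D i)\<close>.\<close>
  define D where "D = rec_nat 0 (\<lambda>_ b. max b (mdeg (w b)))"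
  have D: "D (Suc k) = max (D k) (mdeg (w (D k)))" for k by (simp add: D_def)
  have mono: "i \<le> j \<Longrightarrow> D i \<le> D j" for i j by (rule lift_Suc_mono_le) (simp_all add: D)
  obtain r :: "nat \<Rightarrow> nat" where r: "strict_mono r"
    "\<forall>a\<in>{1..l}. \<forall>i j. i \<le> j \<longrightarrow> lookup (w (D (r i))) a \<le> lookup (w (D (r j))) a"
    using monotone_subseq_coordinates[of "{1..l}" "\<lambda>i. lookup (w (D i))"] by auto
  let ?m = "w (D (r 0))" and ?n = "w (D (r 1))"
  have le: "lookup ?m a \<le> lookup ?n a" for a
  proof (cases "a \<in> {1..l}")
    case True
    then show ?thesis using r(2) by (meson zero_le)
  next
    case False
    then have "a \<notin> keys ?m" using w(1) E unfolding mons_def by blast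
    then show ?thesis by (simp add: in_keys_iff)
  qed
  have "?n = ?m + (?n - ?m)" by (rule poly_mapping_eqI) (simp add: lookup_add lookup_minus le_add_diff_inverse[OF le] del: One_nat_def)
  moreover have "?n - ?m \<in> mons l"
  proof -
    have "keys (?n - ?m) \<subseteq> keys ?n" by (auto simp: in_keys_iff lookup_minus)
    then show ?thesis using w(1) E unfolding mons_def by blast
  qed
  moreover have "mdeg ?m \<le> D (r 1)"
  proof -
    have "mdeg ?m \<le> D (Suc (r 0))" by (simp add: D)
    also have "\<dots> \<le> D (r 1)" using r(1) by (intro mono) (simp add: strict_mono_def Suc_leI)
    finally show ?thesis .
  qed
  ultimately show False using w by blast
qed


section \<open>Linear substitutions\<close>

lemma Const_sum: "Const (\<Sum>i\<in>A. c i) = (\<Sum>i\<in>A. Const (c i))"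
  by (induction A rule: infinite_finite_induct) (auto simp: Const_add)

text \<open>For composing coordinate changes: an algebra endomorphism is determined by what it does
  to the variables.\<close>

lemma hom_subst_mpoly:
  fixes H :: "('x, 'k::comm_ring_1) mpoly \<Rightarrow> ('x, 'k) mpoly" and f :: "('x, 'k) mpoly"
  assumes H: "\<And>f g. H (f + g) = H f + H g" "\<And>f g. H (f * g) = H f * H g" "\<And>c. H (Const c) = Const c"
  shows "H (subst_mpoly Const \<phi> f) = subst_mpoly Const (\<lambda>i. H (\<phi> i)) f"
proof -
  have 0: "H 0 = 0" "H 1 = 1" using H(3)[of 0] H(3)[of 1] by simp_all
  have sum: "H (\<Sum>i\<in>A. h i) = (\<Sum>i\<in>A. H (h i))" for A :: "'x monomial set" and h
    by (induction A rule: infinite_finite_induct) (auto simp: 0 H)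
  have prod: "H (\<Prod>i\<in>A. h i) = (\<Prod>i\<in>A. H (h i))" for A :: "'x set" and h
    by (induction A rule: infinite_finite_induct) (auto simp: 0 H)
  have pow: "H (a ^ n) = H a ^ n" for a n by (induction n) (auto simp: 0 H)
  show ?thesis unfolding subst_mpoly_def by (simp add: sum prod pow H(2,3))
qed

lemma subst_mpoly_cong:
  assumes "\<And>i. i \<in> vars f \<Longrightarrow> \<phi> i = \<psi> i"
  shows "subst_mpoly h \<phi> f = subst_mpoly h \<psi> f"
  unfolding subst_mpoly_def
proof (intro sum.cong refl arg_cong2[where f = "(*)"] prod.cong)
  fix m i assume "m \<in> keys f" "i \<in> keys m"
  then have "i \<in> vars f" unfolding vars_def by blast
  then show "\<phi> i ^ lookup m i = \<psi> i ^ lookup m i" using assms by simp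
qed

lemma Var_power: "Var i ^ k = Poly_Mapping.single (Poly_Mapping.single i k) 1"
  by (induction k) (simp_all add: Var_def mult_single single_add[symmetric])

lemma subst_mpoly_Var: "subst_mpoly Const Var f = (f :: ('x, 'k::comm_ring_1) mpoly)"
proof (induction f rule: mpoly_induct)
  case (single m c)
  have "finite A \<Longrightarrow> (\<Prod>i\<in>A. Var i ^ k i) = (Poly_Mapping.single (\<Sum>i\<in>A. Poly_Mapping.single i (k i)) 1 :: ('x, 'k) mpoly)" for A k
    by (induction A rule: finite_induct) (auto simp: Var_power mult_single)
  then have "eval_monom Var m = (Poly_Mapping.single m 1 :: ('x, 'k) mpoly)"
    unfolding eval_monom_def by (simp add: mpoly_expand[symmetric])
  then show ?case by (simp add: subst_mpoly_single Const_def mult_single)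
qed (simp add: subst_mpoly_add[of Const] Const_add)

lemma linear_form_homog [simp]: "linear_form l v \<in> homog_part l 1"
proof -
  have "Const (v $ i) * Var (Suc i) \<in> homog_part l 1" if "i < l" for i
    using homog_mult[OF Const_homog Var_homog[of "Suc i" l]] that by simp
  then show ?thesis unfolding linear_form_def homog_part_eq by (intro supp_sum) auto
qed

context
  fixes l :: nat and g :: "'k::field mat"
begin

lemma GL_act_add: "GL_act l g (a + b) = GL_act l g a + GL_act l g b"
  unfolding GL_act_def by (rule subst_mpoly_add) (simp_all add: Const_add)

lemma GL_act_mult: "GL_act l g (a * b) = GL_act l g a * GL_act l g b"
  unfolding GL_act_def by (rule subst_mpoly_mult) (simp_all add: Const_add Const_mult)

lemma GL_act_Const [simp]: "GL_act l g (Const c) = Const c"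
  unfolding GL_act_def by (subst Const_def) (simp add: subst_mpoly_single)

lemma GL_act_0 [simp]: "GL_act l g 0 = 0"
  using GL_act_Const[of 0] by simp

lemma GL_act_1 [simp]: "GL_act l g 1 = 1"
  using GL_act_Const[of 1] by simp

lemma GL_act_power: "GL_act l g (a ^ n) = GL_act l g a ^ n"
  by (induction n) (auto simp: GL_act_mult)

lemma GL_act_sum: "GL_act l g (\<Sum>i\<in>A. f i) = (\<Sum>i\<in>A. GL_act l g (f i))"
  by (induction A rule: infinite_finite_induct) (auto simp: GL_act_add)

lemma GL_act_Var: "GL_act l g (Var i) = linear_form l (col g (i - 1))"
  unfolding GL_act_def Var_def by (simp add: subst_mpoly_single)

lemma linear_GL_act: "Vector_Spaces.linear (\<lambda>(c::'k) f. Const c * f) (\<lambda>c f. Const c * f) (GL_act l g)"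
  by unfold_locales (simp_all add: algebra_simps Const_add Const_mult GL_act_add GL_act_mult)

lemma GL_act_homog:
  assumes "f \<in> homog_part l d" shows "GL_act l g f \<in> homog_part l d"
proof -
  have "GL_act l g (Poly_Mapping.single m c) \<in> homog_part l d" if m: "m \<in> mon l d" for m c
  proof -
    have "finite A \<Longrightarrow> (\<Prod>i\<in>A. linear_form l (col g (i - 1)) ^ k i) \<in> homog_part l (\<Sum>i\<in>A. k i)" for A k
    proof (induction A rule: finite_induct)
      case empty
      show ?case using Const_homog[of 1] by simp
    next
      case (insert i A)
      then show ?case using homog_mult homog_power[OF linear_form_homog, of l "col g (i - 1)" "k i"] by simp
    qed
    then have "eval_monom (\<lambda>i. linear_form l (col g (i - 1))) m \<in> homog_part l d"
      using m unfolding eval_monom_def mon_def mdeg_def by auto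
    then have "Const c * eval_monom (\<lambda>i. linear_form l (col g (i - 1))) m \<in> homog_part l (0 + d)"
      by (rule homog_mult[OF Const_homog])
    then show ?thesis unfolding GL_act_def by (simp add: subst_mpoly_single)
  qed
  moreover have "GL_act l g f = (\<Sum>m\<in>keys f. GL_act l g (Poly_Mapping.single m (lookup f m)))"
    by (subst mpoly_expand[of f]) (rule GL_act_sum)
  ultimately show ?thesis
    using assms unfolding homog_part_eq supp_def[of "mon l d"] by (auto intro!: supp_sum[unfolded supp_def, simplified])
qed

lemma GL_act_carrier:
  assumes f: "f \<in> polys l" shows "GL_act l g f \<in> polys l"
proof -
  have "GL_act l g f = (\<Sum>d\<in>mdeg ` keys f. GL_act l g (hc d f))"
    by (subst sum_hc[of "mdeg ` keys f" f]) (simp_all add: GL_act_sum)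
  moreover have "GL_act l g (hc d f) \<in> supp (mons l)" for d
    using GL_act_homog[OF hc_homog[OF f]] homog_carrier carrier_poly_ring by blast
  ultimately show ?thesis unfolding carrier_poly_ring by (simp add: supp_sum)
qed

lemma GL_act_hc:
  assumes f: "f \<in> polys l" shows "hc d (GL_act l g f) = GL_act l g (hc d f)"
proof -
  \<comment> \<open>The degree \<open>d\<close> is inserted so that the sum has this index even when
    \<open>f\<close> has no term of degree \<open>d\<close>.\<close>
  let ?D = "insert d (mdeg ` keys f)"
  have "GL_act l g f = (\<Sum>e\<in>?D. GL_act l g (hc e f))"
    by (subst sum_hc[of ?D f]) (simp_all only: GL_act_sum, auto)
  then have "hc d (GL_act l g f) = (\<Sum>e\<in>?D. hc d (GL_act l g (hc e f)))" by (simp only: hc_sum)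
  also have "\<dots> = (\<Sum>e\<in>?D. if e = d then GL_act l g (hc d f) else 0)"
  proof (rule sum.cong[OF refl])
    fix e show "hc d (GL_act l g (hc e f)) = (if e = d then GL_act l g (hc d f) else 0)"
      using hc_of_homog[OF GL_act_homog[OF hc_homog[OF f]], of d e] by auto
  qed
  finally show ?thesis by simp
qed

end

text \<open>The columns of \<open>g\<close> are the images of the variables, so coefficient vectors
  are multiplied by \<open>g\<close> from the left.\<close>

lemma GL_act_linear_form:
  assumes g: "g \<in> carrier_mat l l" and v: "v \<in> carrier_vec l"
  shows "GL_act l g (linear_form l v) = linear_form l (g *\<^sub>v (v :: 'k::field vec))"
proof -
  have "GL_act l g (linear_form l v) = (\<Sum>i<l. Const (v $ i) * linear_form l (col g i))"
    unfolding linear_form_def[of l v] by (simp add: GL_act_sum GL_act_mult GL_act_Var)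
  also have "\<dots> = (\<Sum>i<l. \<Sum>a<l. Const (v $ i * g $$ (a, i)) * Var (Suc a))"
  proof (rule sum.cong[OF refl])
    fix i assume "i \<in> {..<l}"
    then show "Const (v $ i) * linear_form l (col g i) = (\<Sum>a<l. Const (v $ i * g $$ (a, i)) * Var (Suc a))"
      unfolding linear_form_def sum_distrib_left Const_mult mult.assoc
      by (intro sum.cong refl) (use g in simp)
  qed
  also have "\<dots> = (\<Sum>a<l. \<Sum>i<l. Const (v $ i * g $$ (a, i)) * Var (Suc a))" by (rule sum.swap)
  also have "\<dots> = (\<Sum>a<l. Const (\<Sum>i<l. v $ i * g $$ (a, i)) * Var (Suc a))"
    by (simp add: Const_sum sum_distrib_right)
  also have "\<dots> = linear_form l (g *\<^sub>v v)" unfolding linear_form_def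
  proof (intro sum.cong refl arg_cong2[where f = "(*)"] arg_cong[where f = Const])
    fix a assume "a \<in> {..<l}"
    then have "(g *\<^sub>v v) $ a = (\<Sum>i<l. g $$ (a, i) * v $ i)"
      using g v by (simp add: scalar_prod_def lessThan_atLeast0)
    then show "(\<Sum>i<l. v $ i * g $$ (a, i)) = (g *\<^sub>v v) $ a" by (simp add: mult.commute)
  qed
  finally show ?thesis .
qed

lemma linear_form_unit:
  "i < l \<Longrightarrow> linear_form l (unit_vec l i) = (Var (Suc i) :: (nat, 'k::field) mpoly)"
proof -
  assume i: "i < l"
  have "linear_form l (unit_vec l i) = (\<Sum>j<l. if j = i then Var (Suc i) else (0 :: (nat, 'k) mpoly))"
    unfolding linear_form_def by (rule sum.cong) (use i in auto)
  then show ?thesis using i by simp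
qed

text \<open>Applying \<open>g\<close> to column \<open>i\<close> of \<open>w\<close> gives column
  \<open>i\<close> of \<open>g * w = 1\<close>, which is a variable. The second part is what moves
  given linear forms to variables.\<close>

lemma GL_act_inverse:
  assumes g: "g \<in> carrier_mat l l" and w: "w \<in> carrier_mat l l" and gw: "g * w = 1\<^sub>m l"
    and f: "f \<in> polys l"
  shows "GL_act l g (GL_act l w f) = (f :: (nat, 'k::field) mpoly)"
    and "i \<in> {1..l} \<Longrightarrow> GL_act l g (linear_form l (col w (i - 1))) = Var i"
proof -
  have V: "GL_act l g (linear_form l (col w (i - 1))) = Var i" if "i \<in> {1..l}" for i
  proof -
    have "GL_act l g (linear_form l (col w (i - 1))) = linear_form l (g *\<^sub>v col w (i - 1))"
      by (rule GL_act_linear_form[OF g]) (use w that in auto)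
    also have "g *\<^sub>v col w (i - 1) = col (g * w) (i - 1)" using g w that by (intro col_mult2[symmetric]) auto
    also have "\<dots> = unit_vec l (i - 1)" unfolding gw using that by (intro col_one) auto
    also have "linear_form l (unit_vec l (i - 1)) = (Var (Suc (i - 1)) :: (nat, 'k) mpoly)"
      by (rule linear_form_unit) (use that in auto)
    finally show ?thesis using that by simp
  qed
  then show "i \<in> {1..l} \<Longrightarrow> GL_act l g (linear_form l (col w (i - 1))) = Var i" .
  have "GL_act l g (GL_act l w f) = subst_mpoly Const (\<lambda>i. GL_act l g (linear_form l (col w (i - 1)))) f"
    unfolding GL_act_def[of l w] by (rule hom_subst_mpoly) (simp_all add: GL_act_add GL_act_mult)
  also have "\<dots> = subst_mpoly Const Var f"
  proof (rule subst_mpoly_cong)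
    fix i assume "i \<in> vars f"
    then have "i \<in> {1..l}" using f by (auto simp: poly_ring_def)
    then show "GL_act l g (linear_form l (col w (i - 1))) = Var i" by (rule V)
  qed
  finally show "GL_act l g (GL_act l w f) = f" by (simp add: subst_mpoly_Var)
qed

section \<open>Invertible matrices and the images of ideals under them\<close>

lemma GL_inverse:
  assumes "g \<in> GL l"
  obtains w where "w \<in> GL l" "g * w = 1\<^sub>m l" "w * g = 1\<^sub>m l" "g \<in> carrier_mat l l" "w \<in> carrier_mat l l"
proof -
  have g: "g \<in> carrier_mat l l" using assms unfolding GL_def by blast
  obtain w where w: "g * w = 1\<^sub>m (dim_row g)" "w * g = 1\<^sub>m (dim_row w)"
    using assms unfolding GL_def invertible_mat_def inverts_mat_def by blast
  have "dim_col (g * w) = l" "dim_col (w * g) = dim_row w" using w g by simp_all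
  then have "w \<in> carrier_mat l l" using g by auto
  moreover then have "w \<in> GL l" using w g unfolding GL_def invertible_mat_def inverts_mat_def by auto
  ultimately show ?thesis using that w g by auto
qed

lemma GL_I: "g \<in> carrier_mat l l \<Longrightarrow> w \<in> carrier_mat l l \<Longrightarrow> g * w = 1\<^sub>m l \<Longrightarrow> w * g = 1\<^sub>m l \<Longrightarrow> g \<in> GL l"
  unfolding GL_def invertible_mat_def inverts_mat_def by auto

abbreviation sq :: "nat \<Rightarrow> (nat \<times> nat) set" where
  "sq l \<equiv> {..<l} \<times> {..<l}"

lemma det_nonzero_GL:
  assumes A: "A \<in> carrier_mat l l" and d: "det A \<noteq> (0 :: 'k::field)" shows "A \<in> GL l"
proof -
  have "A \<in> Units (ring_mat TYPE('k) l undefined)" by (rule det_non_zero_imp_unit[OF A d])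
  then obtain B where "B \<in> carrier_mat l l" "A * B = 1\<^sub>m l" "B * A = 1\<^sub>m l"
    unfolding Units_def ring_mat_def by auto
  then show ?thesis using GL_I[OF A] by blast
qed

lemma polyfn_det:
  assumes "\<And>i j. i < l \<Longrightarrow> j < l \<Longrightarrow> polyfn X (\<lambda>p. a p (i, j))"
  shows "polyfn X (\<lambda>p. det (mat l l (a p)) :: 'k::comm_ring_1)"
proof -
  have "det (mat l l (a p)) = (\<Sum>\<pi> \<in> {\<pi>. \<pi> permutes {0..<l}}. signof \<pi> * (\<Prod>i = 0..<l. a p (i, \<pi> i)))" for p
    unfolding det_def'[OF mat_carrier]
    by (intro sum.cong refl arg_cong2[where f = "(*)"] prod.cong) (auto simp: permutes_in_image)
  moreover have "polyfn X (\<lambda>p. \<Sum>\<pi> \<in> {\<pi>. \<pi> permutes {0..<l}}. signof \<pi> * (\<Prod>i = 0..<l. a p (i, \<pi> i)))"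
    by (intro polyfn_sum polyfn_mult polyfn_const polyfn_prod) (auto intro!: assms simp: permutes_in_image)
  ultimately show ?thesis by simp
qed

lemma generic_GL: "generic (sq l) (\<lambda>p. mat l l p \<in> (GL l :: 'k::field_char_0 mat set))"
  unfolding generic_def
proof (intro exI[of _ "\<lambda>p. det (mat l l p)"] conjI allI impI)
  show "polyfn (sq l) (\<lambda>p. det (mat l l p) :: 'k)" by (rule polyfn_det) simp
  have "mat l l (\<lambda>(i, j). if i = j then 1 else 0) = (1\<^sub>m l :: 'k mat)" by (rule eq_matI) auto
  then have "det (mat l l (\<lambda>(i, j). if i = j then 1 else 0)) \<noteq> (0 :: 'k)" by simp
  then show "\<exists>p. det (mat l l p) \<noteq> (0 :: 'k)" by blast
qed (rule det_nonzero_GL[OF mat_carrier])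

lemma polyvec_GL_act: "polyvec (sq l) (\<lambda>p. GL_act l (mat l l p) (f :: (nat, 'k::field) mpoly))"
  if f: "f \<in> polys l"
proof -
  have "polyvec (sq l) (\<lambda>p. linear_form l (col (mat l l p) (i - 1)) :: (nat, 'k) mpoly)" if "i \<in> {1..l}" for i
  proof -
    have "linear_form l (col (mat l l p) (i - 1)) = (\<Sum>a<l. Const (p (a, i - 1)) * Var (Suc a))" for p :: "nat \<times> nat \<Rightarrow> 'k"
      unfolding linear_form_def by (rule sum.cong) (use that in auto)
    moreover have "polyvec (sq l) (\<lambda>p. \<Sum>a<l. Const (p (a, i - 1) :: 'k) * Var (Suc a) :: (nat, 'k) mpoly)"
      by (intro polyvec_sum polyvec_mult polyvec_Const polyfn_var polyvec_const) (use that in auto)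
    ultimately show ?thesis by simp
  qed
  then show ?thesis unfolding GL_act_def subst_mpoly_def
    by (intro polyvec_sum polyvec_mult polyvec_const polyvec_prod polyvec_power)
      (use f in \<open>auto simp: poly_ring_def vars_def\<close>)
qed

text \<open>The image absorbs products because every \<open>a\<close> is itself an image, namely of
  \<open>GL_act l w a\<close> with \<open>w\<close> inverse to \<open>g\<close>.\<close>

lemma ideal_GL_act:
  assumes g: "g \<in> GL l" and J: "ideal J (poly_ring l)"
  shows "ideal (GL_act l g ` J) (poly_ring l :: (nat, 'k::field) mpoly ring)"
proof -
  obtain w where w: "g * w = 1\<^sub>m l" "g \<in> carrier_mat l l" "w \<in> carrier_mat l l" using GL_inverse[OF g] by metis
  show ?thesis unfolding ideal_poly_ring_iff
  proof (intro conjI ballI)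
    show "GL_act l g ` J \<subseteq> polys l" using J GL_act_carrier unfolding ideal_poly_ring_iff by blast
    have "GL_act l g 0 \<in> GL_act l g ` J" using J unfolding ideal_poly_ring_iff by blast
    then show "0 \<in> GL_act l g ` J" by simp
    show "f + f' \<in> GL_act l g ` J" if ff: "f \<in> GL_act l g ` J" "f' \<in> GL_act l g ` J" for f f'
    proof -
      obtain a b where ab: "a \<in> J" "b \<in> J" "f = GL_act l g a" "f' = GL_act l g b" using ff by blast
      then have "f + f' = GL_act l g (a + b)" "a + b \<in> J"
        using J unfolding ideal_poly_ring_iff by (simp_all add: GL_act_add)
      then show ?thesis by blast
    qed
    show "a * f \<in> GL_act l g ` J" if f: "f \<in> GL_act l g ` J" and a: "a \<in> polys l" for a f
    proof -
      obtain b where b: "b \<in> J" "f = GL_act l g b" using f by blast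
      have "a * f = GL_act l g (GL_act l w a * b)"
        by (simp add: GL_act_mult b GL_act_inverse(1)[OF w(2,3,1) a])
      moreover have "GL_act l w a * b \<in> J"
        using J b GL_act_carrier[OF a] unfolding ideal_poly_ring_iff by blast
      ultimately show ?thesis by blast
    qed
  qed
qed

lemma homog_ideal_GL_act:
  assumes g: "g \<in> GL l" and J: "homog_ideal l J"
  shows "homog_ideal l (GL_act l g ` (J :: (nat, 'k::field) mpoly set))"
  unfolding homog_ideal_def
proof (intro conjI ballI allI)
  show "ideal (GL_act l g ` J) (poly_ring l)" by (rule ideal_GL_act[OF g homog_ideal_ideal[OF J]])
  fix f d assume "f \<in> GL_act l g ` J"
  then obtain a where a: "a \<in> J" "f = GL_act l g a" by blast
  then have "a \<in> polys l" using homog_ideal_ideal[OF J] unfolding ideal_poly_ring_iff by blast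
  then show "hc d f \<in> GL_act l g ` J" using GL_act_hc a J unfolding homog_ideal_def by blast
qed

lemma GL_act_ideal_part:
  assumes J: "homog_ideal l (J :: (nat, 'k::field) mpoly set)"
  shows "GL_act l g ` J \<inter> homog_part l d = GL_act l g ` (J \<inter> homog_part l d)"
proof
  show "GL_act l g ` J \<inter> homog_part l d \<subseteq> GL_act l g ` (J \<inter> homog_part l d)"
  proof
    fix f assume f: "f \<in> GL_act l g ` J \<inter> homog_part l d"
    then obtain a where a: "a \<in> J" "f = GL_act l g a" by blast
    then have ac: "a \<in> polys l" using homog_ideal_ideal[OF J] unfolding ideal_poly_ring_iff by blast
    have "f = hc d f" using hc_of_homog[of f l d d] f by auto
    then have "f = GL_act l g (hc d a)" using GL_act_hc[OF ac] a by metis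
    moreover have "hc d a \<in> J \<inter> homog_part l d" using a(1) J hc_homog[OF ac] unfolding homog_ideal_def by blast
    ultimately show "f \<in> GL_act l g ` (J \<inter> homog_part l d)" by blast
  qed
qed (use GL_act_homog in auto)

lemma dim_GL_act:
  assumes g: "g \<in> GL l" and V: "mp.subspace V" "V \<subseteq> homog_part l d"
  shows "mp.dim (GL_act l g ` V) = mp.dim (V :: (nat, 'k::field) mpoly set)"
proof -
  obtain w where w: "w * g = 1\<^sub>m l" "g \<in> carrier_mat l l" "w \<in> carrier_mat l l" using GL_inverse[OF g] by metis
  show ?thesis
  proof (rule mp.dim_inj_image[OF linear_GL_act V(1)])
    show "mp.fdim V" using fdim_homog V(2) mp.fdim_subset by blast
    fix v assume v: "v \<in> V" "GL_act l g v = 0"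
    have "v \<in> polys l" using v(1) V(2) homog_carrier by blast
    from GL_act_inverse(1)[OF w(3,2,1) this] have "v = GL_act l w (GL_act l g v)" by simp
    then show "v = 0" using v(2) by simp
  qed
qed


section \<open>The generic initial ideal\<close>

text \<open>As \<open>E\<close> is closed under multiplication by monomials, its linear span is
  already an ideal.\<close>

lemma Idl_xmon:
  assumes E: "E \<subseteq> mons l" "\<And>m n. m \<in> E \<Longrightarrow> n \<in> mons l \<Longrightarrow> m + n \<in> E"
  shows "ideal (supp E :: (nat, 'k::field) mpoly set) (poly_ring l)" and "gen_ideal l (xmon ` E) = (supp E :: (nat, 'k) mpoly set)"
proof -
  interpret R: ring "poly_ring l :: (nat, 'k) mpoly ring" by (rule ring_poly_ring)
  show I: "ideal (supp E :: (nat, 'k) mpoly set) (poly_ring l)"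
  proof -
    have "a * f \<in> supp E" if "f \<in> supp E" "a \<in> supp (mons l)" for a f :: "(nat, 'k) mpoly"
      by (rule supp_mult[OF that(2,1)]) (metis E(2) add.commute)
    then show ?thesis unfolding ideal_poly_ring_iff carrier_poly_ring
      using supp_mono[OF E(1)] by (auto simp: supp_add)
  qed
  have c: "xmon ` E \<subseteq> carrier (poly_ring l :: (nat, 'k) mpoly ring)" using E(1) unfolding carrier_poly_ring by auto
  show "gen_ideal l (xmon ` E) = (supp E :: (nat, 'k) mpoly set)"
  proof
    show "gen_ideal l (xmon ` E) \<subseteq> (supp E :: (nat, 'k) mpoly set)"
      by (rule R.genideal_minimal[OF I]) auto
    have "mp.subspace (gen_ideal l (xmon ` E) :: (nat, 'k) mpoly set)"
      by (rule ideal_poly_ring_subspace[OF R.genideal_ideal[OF c]])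
    then show "supp E \<subseteq> (gen_ideal l (xmon ` E) :: (nat, 'k) mpoly set)"
      using mp.span_minimal[OF R.genideal_self[OF c]] supp_subset_span by blast
  qed
qed

text \<open>The leading monomial of \<open>f\<close> also leads the component of \<open>f\<close> in
  its degree, and a homogeneous ideal contains that component.\<close>

lemma lms_ideal_part:
  assumes J: "homog_ideal l J"
  shows "lms J \<inter> mon l d = lms (J \<inter> homog_part l d :: (nat, 'k::field) mpoly set)"
proof
  show "lms (J \<inter> homog_part l d) \<subseteq> lms J \<inter> mon l d"
    using lms_subset[of "J \<inter> homog_part l d" "mon l d"] unfolding homog_part_eq lms_def by blast
  show "lms J \<inter> mon l d \<subseteq> lms (J \<inter> homog_part l d)"
  proof
    fix m assume m: "m \<in> lms J \<inter> mon l d"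
    then obtain f where f: "f \<in> J" "f \<noteq> 0" "m = leading_monomial f" unfolding lms_def by blast
    have fc: "f \<in> polys l" using homog_ideal_ideal[OF J] f(1) unfolding ideal_poly_ring_iff by blast
    have "m \<in> keys (hc d f)"
      using leading_monomial_in_keys[OF f(2)] f(3) m by (simp add: in_keys_iff lookup_hc mon_def)
    moreover have "leading_monomial (hc d f) = m"
    proof (rule leading_monomial_eqI[OF calculation])
      fix n assume n: "n \<in> keys (hc d f)" "n \<noteq> m"
      then have "n \<in> keys f" by (auto simp: in_keys_iff lookup_hc split: if_splits)
      then show "n \<prec> m" using leading_monomial_greater[OF f(2)] f(3) n(2) by blast
    qed
    moreover have "hc d f \<in> J \<inter> homog_part l d" using J f(1) hc_homog[OF fc] unfolding homog_ideal_def by blast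
    ultimately show "m \<in> lms (J \<inter> homog_part l d)" unfolding lms_def by force
  qed
qed

lemma lms_ideal:
  assumes J: "ideal J (poly_ring l)"
  shows "lms J \<subseteq> mons l" and "m \<in> lms (J :: (nat, 'k::field) mpoly set) \<Longrightarrow> n \<in> mons l \<Longrightarrow> m + n \<in> lms J"
proof -
  show "lms J \<subseteq> mons l" by (rule lms_subset) (use J in \<open>simp add: ideal_poly_ring_iff carrier_poly_ring\<close>)
  assume "m \<in> lms J" and n: "n \<in> mons l"
  then obtain f where f: "f \<in> J" "f \<noteq> 0" "m = leading_monomial f" unfolding lms_def by blast
  have "xmon n * f \<in> J" using J f(1) n unfolding ideal_poly_ring_iff carrier_poly_ring by auto
  then show "m + n \<in> lms J"
    using leading_monomial_mult[OF f(2), of n] f(3) unfolding lms_def by (force simp: add.commute)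
qed

lemma LT_ideal_eq:
  assumes J: "ideal J (poly_ring l)"
  shows "LT_ideal l J = supp (lms (J :: (nat, 'k::field) mpoly set))"
proof -
  have "{Poly_Mapping.single (leading_monomial f) 1 |f. f \<in> J \<and> f \<noteq> 0} = (xmon ` lms J :: (nat, 'k) mpoly set)"
    unfolding lms_def by blast
  then show ?thesis unfolding LT_ideal_def using Idl_xmon(2)[OF lms_ideal[OF J]] by simp
qed

section \<open>Open sets of matrices and generic points\<close>

lemma mat_entries: "A \<in> carrier_mat m n \<Longrightarrow> mat m n (\<lambda>p. A $$ p) = A"
  by (rule eq_matI) auto

text \<open>One of the defining polynomials is nonzero at \<open>A\<close>. Its variables are in
  range, so its value at \<open>p\<close> is its value at the matrix cut out of
  \<open>p\<close>.\<close>

lemma zariski_open_generic: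
  assumes U: "zariski_open m n U" and A: "A \<in> U"
  shows "generic ({..<m} \<times> {..<n}) (\<lambda>p. mat m n p \<in> (U :: 'k::field_char_0 mat set))"
proof -
  obtain F where F: "\<forall>f\<in>F. vars f \<subseteq> {..<m} \<times> {..<n}"
    "U = {A \<in> carrier_mat m n. \<exists>f\<in>F. subst_mpoly id (\<lambda>p. A $$ p) f \<noteq> 0}"
    using U unfolding zariski_open_def by blast
  obtain f where f: "f \<in> F" "subst_mpoly id (\<lambda>p. A $$ p) f \<noteq> 0" using A F(2) by blast
  have pf: "polyfn ({..<m} \<times> {..<n}) (\<lambda>p. subst_mpoly id p f)" using F(1) f(1) unfolding polyfn_def by blast
  have "mat m n p \<in> U" if "subst_mpoly id p f \<noteq> 0" for p
  proof -
    have "subst_mpoly id (\<lambda>ij. mat m n p $$ ij) f = subst_mpoly id p f"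
      by (rule polyfn_restrict[OF pf]) auto
    then show ?thesis using F(2) f(1) that by auto
  qed
  then show ?thesis unfolding generic_def using pf f(2) by blast
qed

lemma generic_zariski_open:
  fixes Q :: "'k::field_char_0 mat \<Rightarrow> bool"
  assumes "generic ({..<m} \<times> {..<n}) (\<lambda>p. Q (mat m n p))"
  obtains U where "zariski_open m n U" "U \<noteq> {}" "\<And>A. A \<in> U \<Longrightarrow> Q A"
proof -
  obtain \<phi> p where \<phi>: "polyfn ({..<m} \<times> {..<n}) \<phi>" "\<phi> p \<noteq> 0" "\<And>p. \<phi> p \<noteq> 0 \<Longrightarrow> Q (mat m n p)"
    using assms unfolding generic_def by blast
  obtain f where f: "vars f \<subseteq> {..<m} \<times> {..<n}" "\<And>p. \<phi> p = subst_mpoly id p f"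
    using \<phi>(1) unfolding polyfn_def by blast
  define U where "U = {A \<in> carrier_mat m n. \<exists>g\<in>{f}. subst_mpoly id (\<lambda>p. A $$ p) g \<noteq> 0}"
  have "zariski_open m n U" unfolding zariski_open_def U_def using f(1) by (intro exI[of _ "{f}"]) simp
  moreover have "mat m n p \<in> U"
  proof -
    have "\<phi> (\<lambda>ij. mat m n p $$ ij) = \<phi> p" by (rule polyfn_restrict[OF \<phi>(1)]) auto
    then show ?thesis using \<phi>(2) f(2) unfolding U_def by simp
  qed
  moreover have "Q A" if "A \<in> U" for A
  proof -
    have "A \<in> carrier_mat m n" "\<phi> (\<lambda>p. A $$ p) \<noteq> 0" using that f(2) unfolding U_def by auto
    then show ?thesis using \<phi>(3)[of "\<lambda>p. A $$ p"] mat_entries by metis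
  qed
  ultimately show ?thesis using that by blast
qed

text \<open>The space is spanned by the images of a basis of the degree \<open>d\<close> part of
  \<open>I\<close>, which depend polynomially on the matrix, and by the fixed monomials in
  \<open>B\<close>; its dimension is therefore a rank to which \<open>generic_max_dim\<close>
  applies.\<close>

lemma generic_GL_act_dim:
  fixes I :: "(nat, 'k::field_char_0) mpoly set"
  assumes I: "ideal I (poly_ring l)" and B: "finite B"
  shows "generic (sq l) (\<lambda>p. \<forall>g\<in>carrier_mat l l.
    mp.dim (lsum (GL_act l g ` (I \<inter> homog_part l d)) (supp B)) \<le>
    mp.dim (lsum (GL_act l (mat l l p) ` (I \<inter> homog_part l d)) (supp B)))"
proof -
  obtain A where A: "finite A" "A \<subseteq> I \<inter> homog_part l d" "mp.span A = I \<inter> homog_part l d"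
    using mp.fdim_basis_subspace[OF subspace_ideal_part[OF I] fdim_ideal_part] by metis
  define v :: "(nat, 'k) mpoly + nat monomial \<Rightarrow> (nat \<times> nat \<Rightarrow> 'k) \<Rightarrow> (nat, 'k) mpoly"
    where "v = case_sum (\<lambda>f p. GL_act l (mat l l p) f) (\<lambda>b p. xmon b)"
  have span: "mp.span ((\<lambda>i. v i p) ` (A <+> B)) =
    lsum (GL_act l (mat l l p) ` (I \<inter> homog_part l d)) (supp B)" for p
  proof -
    interpret T: Vector_Spaces.linear "\<lambda>(c::'k) f. Const c * f" "\<lambda>c f. Const c * f" "GL_act l (mat l l p)"
      by (rule linear_GL_act)
    have "(\<lambda>i. v i p) ` (A <+> B) = GL_act l (mat l l p) ` A \<union> xmon ` B"
      unfolding v_def Plus_def by (auto simp: image_Un image_image)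
    then show ?thesis by (simp only: mp.span_Un T.span_image A(3) span_xmon_eq lsum_def)
  qed
  have "polyvec (sq l) (v i)" if "i \<in> A <+> B" for i
  proof (cases i)
    case (Inl f)
    then have "f \<in> polys l" using that A(2) homog_carrier by blast
    then show ?thesis using Inl polyvec_GL_act by (simp add: v_def)
  qed (simp add: v_def)
  then have "generic (sq l) (\<lambda>p. \<forall>q. mp.dim (mp.span ((\<lambda>i. v i q) ` (A <+> B))) \<le> mp.dim (mp.span ((\<lambda>i. v i p) ` (A <+> B))))"
    using A(1) B by (intro generic_max_dim) auto
  then show ?thesis unfolding span
    by (rule generic_mono[OF _ order_refl]) (metis mat_entries)
qed

text \<open>Galligo's theorem. In each degree the generic leading monomials are those of any \<open>g\<close> at which
  the finitely many dimensions of \<open>g I\<^sub>d + \<langle>B\<rangle>\<close> are maximal; by Dickson's lemma, an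
  open set which is good up to some degree is good in all degrees.\<close>

lemma rgin_exists:
  fixes I :: "(nat, 'k::field_char_0) mpoly set"
  assumes I: "homog_ideal l I"
  obtains E where "E \<subseteq> mons l" "\<And>m n. m \<in> E \<Longrightarrow> n \<in> mons l \<Longrightarrow> m + n \<in> E" "rgin l I = supp E"
    "\<And>d B g. lower (mon l d) B \<Longrightarrow> g \<in> carrier_mat l l \<Longrightarrow>
      mp.dim (lsum (GL_act l g ` (I \<inter> homog_part l d)) (supp B)) \<le> card (E \<inter> mon l d \<union> B)"
    "\<And>d B. lower (mon l d) B \<Longrightarrow>
      \<exists>g\<in>GL l. mp.dim (lsum (GL_act l g ` (I \<inter> homog_part l d)) (supp B)) = card (E \<inter> mon l d \<union> B)"
proof -
  note I' = homog_ideal_ideal[OF I]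
  define V where "V = (\<lambda>d g. GL_act l g ` (I \<inter> homog_part l d))"
  \<comment> \<open>All square matrices \<open>h\<close> are compared, not only invertible ones.
    There are finitely many sets \<open>B\<close> in each degree, so being good is a finite
    conjunction of generic conditions.\<close>
  define good where "good = (\<lambda>d g. g \<in> GL l \<and> (\<forall>B\<in>Pow (mon l d). \<forall>h\<in>carrier_mat l l.
    mp.dim (lsum (V d h) (supp B)) \<le> mp.dim (lsum (V d g) (supp B))))"
  have sV: "mp.subspace (V d g)" "V d g \<subseteq> supp (mon l d)" for d g
  proof -
    interpret T: Vector_Spaces.linear "\<lambda>(c::'k) f. Const c * f" "\<lambda>c f. Const c * f" "GL_act l g"
      by (rule linear_GL_act)
    show "mp.subspace (V d g)" unfolding V_def by (rule T.subspace_image[OF subspace_ideal_part[OF I']])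
    show "V d g \<subseteq> supp (mon l d)" unfolding V_def using GL_act_homog homog_part_eq by blast
  qed
  have gen: "generic (sq l) (\<lambda>p. good d (mat l l p))" for d
    unfolding good_def V_def
    by (intro generic_conj generic_GL generic_ball generic_GL_act_dim[OF I']) (auto simp: finite_mon finite_subset)
  have lms_good: "lms (V d g) = lms (V d h)" if "good d g" "good d h" for d g h
  proof (rule lms_eqI[OF finite_mon sV sV])
    fix B assume "lower (mon l d) B"
    then have "B \<in> Pow (mon l d)" unfolding lower_def by blast
    moreover have "g \<in> carrier_mat l l" "h \<in> carrier_mat l l" using that unfolding good_def GL_def by auto
    ultimately show "mp.dim (lsum (V d g) (supp B)) = mp.dim (lsum (V d h) (supp B))"
      using that unfolding good_def by (intro order_antisym) auto
  qed
  have ex: "\<exists>g. good d g" for d using generic_ex[OF gen] by blast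
  \<comment> \<open>Some good matrix is chosen in each degree; by \<open>lms_good\<close> the result
    does not depend on the choice.\<close>
  define E where "E = (\<Union>d. lms (V d (SOME g. good d g)))"
  have Ed: "E \<inter> mon l d = lms (V d g)" if g: "good d g" for d g
  proof -
    have s: "good d (SOME g. good d g)" for d using ex someI_ex by metis
    have sub: "lms (V e h) \<subseteq> mon l e" for e h by (rule lms_subset[OF sV(2)])
    have "E \<inter> mon l d \<subseteq> lms (V d (SOME g. good d g))"
    proof
      fix x assume x: "x \<in> E \<inter> mon l d"
      then obtain e where e: "x \<in> lms (V e (SOME g. good e g))" unfolding E_def by blast
      then have "e = d" using sub[of e] x unfolding mon_def by blast
      then show "x \<in> lms (V d (SOME g. good d g))" using e by simp
    qed
    moreover have "lms (V d (SOME g. good d g)) \<subseteq> E" unfolding E_def by (rule UN_upper) simp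
    ultimately have "E \<inter> mon l d = lms (V d (SOME g. good d g))" using sub[of d] by blast
    then show ?thesis using lms_good[OF s g] by simp
  qed
  have Emon: "E \<subseteq> mons l" unfolding E_def using lms_subset[OF sV(2)] mon_subset by blast
  have part: "lms (GL_act l g ` I) \<inter> mon l d = lms (V d g)" if "g \<in> GL l" for d g
    unfolding V_def GL_act_ideal_part[OF I, symmetric] by (rule lms_ideal_part[OF homog_ideal_GL_act[OF that I]])
  \<comment> \<open>The degrees of \<open>E\<close> are defined by separate choices. A single
    \<open>g\<close> that is good in both degrees involved links them, since the leading monomials
    of the ideal \<open>g I\<close> are closed under multiplication.\<close>
  have Emult: "m + n \<in> E" if m: "m \<in> E" and n: "n \<in> mons l" for m n
  proof -
    have md: "m \<in> mon l (mdeg m)" "m + n \<in> mon l (mdeg (m + n))"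
      using m n Emon mons_add by (auto simp: mon_def)
    obtain g where g: "good (mdeg m) g" "good (mdeg (m + n)) g"
      using generic_ex[OF generic_conj[OF gen[of "mdeg m"] gen[of "mdeg (m + n)"]]] by blast
    have gGL: "g \<in> GL l" using g unfolding good_def by blast
    have "m \<in> lms (GL_act l g ` I)" using m md(1) Ed[OF g(1)] part[OF gGL] by blast
    then have "m + n \<in> lms (GL_act l g ` I)" using lms_ideal(2)[OF ideal_GL_act[OF gGL I'] _ n] by blast
    then show ?thesis using md(2) Ed[OF g(2)] part[OF gGL] by blast
  qed
  obtain D where D: "\<And>m. m \<in> E \<Longrightarrow> \<exists>n\<in>E. mdeg n \<le> D \<and> (\<exists>r\<in>mons l. m = n + r)"
    using dickson[OF Emon] by blast
  have LT: "LT_ideal l (GL_act l g ` I) = supp E" if g: "\<forall>d\<in>{..D}. good d g" for g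
  proof -
    have gGL: "g \<in> GL l" using g unfolding good_def by blast
    have "lms (GL_act l g ` I) \<inter> mon l d = E \<inter> mon l d" for d
    proof -
      \<comment> \<open>Members of \<open>E\<close> of degree at most \<open>D\<close> lead elements
        of \<open>g I\<close>; their multiples follow because \<open>g I\<close> is an
        ideal.\<close>
      have sub: "E \<inter> mon l d \<subseteq> lms (GL_act l g ` I) \<inter> mon l d"
      proof
        fix m assume m: "m \<in> E \<inter> mon l d"
        then obtain n r where n: "n \<in> E" "mdeg n \<le> D" "r \<in> mons l" "m = n + r" using D by blast
        have "n \<in> mon l (mdeg n)" using n(1) Emon by (auto simp: mon_def)
        then have "n \<in> lms (GL_act l g ` I)" using Ed[of "mdeg n" g] part[OF gGL] n g by blast
        then show "m \<in> lms (GL_act l g ` I) \<inter> mon l d"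
          using lms_ideal(2)[OF ideal_GL_act[OF gGL I'] _ n(3)] n(4) m by blast
      qed
      \<comment> \<open>Equality by counting: invertible matrices preserve dimension, so both sides
        have as many elements as the dimension of the degree \<open>d\<close> part of
        \<open>I\<close>.\<close>
      obtain h where h: "good d h" using ex by blast
      have "h \<in> GL l" using h unfolding good_def by blast
      then have "card (lms (V d h)) = card (lms (V d g))"
        using dim_eq_card_lms[OF finite_mon sV] dim_GL_act[OF _ subspace_ideal_part[OF I'] Int_lower2] gGL
        unfolding V_def by metis
      then have "card (E \<inter> mon l d) = card (lms (GL_act l g ` I) \<inter> mon l d)"
        using Ed[OF h] part[OF gGL] by simp
      then show ?thesis using card_subset_eq[OF _ sub] finite_mon by auto
    qed
    moreover have "m \<in> mon l (mdeg m)" if "m \<in> mons l" for m using that by (simp add: mon_def)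
    ultimately have "lms (GL_act l g ` I) = E" using Emon lms_ideal(1)[OF ideal_GL_act[OF gGL I']] by blast
    then show ?thesis using LT_ideal_eq[OF ideal_GL_act[OF gGL I']] by simp
  qed
  have "generic (sq l) (\<lambda>p. \<forall>d\<in>{..D}. good d (mat l l p))" by (rule generic_ball) (auto intro: gen)
  from generic_zariski_open[of l l "\<lambda>g. \<forall>d\<in>{..D}. good d g", OF this]
  obtain U where U: "zariski_open l l U" "U \<noteq> {}" "\<And>g. g \<in> U \<Longrightarrow> \<forall>d\<in>{..D}. good d g"
    by metis
  have rgin: "rgin l I = supp E" unfolding rgin_def
  proof (rule the_equality)
    have "U \<inter> GL l \<noteq> {}" using U(2,3) unfolding good_def by blast
    then show "\<exists>U. zariski_open l l U \<and> U \<inter> GL l \<noteq> {} \<and> (\<forall>g\<in>U \<inter> GL l. LT_ideal l (GL_act l g ` I) = supp E)"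
      using U(1,3) LT by blast
    fix J assume "\<exists>U. zariski_open l l U \<and> U \<inter> GL l \<noteq> {} \<and> (\<forall>g\<in>U \<inter> GL l. LT_ideal l (GL_act l g ` I) = J)"
    then obtain U' A where U': "zariski_open l l U'" "A \<in> U'" "\<forall>g\<in>U' \<inter> GL l. LT_ideal l (GL_act l g ` I) = J" by blast
    obtain A' where "A' \<in> U" using U(2) by blast
    \<comment> \<open>Any other open set with a constant leading term ideal shares an invertible
      matrix with \<open>U\<close>.\<close>
    obtain p where "mat l l p \<in> U'" "mat l l p \<in> U" "mat l l p \<in> GL l"
      using generic_ex[OF generic_conj[OF zariski_open_generic[OF U'(1,2)]
        generic_conj[OF zariski_open_generic[OF U(1) \<open>A' \<in> U\<close>] generic_GL]]] by blast
    then show "J = supp E" using U'(3) LT[OF U(3)] by blast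
  qed
  have dims: "mp.dim (lsum (V d g) (supp B)) = card (E \<inter> mon l d \<union> B)" if "good d g" "lower (mon l d) B" for d g B
    using dim_lsum_lower[OF finite_mon sV that(2)] Ed[OF that(1)] by simp
  show ?thesis
  proof (rule that[OF Emon Emult rgin])
    fix d B assume B: "lower (mon l d) B"
    obtain g where g: "good d g" using ex by blast
    show "\<exists>g\<in>GL l. mp.dim (lsum (GL_act l g ` (I \<inter> homog_part l d)) (supp B)) = card (E \<inter> mon l d \<union> B)"
      using dims[OF g B] g unfolding good_def V_def by blast
    fix h :: "'k mat" assume h: "h \<in> carrier_mat l l"
    have "B \<in> Pow (mon l d)" using B unfolding lower_def by blast
    then show "mp.dim (lsum (GL_act l h ` (I \<inter> homog_part l d)) (supp B)) \<le> card (E \<inter> mon l d \<union> B)"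
      using dims[OF g B] g h unfolding good_def V_def by metis
  qed
qed


section \<open>Generic linear forms\<close>

text \<open>Writes the graded piece as a span of products with monomials, a family that is finite
  apart from \<open>I\<close> and varies polynomially when the \<open>v t\<close> do. Generators
  with \<open>e t > d\<close> are excluded explicitly, as \<open>d - e t\<close> would truncate to
  0.\<close>

lemma add_gens_homog_span:
  fixes I :: "(nat, 'k::field) mpoly set"
  assumes I: "homog_ideal l I" and T: "finite T" and v: "\<And>t. t \<in> T \<Longrightarrow> v t \<in> homog_part l (e t)"
  shows "add_gens l I (v ` T) \<inter> homog_part l d =
    mp.span ((I \<inter> homog_part l d) \<union> (\<lambda>(t, m). v t * xmon m) ` (SIGMA t:{t\<in>T. e t \<le> d}. mon l (d - e t)))"
  using T v
proof (induction T rule: finite_induct)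
  case empty
  then show ?case
    using add_gens_empty[OF homog_ideal_ideal[OF I]] subspace_ideal_part[OF homog_ideal_ideal[OF I]]
    by (simp add: mp.span_eq_iff[THEN iffD2])
next
  case (insert t T)
  let ?X = "\<lambda>T. (\<lambda>(t, m). v t * xmon m) ` (SIGMA t:{t\<in>T. e t \<le> d}. mon l (d - e t))"
  have vT: "v ` T \<subseteq> (\<Union>d. homog_part l d)" and vt: "v t \<in> homog_part l (e t)" using insert.prems by auto
  have c: "v ` T \<subseteq> polys l" "{v t} \<subseteq> polys l" using vT vt homog_carrier by blast+
  have "add_gens l I (v ` insert t T) = add_gens l (add_gens l I (v ` T)) {v t}"
    using add_gens_Un[OF homog_ideal_ideal[OF I] c] by simp
  note eq = add_gens_homog_part[OF homog_ideal_add_gens[OF I vT] vt, of d, folded this]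
  have IH: "add_gens l I (v ` T) \<inter> homog_part l d = mp.span ((I \<inter> homog_part l d) \<union> ?X T)"
    by (rule insert.IH) (use insert.prems in blast)
  show ?case
  proof (cases "e t \<le> d")
    case True
    have X: "?X (insert t T) = (\<lambda>m. v t * xmon m) ` mon l (d - e t) \<union> ?X T" using True by force
    interpret m: Vector_Spaces.linear "\<lambda>(c::'k) f. Const c * f" "\<lambda>c f. Const c * f" "(*) (v t)" by (rule linear_times)
    have "(\<lambda>m. v t * xmon m) ` mon l (d - e t) = (*) (v t) ` xmon ` mon l (d - e t)" by (simp add: image_image)
    then have sp: "mp.span ((\<lambda>m. v t * xmon m) ` mon l (d - e t)) = (*) (v t) ` homog_part l (d - e t)"
      by (simp only: m.span_image span_xmon_eq homog_part_eq)
    have "add_gens l I (v ` insert t T) \<inter> homog_part l d =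
      {x + y |x y. x \<in> (*) (v t) ` homog_part l (d - e t) \<and> y \<in> mp.span ((I \<inter> homog_part l d) \<union> ?X T)}"
      unfolding eq IH using True by auto
    also have "\<dots> = mp.span ((\<lambda>m. v t * xmon m) ` mon l (d - e t) \<union> ((I \<inter> homog_part l d) \<union> ?X T))"
      by (simp only: mp.span_Un[of "(\<lambda>m. v t * xmon m) ` mon l (d - e t)" "(I \<inter> homog_part l d) \<union> ?X T"] sp)
    finally show ?thesis unfolding X by (simp only: Un_ac)
  next
    case False
    then have "?X (insert t T) = ?X T" by auto
    then show ?thesis unfolding eq using False IH by simp
  qed
qed

text \<open>The graded piece has generically maximal dimension, being a rank, so its codimension is
  generically minimal.\<close>

lemma generic_min_HF:
  fixes I :: "(nat, 'k::field_char_0) mpoly set"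
  assumes I: "homog_ideal l I" and T: "finite T"
    and v: "\<And>t p. t \<in> T \<Longrightarrow> v t p \<in> homog_part l (e t)" and pv: "\<And>t. t \<in> T \<Longrightarrow> polyvec X (v t)"
  shows "generic X (\<lambda>p. \<forall>q. HF l (add_gens l I ((\<lambda>t. v t p) ` T)) d \<le> HF l (add_gens l I ((\<lambda>t. v t q) ` T)) d)"
proof -
  note I' = homog_ideal_ideal[OF I]
  obtain A where A: "finite A" "A \<subseteq> I \<inter> homog_part l d" "mp.span A = I \<inter> homog_part l d"
    using mp.fdim_basis_subspace[OF subspace_ideal_part[OF I'] fdim_ideal_part] by metis
  define \<Sigma> where "\<Sigma> = (SIGMA t:{t\<in>T. e t \<le> d}. mon l (d - e t))"
  define w where "w = case_sum (\<lambda>f p. f) (\<lambda>(t, m) p. v t p * xmon m)"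
  have fin: "finite (A <+> \<Sigma>)" using A(1) T finite_mon unfolding \<Sigma>_def by auto
  have sp: "mp.span ((\<lambda>i. w i p) ` (A <+> \<Sigma>)) = add_gens l I ((\<lambda>t. v t p) ` T) \<inter> homog_part l d" for p
  proof -
    have im: "(\<lambda>i. w i p) ` (A <+> \<Sigma>) = A \<union> (\<lambda>(t, m). v t p * xmon m) ` \<Sigma>"
      unfolding w_def Plus_def by (auto simp: image_Un image_image split_def)
    have "mp.span (A \<union> Y) = mp.span (I \<inter> homog_part l d \<union> Y)" for Y
      by (subst (1 2) mp.span_Un) (simp add: A(3)[symmetric] mp.span_span)
    then show ?thesis
      using add_gens_homog_span[OF I T v, of "\<lambda>t. t" "\<lambda>_. p" d] unfolding im unfolding \<Sigma>_def by simp
  qed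
  have HF: "HF l (add_gens l I ((\<lambda>t. v t p) ` T)) d + mp.dim (mp.span ((\<lambda>i. w i p) ` (A <+> \<Sigma>))) = card (mon l d)" for p
    unfolding sp by (rule HF_dim[OF ideal_add_gens[OF I']]) (use v homog_carrier in blast)
  have "generic X (\<lambda>p. \<forall>q. mp.dim (mp.span ((\<lambda>i. w i q) ` (A <+> \<Sigma>))) \<le> mp.dim (mp.span ((\<lambda>i. w i p) ` (A <+> \<Sigma>))))"
  proof (rule generic_max_dim[OF fin])
    fix i assume "i \<in> A <+> \<Sigma>"
    then show "polyvec X (w i)" unfolding w_def \<Sigma>_def using pv by auto
  qed
  then show ?thesis
  proof (rule generic_mono[OF _ order_refl], intro allI)
    fix p q assume "\<forall>q. mp.dim (mp.span ((\<lambda>i. w i q) ` (A <+> \<Sigma>))) \<le> mp.dim (mp.span ((\<lambda>i. w i p) ` (A <+> \<Sigma>)))"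
    from spec[OF this, of q] show "HF l (add_gens l I ((\<lambda>t. v t p) ` T)) d \<le> HF l (add_gens l I ((\<lambda>t. v t q) ` T)) d"
      using HF[of p] HF[of q] by linarith
  qed
qed

section \<open>Linear forms given by the rows of a parameter matrix\<close>

definition rowf :: "nat \<Rightarrow> (nat \<times> nat \<Rightarrow> 'k) \<Rightarrow> nat \<Rightarrow> (nat, 'k::comm_ring_1) mpoly" where
  "rowf l p a = linear_form l (vec l (\<lambda>b. p (a, b)))"

lemma rowf_homog: "rowf l p a \<in> homog_part l 1"
  unfolding rowf_def by (rule linear_form_homog)

lemma polyvec_rowf: "(\<And>b. b < l \<Longrightarrow> (a, b) \<in> X) \<Longrightarrow> polyvec X (\<lambda>p. rowf l p a)"
  unfolding rowf_def linear_form_def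
  by (intro polyvec_sum polyvec_mult polyvec_const polyvec_Const) simp

text \<open>Makes arbitrary forms of degree 1 a point of the parameter space, so that generic values
  can be compared with theirs.\<close>

lemma homog_part_1_linear_form:
  assumes f: "f \<in> homog_part l 1"
  shows "f = linear_form l (vec l (\<lambda>b. lookup f (Poly_Mapping.single (Suc b) 1)))"
proof (rule poly_mapping_eqI)
  fix m
  have L: "lookup (linear_form l v) m =
    (\<Sum>b<l. if m = Poly_Mapping.single (Suc b) 1 then v $ b else 0)" for v :: "'a vec"
    unfolding linear_form_def lookup_sum lookup_Const_times Var_def
    by (rule sum.cong) (auto simp: lookup_single when_def)
  show "lookup f m =
    lookup (linear_form l (vec l (\<lambda>b. lookup f (Poly_Mapping.single (Suc b) 1)))) m"
  proof (cases "\<exists>b<l. m = Poly_Mapping.single (Suc b) 1")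
    case True
    then obtain b where b: "b < l" "m = Poly_Mapping.single (Suc b) 1" by blast
    have "(\<Sum>c<l. if m = Poly_Mapping.single (Suc c) 1 then x c else 0) = (\<Sum>c<l. if c = b then x b else 0)" for x :: "nat \<Rightarrow> 'a"
    proof (rule sum.cong[OF refl])
      fix c
      have "Poly_Mapping.single (Suc b) (1::nat) = Poly_Mapping.single (Suc c) 1 \<longleftrightarrow> c = b"
        by (metis keys_single nat.inject singleton_inject zero_neq_one)
      then show "(if m = Poly_Mapping.single (Suc c) 1 then x c else 0) = (if c = b then x b else 0)"
        unfolding b(2) by simp
    qed
    then show ?thesis unfolding L using b by simp
  next
    case False
    \<comment> \<open>A monomial of degree 1 is a variable: some exponent is nonzero, hence 1, and
      the others sum to 0.\<close>
    have "m \<notin> mon l 1"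
    proof
      assume m: "m \<in> mon l 1"
      then have "m \<noteq> 0" by (auto simp: mon_def)
      then obtain i where i: "i \<in> keys m" by (metis all_not_in_conv keys_eq_empty)
      have "mdeg m = lookup m i + (\<Sum>j\<in>keys m - {i}. lookup m j)"
        unfolding mdeg_def using i by (simp add: sum.remove)
      then have *: "lookup m i = 1" "(\<Sum>j\<in>keys m - {i}. lookup m j) = 0"
      proof -
        have 1: "mdeg m = 1" "lookup m i \<noteq> 0" using m i by (simp_all add: mon_def in_keys_iff)
        show "lookup m i = 1" "(\<Sum>j\<in>keys m - {i}. lookup m j) = 0"
          using 1 \<open>mdeg m = lookup m i + _\<close> by linarith+
      qed
      have "\<forall>b\<in>keys m - {i}. lookup m b = 0" using *(2) by simp
      then have "lookup m a = 0" if "a \<noteq> i" for a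
        using that by (metis DiffI empty_iff insert_iff in_keys_iff)
      then have "m = Poly_Mapping.single i 1"
        using *(1) by (intro poly_mapping_eqI) (auto simp: lookup_single when_def)
      moreover have "i \<in> {1..l}" using m i unfolding mon_def mons_def by blast
      then have "i = Suc (i - 1)" "i - 1 < l" by auto
      ultimately show False using False by metis
    qed
    then have "lookup f m = 0" using f unfolding homog_part_eq supp_iff by blast
    moreover have "(\<Sum>b<l. if m = Poly_Mapping.single (Suc b) 1 then x b else 0) = 0" for x :: "nat \<Rightarrow> 'a"
      by (rule sum.neutral) (use False in auto)
    ultimately show ?thesis unfolding L by simp
  qed
qed

section \<open>Hilbert functions after adding one form, and the sectional matrix\<close>

lemma HF_add_gens_low:
  assumes J: "homog_ideal l (J :: (nat, 'k::field) mpoly set)" and g: "g \<in> homog_part l s" and d: "d < s"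
  shows "HF l (add_gens l J {g}) d = HF l J d"
proof -
  have gc: "{g} \<subseteq> polys l" using g homog_carrier by blast
  have "add_gens l J {g} \<inter> homog_part l d = J \<inter> homog_part l d"
    using add_gens_homog_part[OF J g, of d] d by simp
  then show ?thesis
    using HF_dim[OF ideal_add_gens[OF homog_ideal_ideal[OF J] gc], of d] HF_dim[OF homog_ideal_ideal[OF J], of d] by simp
qed

lemma HF_add_gens:
  assumes J: "homog_ideal l (J :: (nat, 'k::field) mpoly set)" and g: "g \<in> homog_part l s"
  shows "HF l (add_gens l J {g}) (i + s) + HF l J i + mp.dim (J \<inter> homog_part l i) =
    HF l J (i + s) + mp.dim {f \<in> homog_part l i. g * f \<in> J}"
    and "mp.dim (J \<inter> homog_part l i) \<le> mp.dim {f \<in> homog_part l i. g * f \<in> J}"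
    and "mp.dim {f \<in> homog_part l i. g * f \<in> J} = mp.dim (J \<inter> homog_part l i) \<longleftrightarrow>
      (\<forall>f \<in> homog_part l i. g * f \<in> J \<longrightarrow> f \<in> J)"
    and "HF l (add_gens l J {g}) (i + s) = 0 \<longleftrightarrow> homog_part l (i + s) \<subseteq> add_gens l J {g}"
proof -
  note J' = homog_ideal_ideal[OF J]
  have gc: "g \<in> polys l" using g homog_carrier by blast
  have A: "ideal (add_gens l J {g}) (poly_ring l)" by (rule ideal_add_gens[OF J']) (use gc in simp)
  let ?N = "{f \<in> homog_part l i. g * f \<in> J}"
  have N: "?N = {f \<in> homog_part l i. g * f \<in> J \<inter> homog_part l (i + s)}"
    using homog_mult[OF g] by (auto simp: add.commute)
  have "add_gens l J {g} \<inter> homog_part l (i + s) =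
    {g * a + b |a b. a \<in> homog_part l i \<and> b \<in> J \<inter> homog_part l (i + s)}"
    using add_gens_homog_part[OF J g, of "i + s"] by simp
  then have "mp.dim (add_gens l J {g} \<inter> homog_part l (i + s)) + mp.dim ?N =
    card (mon l i) + mp.dim (J \<inter> homog_part l (i + s))"
    using mp.dim_image_sum_preimage[OF linear_times[of g] subspace_homog[of l i] fdim_homog
      subspace_ideal_part[OF J', of "i + s"] fdim_ideal_part]
    unfolding N by (simp add: homog_part_eq dim_supp)
  then show "HF l (add_gens l J {g}) (i + s) + HF l J i + mp.dim (J \<inter> homog_part l i) =
    HF l J (i + s) + mp.dim ?N"
    using HF_dim[OF A, of "i + s"] HF_dim[OF J', of i] HF_dim[OF J', of "i + s"] by linarith
  interpret T: Vector_Spaces.linear "\<lambda>(c::'k) f. Const c * f" "\<lambda>c f. Const c * f" "(*) g" by (rule linear_times)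
  have sN: "mp.subspace ?N"
    using mp.subspace_inter[OF subspace_homog T.subspace_linear_preimage[OF ideal_poly_ring_subspace[OF J']]]
    by (simp add: Int_def)
  have fN: "mp.fdim ?N" by (rule mp.fdim_subset[OF fdim_homog]) blast
  have sub: "J \<inter> homog_part l i \<subseteq> ?N" using J' gc unfolding ideal_poly_ring_iff by auto
  show "mp.dim (J \<inter> homog_part l i) \<le> mp.dim ?N"
    using mp.dim_mono_fdim[OF fN] sub mp.span_superset by blast
  show "mp.dim ?N = mp.dim (J \<inter> homog_part l i) \<longleftrightarrow> (\<forall>f \<in> homog_part l i. g * f \<in> J \<longrightarrow> f \<in> J)"
  proof
    assume "mp.dim ?N = mp.dim (J \<inter> homog_part l i)"
    then have "J \<inter> homog_part l i = ?N"
      using mp.subspace_eq_of_dim[OF subspace_ideal_part[OF J'] sN sub fN] by simp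
    then show "\<forall>f \<in> homog_part l i. g * f \<in> J \<longrightarrow> f \<in> J" by blast
  next
    assume "\<forall>f \<in> homog_part l i. g * f \<in> J \<longrightarrow> f \<in> J"
    then have "?N = J \<inter> homog_part l i" using sub by blast
    then show "mp.dim ?N = mp.dim (J \<inter> homog_part l i)" by simp
  qed
  have dS: "mp.dim (homog_part l (i + s) :: (nat, 'k) mpoly set) = card (mon l (i + s))"
    unfolding homog_part_eq by (rule dim_supp)
  show "HF l (add_gens l J {g}) (i + s) = 0 \<longleftrightarrow> homog_part l (i + s) \<subseteq> add_gens l J {g}"
  proof
    assume "HF l (add_gens l J {g}) (i + s) = 0"
    then have "mp.dim (add_gens l J {g} \<inter> homog_part l (i + s)) = card (mon l (i + s))"
      using HF_dim[OF A, of "i + s"] by simp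
    then have "add_gens l J {g} \<inter> homog_part l (i + s) = homog_part l (i + s)"
      by (intro mp.subspace_eq_of_dim[OF subspace_ideal_part[OF A] subspace_homog Int_lower2 fdim_homog])
        (simp add: dS)
    then show "homog_part l (i + s) \<subseteq> add_gens l J {g}" by blast
  next
    assume "homog_part l (i + s) \<subseteq> add_gens l J {g}"
    then have "add_gens l J {g} \<inter> homog_part l (i + s) = homog_part l (i + s)" by blast
    then show "HF l (add_gens l J {g}) (i + s) = 0" using HF_dim[OF A, of "i + s"] dS by simp
  qed
qed

lemma HF_add_gens_ge:
  assumes J: "homog_ideal l (J :: (nat, 'k::field) mpoly set)" and g: "g \<in> homog_part l s"
  shows "HF l J d - (if d < s then 0 else HF l J (d - s)) \<le> HF l (add_gens l J {g}) d"
proof (cases "d < s")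
  case True
  then show ?thesis using HF_add_gens_low[OF J g] by simp
next
  case False
  then show ?thesis using HF_add_gens(1,2)[OF J g, of "d - s"] by simp
qed

text \<open>The minimum over all coefficient matrices is taken on an open set, and any other generic
  value would have to agree with it at a common point. So the \<open>THE\<close> denotes the
  minimum, which bounds the value for arbitrary forms.\<close>

lemma sectional_matrix_generic:
  fixes I :: "(nat, 'k::field_char_0) mpoly set"
  assumes I: "homog_ideal l I" and j: "j \<le> l"
  shows "generic ({..<j} \<times> {..<l}) (\<lambda>p. HF l (add_gens l I (rowf l p ` {..<j})) d = sectional_matrix l I (l - j) d)"
    and "sectional_matrix l I (l - j) d \<le> HF l (add_gens l I (rowf l q ` {..<j})) d"
proof -
  let ?X = "{..<j} \<times> {..<l}"
  let ?H = "\<lambda>p. HF l (add_gens l I (rowf l p ` {..<j})) d"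
  let ?HA = "\<lambda>A. HF l (add_gens l I {linear_form l (row A a) |a. a < j}) d"
  have HA: "?HA (mat j l p) = ?H p" for p
  proof -
    have "row (mat j l p) a = vec l (\<lambda>b. p (a, b))" if "a < j" for a using that by (intro eq_vecI) auto
    then have "(\<lambda>a. linear_form l (row (mat j l p) a)) ` {..<j} = rowf l p ` {..<j}"
      unfolding rowf_def by (intro image_cong) auto
    moreover have "{linear_form l (row (mat j l p) a) |a. a < j} = (\<lambda>a. linear_form l (row (mat j l p) a)) ` {..<j}"
      unfolding lessThan_def by (rule setcompr_eq_image)
    ultimately show ?thesis by simp
  qed
  have gen: "generic ?X (\<lambda>p. \<forall>q. ?H p \<le> ?H q)"
    by (rule generic_min_HF[OF I, of _ _ "\<lambda>_. 1"]) (auto intro: polyvec_rowf rowf_homog[unfolded One_nat_def])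
  then obtain p0 where p0: "\<And>q. ?H p0 \<le> ?H q" using generic_ex by blast
  have gen': "generic ?X (\<lambda>p. ?H p = ?H p0)"
    by (rule generic_mono[OF gen order_refl]) (use p0 in \<open>auto intro: order_antisym\<close>)
  define Q where "Q = (\<lambda>A. ?HA A = ?H p0)"
  have "generic ?X (\<lambda>p. Q (mat j l p))" unfolding Q_def HA by (rule gen')
  from generic_zariski_open[OF this] obtain U where "zariski_open j l U" "U \<noteq> {}" "\<And>A. A \<in> U \<Longrightarrow> Q A"
    by metis
  note U = this[unfolded Q_def]
  have "sectional_matrix l I (l - j) d = ?H p0"
    unfolding sectional_matrix_def diff_diff_cancel[OF j]
  proof (rule the_equality)
    show "\<exists>U. zariski_open j l U \<and> U \<noteq> {} \<and> (\<forall>A\<in>U. ?HA A = ?H p0)" using U by blast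
    fix n assume "\<exists>U. zariski_open j l U \<and> U \<noteq> {} \<and> (\<forall>A\<in>U. ?HA A = n)"
    then obtain U' A where U': "zariski_open j l U'" "A \<in> U'" "\<forall>A\<in>U'. ?HA A = n" by blast
    obtain p where "mat j l p \<in> U'" "?H p = ?H p0"
      using generic_ex[OF generic_conj[OF zariski_open_generic[OF U'(1,2)] gen']] by blast
    then have "?HA (mat j l p) = n" using U'(3) by blast
    then show "n = ?H p0" unfolding HA using \<open>?H p = ?H p0\<close> by simp
  qed
  then show "generic ?X (\<lambda>p. ?H p = sectional_matrix l I (l - j) d)" "sectional_matrix l I (l - j) d \<le> ?H q"
    using gen' p0 by simp_all
qed

text \<open>The monomials of the ideal generated by \<open>last_vars\<close>, that is, those
  divisible by one of its generators.\<close>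

definition last_mons :: "nat \<Rightarrow> nat \<Rightarrow> nat \<Rightarrow> nat monomial set" where
  "last_mons l j s = {m \<in> mons l. (\<exists>i\<in>{l - j + 1..l}. lookup m i > 0) \<or> s \<le> lookup m (l - j)}"

definition last_vars :: "nat \<Rightarrow> nat \<Rightarrow> nat \<Rightarrow> (nat, 'k::comm_ring_1) mpoly set" where
  "last_vars l j s = Var ` {l - j + 1..l} \<union> {Var (l - j) ^ s}"

lemma last_mons_mons: "last_mons l j s \<subseteq> mons l"
  unfolding last_mons_def by blast

lemma last_mons_mult: "m \<in> last_mons l j s \<Longrightarrow> n \<in> mons l \<Longrightarrow> m + n \<in> last_mons l j s"
  unfolding last_mons_def by (force simp: mons_add lookup_add)

lemma last_vars_homog:
  assumes "j < l" shows "last_vars l j s \<subseteq> (\<Union>d. homog_part l d)"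
proof -
  have "Var (l - j) ^ s \<in> homog_part l (s * 1)" by (rule homog_power[OF Var_homog]) (use assms in auto)
  moreover have "Var i \<in> homog_part l 1" if "i \<in> {l - j + 1..l}" for i
    by (rule Var_homog) (use that in auto)
  ultimately show ?thesis unfolding last_vars_def by blast
qed

lemma last_vars_carrier: "j < l \<Longrightarrow> last_vars l j s \<subseteq> polys l"
  using last_vars_homog[of j l s] homog_carrier by blast

lemma Idl_last_vars:
  assumes j: "j < l"
  shows "gen_ideal l (last_vars l j s) = (supp (last_mons l j s) :: (nat, 'k::field) mpoly set)"
proof -
  interpret R: ring "poly_ring l :: (nat, 'k) mpoly ring" by (rule ring_poly_ring)
  have mi: "ideal (supp (last_mons l j s) :: (nat, 'k) mpoly set) (poly_ring l)"
    "gen_ideal l (xmon ` last_mons l j s) = (supp (last_mons l j s) :: (nat, 'k) mpoly set)"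
    by (rule Idl_xmon[OF last_mons_mons], erule (1) last_mons_mult)+
  let ?K = "gen_ideal l (last_vars l j s) :: (nat, 'k) mpoly set"
  have K: "ideal ?K (poly_ring l)" by (rule R.genideal_ideal[OF last_vars_carrier[OF j]])
  have gens: "last_vars l j s \<subseteq> ?K" by (rule R.genideal_self[OF last_vars_carrier[OF j]])
  \<comment> \<open>A monomial divisible by a generator is a multiple of it; the cofactor has the
    truncated difference of the exponents.\<close>
  have div: "xmon m \<in> ?K" if m: "m \<in> mons l" and i: "a \<le> lookup m i" and V: "(Var i ^ a :: (nat, 'k) mpoly) \<in> last_vars l j s" for m i a
  proof -
    let ?r = "m - Poly_Mapping.single i a"
    have m': "m = ?r + Poly_Mapping.single i a"
      by (rule poly_mapping_eqI) (use i in \<open>auto simp: lookup_add lookup_minus lookup_single when_def\<close>)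
    have "keys ?r \<subseteq> keys m" by (auto simp: in_keys_iff lookup_minus)
    then have "(xmon ?r :: (nat, 'k) mpoly) \<in> polys l" using m unfolding carrier_poly_ring mons_def by auto
    then have "xmon ?r * Var i ^ a \<in> ?K" by (rule ideal_mult[OF K _ subsetD[OF gens V]])
    moreover have "xmon ?r * Var i ^ a = (xmon m :: (nat, 'k) mpoly)" unfolding Var_power by (simp add: mult_single m'[symmetric])
    ultimately show ?thesis by simp
  qed
  show ?thesis
  proof
    show "?K \<subseteq> supp (last_mons l j s)"
    proof (rule R.genideal_minimal[OF mi(1)])
      show "last_vars l j s \<subseteq> (supp (last_mons l j s) :: (nat, 'k) mpoly set)"
      proof
        fix x :: "(nat, 'k) mpoly" assume "x \<in> last_vars l j s"
        then consider i where "i \<in> {l - j + 1..l}" "x = Var i ^ 1" | "x = Var (l - j) ^ s"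
          unfolding last_vars_def by auto
        then show "x \<in> supp (last_mons l j s)"
        proof cases
          case 1
          moreover have "0 < lookup (Poly_Mapping.single i (1::nat)) i" by simp
          ultimately have "Poly_Mapping.single i 1 \<in> last_mons l j s"
            unfolding last_mons_def mons_def using 1(1) by (auto intro: bexI[of _ i] simp del: lookup_single_eq)
          then show ?thesis unfolding 1(2) Var_power by (rule single_in_supp)
        next
          case 2
          then show ?thesis unfolding 2 Var_power using j by (intro single_in_supp) (auto simp: last_mons_def mons_def)
        qed
      qed
    qed
    have sub: "xmon ` last_mons l j s \<subseteq> ?K"
    proof
      fix x :: "(nat, 'k) mpoly" assume "x \<in> xmon ` last_mons l j s"
      then obtain m where m: "m \<in> last_mons l j s" "x = xmon m" by blast
      then consider i where "i \<in> {l - j + 1..l}" "1 \<le> lookup m i" | "s \<le> lookup m (l - j)"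
        unfolding last_mons_def by force
      then show "x \<in> ?K"
      proof cases
        case 1
        then show ?thesis unfolding m(2) using m(1) last_mons_mons by (intro div[of m 1 i]) (auto simp: last_vars_def)
      next
        case 2
        then show ?thesis unfolding m(2) using m(1) last_mons_mons by (intro div[of m s "l - j"]) (auto simp: last_vars_def)
      qed
    qed
    show "supp (last_mons l j s) \<subseteq> ?K"
      unfolding mi(2)[symmetric] by (rule R.genideal_minimal[OF K sub])
  qed
qed

lemma add_gens_last_vars:
  assumes "j < l" "ideal J (poly_ring l)"
  shows "add_gens l J (last_vars l j s) = lsum J (supp (last_mons l j s) :: (nat, 'k::field) mpoly set)"
  using add_gens_eq[OF assms(2) last_vars_carrier[OF assms(1)]] unfolding Idl_last_vars[OF assms(1)] lsum_def .

lemma lsum_homog_part: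
  assumes J: "homog_ideal l J" and X: "X \<subseteq> mons l"
  shows "lsum J (supp X) \<inter> homog_part l d = lsum (J \<inter> homog_part l d) (supp (X \<inter> mon l d) :: (nat, 'k::field) mpoly set)"
proof
  have Jc: "J \<subseteq> polys l" by (rule ideal_carrier[OF homog_ideal_ideal[OF J]])
  show "lsum J (supp X) \<inter> homog_part l d \<subseteq> lsum (J \<inter> homog_part l d) (supp (X \<inter> mon l d))"
  proof
    fix f assume f: "f \<in> lsum J (supp X) \<inter> homog_part l d"
    then obtain a b where ab: "f = a + b" "a \<in> J" "b \<in> supp X" unfolding lsum_def by blast
    have "f = hc d f" using hc_of_homog[of f l d d] f by auto
    then have "f = hc d a + hc d b" using ab(1) hc_add by metis
    moreover have "hc d a \<in> J \<inter> homog_part l d" using J ab(2) hc_homog Jc unfolding homog_ideal_def by blast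
    moreover have "hc d b \<in> supp (X \<inter> mon l d)"
      using hc_supp[OF ab(3), of d] X supp_mono[of "{m \<in> X. mdeg m = d}" "X \<inter> mon l d"] by (auto simp: mon_def)
    ultimately show "f \<in> lsum (J \<inter> homog_part l d) (supp (X \<inter> mon l d))" unfolding lsum_def by blast
  qed
  have "supp (X \<inter> mon l d) \<subseteq> (supp X :: (nat, 'k) mpoly set)" "supp (X \<inter> mon l d) \<subseteq> (homog_part l d :: (nat, 'k) mpoly set)"
    unfolding homog_part_eq by (auto intro: supp_mono[THEN subsetD])
  then show "lsum (J \<inter> homog_part l d) (supp (X \<inter> mon l d)) \<subseteq> lsum J (supp X) \<inter> homog_part l d"
    unfolding lsum_def using mp.subspace_add[OF subspace_homog] by blast
qed

text \<open>This is where the reverse lexicographic order enters: monomials involving the last variables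
  are smaller than all the others of the same degree.\<close>

lemma lower_last_mons:
  assumes j: "j < l" shows "lower (mon l d) (last_mons l j s \<inter> mon l d)"
  unfolding lower_def
proof (intro conjI ballI)
  fix b n assume b: "b \<in> last_mons l j s \<inter> mon l d" and n: "n \<in> mon l d - last_mons l j s \<inter> mon l d"
  have n0: "lookup n i = 0" if "l - j < i" for i
  proof (cases "i \<le> l")
    case True
    then show ?thesis using n that by (auto simp: last_mons_def mon_def)
  next
    case False
    then have "i \<notin> keys n" using n by (auto simp: mon_def mons_def)
    then show ?thesis by (simp add: in_keys_iff)
  qed
  have ns: "lookup n (l - j) < s" using n by (auto simp: last_mons_def mon_def)
  let ?P = "\<lambda>i. l - j < i \<and> lookup b i > 0"
  have "\<exists>i. lookup b i > lookup n i \<and>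
    (\<forall>k>i. lookup b k = lookup n k)"
  proof (cases "\<exists>i. ?P i")
    case True
    have "i \<le> l" if "?P i" for i
    proof -
      have "i \<in> keys b" using that by (simp add: in_keys_iff)
      then show ?thesis using b by (auto simp: mon_def mons_def)
    qed
    \<comment> \<open>The last variable of \<open>b\<close> beyond \<open>l - j\<close>. There
      \<open>n\<close> has exponent 0, and after it both exponents vanish, so this position
      decides.\<close>
    then obtain i where i: "?P i" "\<And>k. ?P k \<Longrightarrow> k \<le> i"
      using True Greatest_le_nat[of ?P _ l] GreatestI_ex_nat[of ?P l] by blast
    have "lookup b k = lookup n k" if "k > i" for k
      using i(2)[of k] i(1) n0[of k] that by auto
    moreover have "lookup n i < lookup b i" using i(1) n0[of i] by simp
    ultimately show ?thesis by blast
  next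
    case False
    then have "s \<le> lookup b (l - j)" using b by (force simp: last_mons_def)
    \<comment> \<open>Beyond \<open>l - j\<close> both exponents vanish; at \<open>l - j\<close> the
      exponent of \<open>b\<close> is at least \<open>s\<close> and that of \<open>n\<close> is
      smaller.\<close>
    then show ?thesis using False n0 ns by (intro exI[of _ "l - j"]) auto
  qed
  then show "b \<prec> n" using b n unfolding degrevlex_less_def mon_def by auto
qed auto

lemma GL_act_add_gens:
  fixes I :: "(nat, 'k::field) mpoly set"
  assumes g: "g \<in> GL l" and I: "ideal I (poly_ring l)" and G: "G \<subseteq> polys l"
  shows "GL_act l g ` add_gens l I G = add_gens l (GL_act l g ` I) (GL_act l g ` G)"
proof
  obtain w where w: "w \<in> GL l" "g * w = 1\<^sub>m l" "w * g = 1\<^sub>m l" "g \<in> carrier_mat l l" "w \<in> carrier_mat l l"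
    using GL_inverse[OF g] by metis
  have gw: "GL_act l g (GL_act l w f) = f" "GL_act l w (GL_act l g f) = f" if "f \<in> polys l" for f
    using GL_act_inverse(1)[OF w(4,5,2) that] GL_act_inverse(1)[OF w(5,4,3) that] by simp_all
  have gG: "GL_act l g ` G \<subseteq> polys l" using G GL_act_carrier by blast
  let ?A = "add_gens l I G" and ?B = "add_gens l (GL_act l g ` I) (GL_act l g ` G)"
  note A = ideal_add_gens[OF I G] and gI = ideal_GL_act[OF g I]
  note B = ideal_add_gens[OF gI gG]
  show "?B \<subseteq> GL_act l g ` ?A"
    by (rule add_gens_minimal[OF ideal_GL_act[OF g A]])
      (use subset_add_gens[OF I G] gens_subset_add_gens[OF I G] in blast)+
  have "?A \<subseteq> GL_act l w ` ?B"
  proof (rule add_gens_minimal[OF ideal_GL_act[OF w(1) B]])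
    have Ic: "I \<subseteq> polys l" by (rule ideal_carrier[OF I])
    have pull: "X \<subseteq> GL_act l w ` ?B" if "X \<subseteq> polys l" "GL_act l g ` X \<subseteq> ?B" for X
    proof
      fix x assume x: "x \<in> X"
      then have "x = GL_act l w (GL_act l g x)" "GL_act l g x \<in> ?B" using gw(2)[of x] that by auto
      then show "x \<in> GL_act l w ` ?B" by (rule image_eqI)
    qed
    show "I \<subseteq> GL_act l w ` ?B" by (rule pull[OF Ic subset_add_gens[OF gI gG]])
    show "G \<subseteq> GL_act l w ` ?B" by (rule pull[OF G gens_subset_add_gens[OF gI gG]])
  qed
  moreover have "?B \<subseteq> polys l" by (rule ideal_carrier[OF B])
  ultimately show "GL_act l g ` ?A \<subseteq> ?B" using gw(1) by fastforce
qed

text \<open>Counterpart of \<open>last_vars\<close> for generic forms: row \<open>a\<close>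
  corresponds to the variable with index \<open>l - a\<close>.\<close>

definition row_gens :: "nat \<Rightarrow> nat \<Rightarrow> nat \<Rightarrow> (nat \<times> nat \<Rightarrow> 'k::comm_ring_1) \<Rightarrow> (nat, 'k) mpoly set" where
  "row_gens l j s p = rowf l p ` {..<j} \<union> {rowf l p j ^ s}"

lemma row_gens_homog: "row_gens l j s p \<subseteq> (\<Union>d. homog_part l d)"
proof
  fix f assume "f \<in> row_gens l j s p"
  then consider a where "f = rowf l p a" | "f = rowf l p j ^ s" unfolding row_gens_def by blast
  then show "f \<in> (\<Union>d. homog_part l d)"
  proof cases
    case 1
    show ?thesis unfolding 1 by (rule UN_I[OF UNIV_I], rule rowf_homog)
  next
    case 2
    show ?thesis unfolding 2 by (rule UN_I[OF UNIV_I], rule homog_power[OF rowf_homog])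
  qed
qed

lemma row_gens_carrier: "row_gens l j s p \<subseteq> polys l"
  using row_gens_homog homog_carrier by blast

text \<open>Row \<open>a\<close> of \<open>p\<close> is column \<open>l - 1 - a\<close> of
  \<open>w\<close>, counted from 0, which belongs to the variable \<open>l - a\<close>; the inverse
  \<open>g\<close> sends it there. The reversal makes the first rows correspond to the last
  variables.\<close>

lemma GL_act_row_gens:
  fixes g :: "'k::field mat"
  assumes w: "w \<in> carrier_mat l l" and g: "g \<in> carrier_mat l l" and gw: "g * w = 1\<^sub>m l" and j: "j < l"
    and p: "\<And>a b. a < l \<Longrightarrow> b < l \<Longrightarrow> p (a, b) = w $$ (b, l - 1 - a)"
  shows "GL_act l g ` row_gens l j s p = last_vars l j s"
proof -
  have r: "GL_act l g (rowf l p a) = Var (l - a)" if a: "a \<le> j" for a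
  proof -
    have "vec l (\<lambda>b. p (a, b)) = col w (l - a - 1)"
      by (rule eq_vecI) (use p a j w in auto)
    then show ?thesis unfolding rowf_def
      using GL_act_inverse(2)[OF g w gw zero_carrier, of "l - a"] a j by simp
  qed
  have "(\<lambda>a. l - a) ` {..<j} = {l - j + 1..l}"
  proof
    show "{l - j + 1..l} \<subseteq> (\<lambda>a. l - a) ` {..<j}"
    proof
      fix i assume "i \<in> {l - j + 1..l}"
      then have "i = l - (l - i)" "l - i \<in> {..<j}" using j by auto
      then show "i \<in> (\<lambda>a. l - a) ` {..<j}" by (rule image_eqI)
    qed
  qed (use j in auto)
  moreover have "GL_act l g ` rowf l p ` {..<j} = Var ` (\<lambda>a. l - a) ` {..<j}"
    unfolding image_image by (rule image_cong) (use r in auto)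
  ultimately show ?thesis unfolding row_gens_def last_vars_def by (simp add: image_Un r GL_act_power)
qed

lemma generic_last_rows_GL:
  "generic (sq l) (\<lambda>p. mat l l (\<lambda>(b, c). p (l - 1 - c, b)) \<in> (GL l :: 'k::field_char_0 mat set))"
  unfolding generic_def
proof (intro exI[of _ "\<lambda>p. det (mat l l (\<lambda>(b, c). p (l - 1 - c, b)))"] conjI allI impI)
  show "polyfn (sq l) (\<lambda>p. det (mat l l (\<lambda>(b, c). p (l - 1 - c, b))) :: 'k)" by (rule polyfn_det) auto
  \<comment> \<open>The unit vectors in reverse order as rows are a point with nonzero
    determinant.\<close>
  have "mat l l (\<lambda>(b, c). (\<lambda>(a, b). if l - 1 - a = b then 1 else 0) (l - 1 - c, b)) = (1\<^sub>m l :: 'k mat)"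
    by (rule eq_matI) auto
  then have "det (mat l l (\<lambda>(b, c). (\<lambda>(a, b). if l - 1 - a = b then 1 else 0) (l - 1 - c, b))) \<noteq> (0 :: 'k)"
    by simp
  then show "\<exists>p. det (mat l l (\<lambda>(b, c). p (l - 1 - c, b))) \<noteq> (0 :: 'k)" by blast
qed (rule det_nonzero_GL[OF mat_carrier])

text \<open>With \<open>B\<close> the degree \<open>d\<close> part of \<open>last_mons\<close>,
  \<open>N\<close> is the number of monomials minus the largest dimension of
  \<open>g I_d + supp B\<close>. If the rows are the reversed columns of the inverse of an
  invertible \<open>g\<close>, the Hilbert function for these rows is the same number minus the
  dimension at that \<open>g\<close>. Thus minimal values correspond to maximal dimensions.\<close>

lemma rgin_HF_generic:
  fixes I :: "(nat, 'k::field_char_0) mpoly set" and l j s d :: nat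
  assumes I: "homog_ideal l I" and j: "j < l"
  defines "N \<equiv> HF l (add_gens l (rgin l I) (last_vars l j s)) d"
  shows "N \<le> HF l (add_gens l I (row_gens l j s q)) d"
    and "generic (sq l) (\<lambda>p. HF l (add_gens l I (row_gens l j s p)) d = N)"
proof -
  note I' = homog_ideal_ideal[OF I]
  obtain E where E: "E \<subseteq> mons l" "\<And>m n. m \<in> E \<Longrightarrow> n \<in> mons l \<Longrightarrow> m + n \<in> E" "rgin l I = supp E"
    "\<And>d B g. lower (mon l d) B \<Longrightarrow> g \<in> carrier_mat l l \<Longrightarrow>
      mp.dim (lsum (GL_act l g ` (I \<inter> homog_part l d)) (supp B)) \<le> card (E \<inter> mon l d \<union> B)"
    "\<And>d B. lower (mon l d) B \<Longrightarrow>
      \<exists>g\<in>GL l. mp.dim (lsum (GL_act l g ` (I \<inter> homog_part l d)) (supp B)) = card (E \<inter> mon l d \<union> B)"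
    by (rule rgin_exists[OF I]) blast
  let ?B = "last_mons l j s \<inter> mon l d" and ?H = "\<lambda>p. HF l (add_gens l I (row_gens l j s p)) d"
  have iE: "ideal (supp E :: (nat, 'k) mpoly set) (poly_ring l)" by (rule Idl_xmon(1)[OF E(1,2)])
  have N: "N + card (E \<inter> mon l d \<union> ?B) = card (mon l d)"
  proof -
    have "lsum (supp E) (supp (last_mons l j s)) \<inter> homog_part l d = (supp (E \<inter> mon l d \<union> ?B) :: (nat, 'k) mpoly set)"
    proof -
      have "lsum (supp E) (supp (last_mons l j s)) = (supp (E \<union> last_mons l j s) :: (nat, 'k) mpoly set)"
        unfolding lsum_def span_xmon_eq[symmetric] image_Un mp.span_Un ..
      then show ?thesis by (simp only: homog_part_eq supp_Int Int_Un_distrib2)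
    qed
    then show ?thesis
      using HF_dim[OF ideal_add_gens[OF iE last_vars_carrier[OF j, of s]], of d]
      unfolding N_def E(3) add_gens_last_vars[OF j iE] by (simp add: dim_supp)
  qed
  \<comment> \<open>Applying \<open>g\<close> turns the rows into \<open>last_vars\<close> and
    preserves dimensions.\<close>
  have H: "?H p + mp.dim (lsum (GL_act l g ` (I \<inter> homog_part l d)) (supp ?B)) = card (mon l d)"
    if w: "w \<in> GL l" "g \<in> GL l" "g * w = 1\<^sub>m l" and p: "\<And>a b. a < l \<Longrightarrow> b < l \<Longrightarrow> p (a, b) = w $$ (b, l - 1 - a)" for w g p
  proof -
    have c: "w \<in> carrier_mat l l" "g \<in> carrier_mat l l" using w unfolding GL_def by auto
    note A = ideal_add_gens[OF I' row_gens_carrier] and hA = homog_ideal_add_gens[OF I row_gens_homog]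
    have "GL_act l g ` (add_gens l I (row_gens l j s p) \<inter> homog_part l d) =
      GL_act l g ` add_gens l I (row_gens l j s p) \<inter> homog_part l d"
      by (rule GL_act_ideal_part[OF hA, symmetric])
    also have "\<dots> = lsum (GL_act l g ` I) (supp (last_mons l j s)) \<inter> homog_part l d"
    proof -
      have "GL_act l g ` row_gens l j s p = last_vars l j s" by (rule GL_act_row_gens[OF c w(3) j]) (rule p)
      then show ?thesis unfolding GL_act_add_gens[OF w(2) I' row_gens_carrier]
        by (simp only: add_gens_last_vars[OF j ideal_GL_act[OF w(2) I']])
    qed
    also have "\<dots> = lsum (GL_act l g ` (I \<inter> homog_part l d)) (supp ?B)"
      unfolding lsum_homog_part[OF homog_ideal_GL_act[OF w(2) I] last_mons_mons] GL_act_ideal_part[OF I] ..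
    finally have "mp.dim (lsum (GL_act l g ` (I \<inter> homog_part l d)) (supp ?B)) =
      mp.dim (add_gens l I (row_gens l j s p) \<inter> homog_part l d)"
      using dim_GL_act[OF w(2) subspace_ideal_part[OF A] Int_lower2] by metis
    then show ?thesis using HF_dim[OF A, of j s p d] by simp
  qed
  define v where "v = (\<lambda>t p. if t = j then rowf l p j ^ s else rowf l p t :: (nat, 'k) mpoly)"
  have vg: "(\<lambda>t. v t p) ` {..j} = row_gens l j s p" for p
  proof -
    have "{..j} = insert j {..<j}" by auto
    then show ?thesis unfolding row_gens_def v_def by auto
  qed
  have "generic (sq l) (\<lambda>p. \<forall>q. HF l (add_gens l I ((\<lambda>t. v t p) ` {..j})) d \<le> HF l (add_gens l I ((\<lambda>t. v t q) ` {..j})) d)"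
  proof (rule generic_min_HF[OF I, of _ _ "\<lambda>t. if t = j then s else 1"])
    fix t p assume "t \<in> {..j}"
    show "v t p \<in> homog_part l (if t = j then s else 1)"
      using homog_power[OF rowf_homog, of l p j s] rowf_homog[of l p t] unfolding v_def by simp
  next
    fix t assume "t \<in> {..j}"
    then have "polyvec (sq l) (\<lambda>p. rowf l p t)" by (intro polyvec_rowf) (use j in auto)
    then show "polyvec (sq l) (v t)" unfolding v_def by (cases "t = j") auto
  qed simp
  then have gen: "generic (sq l) (\<lambda>p. \<forall>q. ?H p \<le> ?H q)" unfolding vg .
  \<comment> \<open>The minimum over all \<open>q\<close> is attained at a point with invertible
    matrix, where the upper bound on dimensions applies; this also covers linearly dependent
    rows.\<close>
  have ge: "N \<le> ?H q" for q
  proof -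
    obtain p where p: "mat l l (\<lambda>(b, c). p (l - 1 - c, b)) \<in> GL l" "?H p \<le> ?H q"
      using generic_ex[OF generic_conj[OF generic_last_rows_GL gen]] by blast
    let ?w = "mat l l (\<lambda>(b, c). p (l - 1 - c, b))"
    obtain g where g: "g \<in> GL l" "g * ?w = 1\<^sub>m l" "g \<in> carrier_mat l l"
      using GL_inverse[OF p(1)] by metis
    have "?H p + mp.dim (lsum (GL_act l g ` (I \<inter> homog_part l d)) (supp ?B)) = card (mon l d)"
      by (rule H[OF p(1) g(1,2)]) auto
    then show ?thesis using E(4)[OF lower_last_mons[OF j] g(3), of d s] N p(2) by linarith
  qed
  then show "N \<le> ?H q" .
  \<comment> \<open>One invertible matrix with the largest dimension suffices: at its inverse the
    value is \<open>N\<close>, so the generic minimum is \<open>N\<close>.\<close>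
  obtain g where g: "g \<in> GL l" "mp.dim (lsum (GL_act l g ` (I \<inter> homog_part l d)) (supp ?B)) = card (E \<inter> mon l d \<union> ?B)"
    using E(5)[OF lower_last_mons[OF j]] by blast
  obtain w where w: "w \<in> GL l" "g * w = 1\<^sub>m l" using GL_inverse[OF g(1)] by metis
  have "?H (\<lambda>(a, b). w $$ (b, l - 1 - a)) + mp.dim (lsum (GL_act l g ` (I \<inter> homog_part l d)) (supp ?B)) = card (mon l d)"
    by (rule H[OF w(1) g(1) w(2)]) auto
  then have "?H (\<lambda>(a, b). w $$ (b, l - 1 - a)) = N" using g(2) N by linarith
  then show "generic (sq l) (\<lambda>p. ?H p = N)"
    by (intro generic_mono[OF gen order_refl]) (metis ge order_antisym)
qed


section \<open>Lefschetz properties\<close>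

lemma poly_ring_nat_pow: "f [^]\<^bsub>poly_ring l\<^esub> (n::nat) = (f :: (nat, 'k::comm_ring_1) mpoly) ^ n"
  by (induction n) (simp_all add: nat_pow_def mult.commute)

text \<open>The subtraction is truncated, so the two cases of full rank are covered at once.\<close>

definition SLP_HF :: "nat \<Rightarrow> (nat, 'k::field) mpoly set \<Rightarrow> (nat, 'k) mpoly \<Rightarrow> bool" where
  "SLP_HF l J a \<longleftrightarrow> (\<forall>i s. 1 \<le> s \<longrightarrow> HF l (add_gens l J {a ^ s}) (i + s) = HF l J (i + s) - HF l J i)"

text \<open>Stated for a homomorphism with kernel \<open>J\<close>, since \<open>k_SLP\<close> forms
  quotients of the quotient \<open>S/I\<close>. The graded pieces of the target are images of those
  of the polynomial ring.\<close>

lemma SLP_iff_HF: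
  fixes J :: "(nat, 'k::field) mpoly set"
  assumes J: "homog_ideal l J" and a: "a \<in> homog_part l 1"
    and h: "ring_hom_ring (poly_ring l) R h"
    and ker: "\<And>f g. f \<in> polys l \<Longrightarrow> g \<in> polys l \<Longrightarrow> h f = h g \<longleftrightarrow> f - g \<in> J"
  shows "SLP R (\<lambda>d. h ` homog_part l d) (h a) \<longleftrightarrow> SLP_HF l J a"
proof -
  interpret h: ring_hom_ring "poly_ring l" R h by (rule h)
  note J' = homog_ideal_ideal[OF J]
  have ac: "a \<in> polys l" using a homog_carrier by blast
  have "full_rank (\<lambda>x. h a [^]\<^bsub>R\<^esub> s \<otimes>\<^bsub>R\<^esub> x) (h ` homog_part l i) (h ` homog_part l (i + s)) \<longleftrightarrow>
    HF l (add_gens l J {a ^ s}) (i + s) = HF l J (i + s) - HF l J i" for i s :: nat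
  proof -
    have as: "a ^ s \<in> homog_part l s" using homog_power[OF a, of s] by simp
    have asc: "a ^ s \<in> polys l" using as homog_carrier by blast
    let ?A = "add_gens l J {a ^ s}" and ?S = "homog_part l i :: (nat, 'k) mpoly set"
    have Sc: "x \<in> polys l" if "x \<in> homog_part l d" for x d using that homog_carrier by blast
    have mul: "h a [^]\<^bsub>R\<^esub> s \<otimes>\<^bsub>R\<^esub> h x = h (a ^ s * x)" if "x \<in> polys l" for x
    proof -
      have "h a [^]\<^bsub>R\<^esub> s = h (a ^ s)" using h.hom_nat_pow[OF ac, of s] by (simp add: poly_ring_nat_pow)
      then show ?thesis using h.hom_mult[OF asc that] by simp
    qed
    have inj: "inj_on (\<lambda>x. h a [^]\<^bsub>R\<^esub> s \<otimes>\<^bsub>R\<^esub> x) (h ` ?S) \<longleftrightarrow> (\<forall>f\<in>?S. a ^ s * f \<in> J \<longrightarrow> f \<in> J)"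
    proof
      assume L: "inj_on (\<lambda>x. h a [^]\<^bsub>R\<^esub> s \<otimes>\<^bsub>R\<^esub> x) (h ` ?S)"
      show "\<forall>f\<in>?S. a ^ s * f \<in> J \<longrightarrow> f \<in> J"
      proof (intro ballI impI)
        fix f assume f: "f \<in> ?S" "a ^ s * f \<in> J"
        have z: "0 \<in> ?S" by (simp add: homog_part_eq)
        have "h (a ^ s * f) = h (a ^ s * 0)"
          using ker[OF carrier_mult[OF asc Sc[OF f(1)]] zero_carrier] f by simp
        then have "h a [^]\<^bsub>R\<^esub> s \<otimes>\<^bsub>R\<^esub> h f = h a [^]\<^bsub>R\<^esub> s \<otimes>\<^bsub>R\<^esub> h 0"
          using mul[OF Sc[OF f(1)]] mul[OF Sc[OF z]] by simp
        then have "h f = h 0" using inj_onD[OF L] f(1) z by blast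
        then show "f \<in> J" using ker[OF Sc[OF f(1)] zero_carrier] by simp
      qed
    next
      assume R: "\<forall>f\<in>?S. a ^ s * f \<in> J \<longrightarrow> f \<in> J"
      show "inj_on (\<lambda>x. h a [^]\<^bsub>R\<^esub> s \<otimes>\<^bsub>R\<^esub> x) (h ` ?S)"
      proof (rule inj_onI)
        fix x y assume "x \<in> h ` ?S" "y \<in> h ` ?S" and e: "h a [^]\<^bsub>R\<^esub> s \<otimes>\<^bsub>R\<^esub> x = h a [^]\<^bsub>R\<^esub> s \<otimes>\<^bsub>R\<^esub> y"
        then obtain f g where fg: "f \<in> ?S" "g \<in> ?S" "x = h f" "y = h g" by blast
        have "h (a ^ s * f) = h (a ^ s * g)" using e fg mul Sc by metis
        then have "a ^ s * f - a ^ s * g \<in> J"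
          using ker[OF carrier_mult[OF asc Sc[OF fg(1)]] carrier_mult[OF asc Sc[OF fg(2)]]] by simp
        then have "a ^ s * (f - g) \<in> J" by (simp only: right_diff_distrib)
        moreover have "f - g \<in> ?S" using mp.subspace_diff[OF subspace_homog fg(1,2)] .
        ultimately have "f - g \<in> J" using R by blast
        then show "x = y" using ker[OF Sc[OF fg(1)] Sc[OF fg(2)]] fg(3,4) by simp
      qed
    qed
    have part: "?A \<inter> homog_part l (i + s) = {a ^ s * f + b |f b. f \<in> ?S \<and> b \<in> J \<inter> homog_part l (i + s)}"
      using add_gens_homog_part[OF J as, of "i + s"] by simp
    have asS: "a ^ s * f \<in> homog_part l (i + s)" if "f \<in> ?S" for f
      using homog_mult[OF as that] by (simp add: add.commute)
    have surj: "(\<lambda>x. h a [^]\<^bsub>R\<^esub> s \<otimes>\<^bsub>R\<^esub> x) ` h ` ?S = h ` homog_part l (i + s) \<longleftrightarrow> homog_part l (i + s) \<subseteq> ?A"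
    proof -
      have im: "(\<lambda>x. h a [^]\<^bsub>R\<^esub> s \<otimes>\<^bsub>R\<^esub> x) ` h ` ?S = (\<lambda>f. h (a ^ s * f)) ` ?S"
        unfolding image_image by (rule image_cong) (use mul Sc in auto)
      have "(\<lambda>f. h (a ^ s * f)) ` ?S \<subseteq> h ` homog_part l (i + s)" using asS by blast
      moreover have "h f \<in> (\<lambda>f. h (a ^ s * f)) ` ?S \<longleftrightarrow> f \<in> ?A" if f: "f \<in> homog_part l (i + s)" for f
      proof
        assume "h f \<in> (\<lambda>f. h (a ^ s * f)) ` ?S"
        then obtain g where g: "g \<in> ?S" "h f = h (a ^ s * g)" by blast
        then have "f - a ^ s * g \<in> J" using ker[OF Sc[OF f] Sc[OF asS[OF g(1)]]] by simp
        moreover have "f - a ^ s * g \<in> homog_part l (i + s)" by (rule mp.subspace_diff[OF subspace_homog f asS[OF g(1)]])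
        ultimately have "a ^ s * g + (f - a ^ s * g) \<in> ?A \<inter> homog_part l (i + s)" using g(1) unfolding part by blast
        then show "f \<in> ?A" by simp
      next
        assume "f \<in> ?A"
        then obtain g b where gb: "f = a ^ s * g + b" "g \<in> ?S" "b \<in> J" using f part by blast
        then have "h f = h (a ^ s * g)" using ker[OF Sc[OF f] Sc[OF asS[OF gb(2)]]] by simp
        then show "h f \<in> (\<lambda>f. h (a ^ s * f)) ` ?S" using gb(2) by blast
      qed
      ultimately show ?thesis unfolding im by blast
    qed
    \<comment> \<open>The cokernel has the dimension of the target minus that of the source plus
      that of the kernel. It equals the truncated difference exactly when the kernel or the cokernel
      is zero.\<close>
    note HF = HF_add_gens[OF J as, of i]
    show ?thesis unfolding full_rank_def inj surj HF(3)[symmetric] HF(4)[symmetric]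
      using HF(1,2) by linarith
  qed
  then show ?thesis unfolding SLP_def SLP_HF_def using a by auto
qed

text \<open>The correspondence between ideals of \<open>S/I\<close> and ideals of \<open>S\<close>
  containing \<open>I\<close>, applied in both directions by minimality of generated ideals.\<close>

lemma quot_coset_mem_Idl:
  fixes I :: "(nat, 'k::field) mpoly set"
  assumes I: "ideal I (poly_ring l)" and G: "G \<subseteq> polys l" and f: "f \<in> polys l"
  shows "I +>\<^bsub>poly_ring l\<^esub> f \<in> Idl\<^bsub>poly_ring l Quot I\<^esub> ((\<lambda>g. I +>\<^bsub>poly_ring l\<^esub> g) ` G) \<longleftrightarrow> f \<in> add_gens l I G"
proof -
  interpret R: ring "poly_ring l :: (nat, 'k) mpoly ring" by (rule ring_poly_ring)
  interpret I: ideal I "poly_ring l" by (rule I)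
  let ?h = "\<lambda>g. I +>\<^bsub>poly_ring l\<^esub> g"
  interpret h: ring_hom_ring "poly_ring l" "poly_ring l Quot I" ?h by (rule I.rcos_ring_hom_ring)
  let ?J = "Idl\<^bsub>poly_ring l Quot I\<^esub> (?h ` G)"
  have hG: "?h ` G \<subseteq> carrier (poly_ring l Quot I)" using G h.hom_closed by blast
  have J: "ideal ?J (poly_ring l Quot I)" by (rule h.S.genideal_ideal[OF hG])
  note K = ideal_add_gens[OF I G]
  show ?thesis
  proof
    assume "?h f \<in> ?J"
    have "ideal (?h ` add_gens l I G) (poly_ring l Quot I)" by (rule R.ring_ideal_imp_quot_ideal[OF I K])
    then have "?J \<subseteq> ?h ` add_gens l I G"
      by (rule h.S.genideal_minimal) (use gens_subset_add_gens[OF I G] in blast)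
    then obtain k where k: "k \<in> add_gens l I G" "?h f = ?h k" using \<open>?h f \<in> ?J\<close> by blast
    have "k \<in> polys l" using k(1) ideal_carrier[OF K] by blast
    then have "f - k \<in> add_gens l I G" using k(2) coset_eq_iff[OF I f] subset_add_gens[OF I G] by blast
    then have "(f - k) + k \<in> add_gens l I G" using k(1) K unfolding ideal_poly_ring_iff by blast
    then show "f \<in> add_gens l I G" by simp
  next
    assume fK: "f \<in> add_gens l I G"
    have "add_gens l I G \<subseteq> {r \<in> polys l. ?h r \<in> ?J}"
    proof (rule add_gens_minimal[OF h.ideal_vimage[OF J]])
      show "I \<subseteq> {r \<in> polys l. ?h r \<in> ?J}"
      proof
        fix x assume x: "x \<in> I"
        have "?h x = \<zero>\<^bsub>poly_ring l Quot I\<^esub>" using R.a_rcos_zero[OF I x] by (simp add: FactRing_def)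
        then show "x \<in> {r \<in> polys l. ?h r \<in> ?J}"
          using x I.Icarr additive_subgroup.zero_closed[OF ideal.axioms(1)[OF J]] by simp
      qed
      show "G \<subseteq> {r \<in> polys l. ?h r \<in> ?J}"
        using G h.S.genideal_self[OF hG] by blast
    qed
    then show "?h f \<in> ?J" using fK by blast
  qed
qed

text \<open>The composite of the two quotient maps has as kernel \<open>I\<close> plus the ideal of
  the earlier forms, which makes every clause of \<open>k_SLP\<close> an instance of
  \<open>SLP_iff_HF\<close>.\<close>

lemma k_SLP_iff_HF:
  fixes I :: "(nat, 'k::field) mpoly set"
  assumes I: "homog_ideal l I" and k: "1 \<le> k" and L: "\<And>i. i \<in> {1..k} \<Longrightarrow> L i \<in> homog_part l 1"
  shows "k_SLP (poly_ring l Quot I) (quot_part l I) k (\<lambda>i. I +>\<^bsub>poly_ring l\<^esub> L i) \<longleftrightarrow>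
    (\<forall>j<k. SLP_HF l (add_gens l I (L ` {1..j})) (L (j + 1)))"
proof -
  interpret R: ring "poly_ring l :: (nat, 'k) mpoly ring" by (rule ring_poly_ring)
  note I' = homog_ideal_ideal[OF I]
  interpret I: ideal I "poly_ring l" by (rule I')
  let ?R = "poly_ring l Quot I" and ?h = "\<lambda>f. I +>\<^bsub>poly_ring l\<^esub> f"
  interpret h: ring_hom_ring "poly_ring l" ?R ?h by (rule I.rcos_ring_hom_ring)
  have first: "SLP ?R (quot_part l I) (?h (L 1)) \<longleftrightarrow> SLP_HF l (add_gens l I (L ` {1..0})) (L (0 + 1))"
  proof -
    have "L 1 \<in> homog_part l 1" using L[of 1] k by simp
    then show ?thesis unfolding quot_part_def
      using SLP_iff_HF[OF I _ I.rcos_ring_hom_ring coset_eq_iff[OF I']] add_gens_empty[OF I'] by simp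
  qed
  have step: "(let J = Idl\<^bsub>?R\<^esub> ((\<lambda>i. ?h (L i)) ` {1..<i}) in
        SLP (?R Quot J) (\<lambda>d. (\<lambda>x. J +>\<^bsub>?R\<^esub> x) ` quot_part l I d) (J +>\<^bsub>?R\<^esub> ?h (L i))) \<longleftrightarrow>
      SLP_HF l (add_gens l I (L ` {1..i - 1})) (L (i - 1 + 1))" if i: "i \<in> {2..k}" for i
  proof -
    define G where "G = L ` {1..i - 1}"
    have "{1..<i} = {1..i - 1}" using i by auto
    then have im: "(\<lambda>i. ?h (L i)) ` {1..<i} = ?h ` G" unfolding G_def image_image by simp
    have Gh: "G \<subseteq> (\<Union>d. homog_part l d)" unfolding G_def using L i by fastforce
    have Gc: "G \<subseteq> polys l" using Gh homog_carrier by blast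
    let ?J = "Idl\<^bsub>?R\<^esub> (?h ` G)"
    have hG: "?h ` G \<subseteq> carrier ?R" using Gc h.hom_closed by blast
    have J: "ideal ?J ?R" by (rule h.S.genideal_ideal[OF hG])
    interpret J: ideal ?J ?R by (rule J)
    have comp: "ring_hom_ring (poly_ring l) (?R Quot ?J) (\<lambda>f. ?J +>\<^bsub>?R\<^esub> ?h f)"
    proof (rule ring_hom_ringI2[OF R.ring_axioms J.quotient_is_ring])
      show "(\<lambda>f. ?J +>\<^bsub>?R\<^esub> ?h f) \<in> Ring.ring_hom (poly_ring l) (?R Quot ?J)"
        using ring_hom_trans[OF I.rcos_ring_hom J.rcos_ring_hom] by (simp add: comp_def)
    qed
    have ker: "?J +>\<^bsub>?R\<^esub> ?h f = ?J +>\<^bsub>?R\<^esub> ?h g \<longleftrightarrow> f - g \<in> add_gens l I G"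
      if fg: "f \<in> polys l" "g \<in> polys l" for f g
    proof -
      have d: "f - g \<in> polys l"
        using fg mp.subspace_diff[OF subspace_supp] unfolding carrier_poly_ring by blast
      have "?h (f - g) \<oplus>\<^bsub>?R\<^esub> ?h g = ?h f" using h.hom_add[OF d fg(2)] by simp
      then have "?h f \<ominus>\<^bsub>?R\<^esub> ?h g = ?h (f - g)"
        using h.hom_closed[OF d] h.hom_closed[OF fg(2)] by (metis h.S.add.inv_solve_right' h.S.minus_eq h.S.add.m_closed)
      then have "?J +>\<^bsub>?R\<^esub> ?h f = ?J +>\<^bsub>?R\<^esub> ?h g \<longleftrightarrow> ?h (f - g) \<in> ?J"
        using h.S.quotient_eq_iff_same_a_r_cos[OF J h.hom_closed[OF fg(1)] h.hom_closed[OF fg(2)]] by simp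
      then show ?thesis using quot_coset_mem_Idl[OF I' Gc d] by simp
    qed
    have "L i \<in> homog_part l 1" using L i by simp
    from SLP_iff_HF[OF homog_ideal_add_gens[OF I Gh] this comp ker]
    have "SLP (?R Quot ?J) (\<lambda>d. (\<lambda>f. ?J +>\<^bsub>?R\<^esub> ?h f) ` homog_part l d) (?J +>\<^bsub>?R\<^esub> ?h (L i)) \<longleftrightarrow>
      SLP_HF l (add_gens l I G) (L i)" .
    moreover have "i - 1 + 1 = i" using i by simp
    ultimately show ?thesis unfolding Let_def im quot_part_def image_image G_def by simp
  qed
  \<comment> \<open>\<open>k_SLP\<close> lists its first clause separately; in the others
    \<open>j = i - 1\<close>.\<close>
  have "(\<forall>j<k. P j) \<longleftrightarrow> P 0 \<and> (\<forall>i\<in>{2..k}. P (i - 1))" for P :: "nat \<Rightarrow> bool"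
  proof
    assume R: "P 0 \<and> (\<forall>i\<in>{2..k}. P (i - 1))"
    show "\<forall>j<k. P j"
    proof (intro allI impI)
      fix j assume "j < k"
      then show "P j" using R bspec[of "{2..k}" "\<lambda>i. P (i - 1)" "j + 1"] by (cases j) auto
    qed
  qed (use k in auto)
  then show ?thesis unfolding k_SLP_def using first step by simp
qed

text \<open>The values for the given forms are bounded below by the generic values \<open>M\<close>
  and \<open>N\<close>, and rank-nullity at a generic point bounds \<open>N\<close> below by the
  truncated difference of values of \<open>M\<close>. Under SLP the given forms attain this
  difference, which squeezes everything between.\<close>

lemma SLP_HF_iff_generic_HF:
  fixes I :: "(nat, 'k::field_char_0) mpoly set" and L :: "nat \<Rightarrow> (nat, 'k) mpoly"
  assumes I: "homog_ideal l I" and k: "1 \<le> k" "k \<le> l" and L: "\<And>i. i \<in> {1..k} \<Longrightarrow> L i \<in> homog_part l 1"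
  defines "M \<equiv> \<lambda>j. sectional_matrix l I (l - j)"
    and "J \<equiv> \<lambda>j. add_gens l I (L ` {1..j})"
    and "K \<equiv> \<lambda>j s. HF l (add_gens l I (L ` {1..j} \<union> {L (j + 1) ^ s}))"
    and "N \<equiv> \<lambda>j s. HF l (add_gens l (rgin l I) (last_vars l j s))"
  shows "(\<forall>j<k. SLP_HF l (J j) (L (j + 1))) \<longleftrightarrow>
    (\<forall>d j s. j < k \<longrightarrow> 1 \<le> s \<longrightarrow> K j s d = N j s d \<and> N j s d = M j d - (if d < s then 0 else M j (d - s)))"
proof -
  note I' = homog_ideal_ideal[OF I]
  have Lh: "L ` {1..j} \<subseteq> (\<Union>d. homog_part l d)" if "j \<le> k" for j using L that by fastforce
  have Lc: "L ` {1..j} \<subseteq> polys l" if "j \<le> k" for j using Lh[OF that] homog_carrier by blast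
  have Lp: "L (j + 1) ^ s \<in> homog_part l s" if "j < k" for j s using homog_power[OF L[of "j + 1"], of s] that by simp
  have J: "homog_ideal l (J j)" if "j \<le> k" for j unfolding J_def by (rule homog_ideal_add_gens[OF I Lh[OF that]])
  have K: "K j s = HF l (add_gens l (J j) {L (j + 1) ^ s})" if j: "j < k" for j s
  proof -
    have "L (j + 1) ^ s \<in> polys l" using Lp[OF j] homog_carrier by blast
    then show ?thesis unfolding K_def J_def using add_gens_Un[OF I' Lc, of j "{L (j + 1) ^ s}"] j by simp
  qed
  \<comment> \<open>The parameter point whose rows are the given forms.\<close>
  define q where "q = (\<lambda>(a, b). lookup (L (a + 1)) (Poly_Mapping.single (Suc b) 1))"
  have q: "rowf l q a = L (a + 1)" if "a < k" for a
    using homog_part_1_linear_form[OF L[of "a + 1"]] that unfolding rowf_def q_def by simp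
  have qL: "rowf l q ` {..<j} = L ` {1..j}" if "j \<le> k" for j
  proof -
    have "{1..j} = Suc ` {..<j}" by (rule image_Suc_lessThan[symmetric])
    then have "L ` {1..j} = (\<lambda>a. L (Suc a)) ` {..<j}" by (simp only: image_image)
    then show ?thesis using q that by (auto intro!: image_cong)
  qed
  have M_le: "M j d \<le> HF l (J j) d" if "j \<le> k" for j d
    using sectional_matrix_generic(2)[OF I, of j d q] that k(2) unfolding M_def J_def qL[OF that] by simp
  have N_le: "N j s d \<le> K j s d" if "j < k" for j s d
    using rgin_HF_generic(1)[OF I, of j s d q] that k(2) q[OF that] qL[of j] unfolding N_def K_def row_gens_def by simp
  have Mgen: "generic (sq l) (\<lambda>p. HF l (add_gens l I (rowf l p ` {..<j})) d = M j d)" if "j \<le> l" for j d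
    unfolding M_def by (rule generic_mono[OF sectional_matrix_generic(1)[OF I that]]) (use that in auto)
  have row: "homog_ideal l (add_gens l I (rowf l p ` {..<j}))"
    "add_gens l I (row_gens l j s p) = add_gens l (add_gens l I (rowf l p ` {..<j})) {rowf l p j ^ s}"
    "rowf l p j ^ s \<in> homog_part l s" for p :: "nat \<times> nat \<Rightarrow> 'k" and j s
  proof -
    have "rowf l p ` {..<j} \<subseteq> (\<Union>d. homog_part l d)" using rowf_homog by blast
    then show "homog_ideal l (add_gens l I (rowf l p ` {..<j}))" by (rule homog_ideal_add_gens[OF I])
    show "rowf l p j ^ s \<in> homog_part l s" using homog_power[OF rowf_homog, of l p j s] by simp
    have "row_gens l j s p \<subseteq> polys l" by (rule row_gens_carrier)
    then show "add_gens l I (row_gens l j s p) = add_gens l (add_gens l I (rowf l p ` {..<j})) {rowf l p j ^ s}"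
      unfolding row_gens_def by (intro add_gens_Un[OF I']) auto
  qed
  have ge: "M j d - (if d < s then 0 else M j (d - s)) \<le> HF l (add_gens l I (row_gens l j s p)) d"
    if "HF l (add_gens l I (rowf l p ` {..<j})) d = M j d"
      "HF l (add_gens l I (rowf l p ` {..<j})) (d - s) = M j (d - s)" for p j d s
    using HF_add_gens_ge[OF row(1)[where p = p and j = j] row(3)[where p = p and j = j and s = s], of d] that
    unfolding row(2) by (cases "d < s") simp_all
  have N_ge: "M j d - (if d < s then 0 else M j (d - s)) \<le> N j s d" if jl: "j < l" for j s d
  proof -
    have "generic (sq l) (\<lambda>p. HF l (add_gens l I (rowf l p ` {..<j})) d = M j d \<and>
        HF l (add_gens l I (rowf l p ` {..<j})) (d - s) = M j (d - s) \<and>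
        HF l (add_gens l I (row_gens l j s p)) d = N j s d)"
      unfolding N_def by (intro generic_conj Mgen rgin_HF_generic(2)[OF I jl]) (use jl in simp_all)
    from generic_ex[OF this] show ?thesis using ge by metis
  qed
  \<comment> \<open>The case \<open>s = 1\<close>, where the added power is just the next
    row.\<close>
  have M_ge: "M j d - (if d < 1 then 0 else M j (d - 1)) \<le> M (j + 1) d" if jl: "j < l" for j d
  proof -
    have "generic (sq l) (\<lambda>p. HF l (add_gens l I (rowf l p ` {..<j})) d = M j d \<and>
        HF l (add_gens l I (rowf l p ` {..<j})) (d - 1) = M j (d - 1) \<and>
        HF l (add_gens l I (rowf l p ` {..<j + 1})) d = M (j + 1) d)"
      by (intro generic_conj Mgen) (use jl in simp_all)
    then obtain p where "HF l (add_gens l I (rowf l p ` {..<j})) d = M j d"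
        "HF l (add_gens l I (rowf l p ` {..<j})) (d - 1) = M j (d - 1)"
        "HF l (add_gens l I (rowf l p ` {..<j + 1})) d = M (j + 1) d"
      using generic_ex by blast
    moreover have "rowf l p ` {..<j + 1} = row_gens l j 1 p" unfolding row_gens_def by (auto simp: lessThan_Suc)
    ultimately show ?thesis using ge[of p j d 1] by simp
  qed
  show ?thesis
  proof
    assume R: "\<forall>d j s. j < k \<longrightarrow> 1 \<le> s \<longrightarrow> K j s d = N j s d \<and> N j s d = M j d - (if d < s then 0 else M j (d - s))"
    then have KM: "K j s d = M j d - (if d < s then 0 else M j (d - s))" if "j < k" "1 \<le> s" for j s d
      using that by simp
    \<comment> \<open>With \<open>s = d + 1\<close> neither the power nor the shifted term
      contributes in degree \<open>d\<close>, so the equation gives the Hilbert function of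
      \<open>J j\<close> itself.\<close>
    have HJ: "HF l (J j) d = M j d" if j: "j < k" for j d
      using KM[OF j, of "Suc d" d] HF_add_gens_low[OF J Lp[OF j, of "Suc d"], of j d] j unfolding K[OF j] by simp
    show "\<forall>j<k. SLP_HF l (J j) (L (j + 1))" unfolding SLP_HF_def
    proof (intro allI impI)
      fix j i s :: nat assume "j < k" "1 \<le> s"
      then show "HF l (add_gens l (J j) {L (j + 1) ^ s}) (i + s) = HF l (J j) (i + s) - HF l (J j) i"
        using KM[of j s "i + s"] HJ K by simp
    qed
  next
    assume S: "\<forall>j<k. SLP_HF l (J j) (L (j + 1))"
    have KJ: "K j s d = HF l (J j) d - (if d < s then 0 else HF l (J j) (d - s))" if j: "j < k" "1 \<le> s" for j s d
    proof (cases "d < s")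
      case True
      then show ?thesis using HF_add_gens_low[OF J Lp[OF j(1), of s] True, of j] j unfolding K[OF j(1)] by simp
    next
      case False
      then have "d = d - s + s" by simp
      then show ?thesis using S j False unfolding K[OF j(1)] SLP_HF_def by (metis (full_types))
    qed
    have HJ: "HF l (J j) d = M j d" if "j < k" for j d
      using that
    proof (induction j arbitrary: d)
      case 0
      have "J 0 = I" unfolding J_def using add_gens_empty[OF I'] by simp
      moreover obtain p :: "nat \<times> nat \<Rightarrow> 'k" where "HF l (add_gens l I (rowf l p ` {..<0})) d = M 0 d"
        using generic_ex[OF Mgen[of 0 d]] by auto
      ultimately show ?case using add_gens_empty[OF I'] by simp
    next
      \<comment> \<open>\<open>J (Suc j)\<close> is \<open>J j\<close> with the first power of the
        next form added, so the SLP at \<open>j\<close> gives the least value that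
        \<open>M_ge\<close> permits for \<open>M (Suc j) d\<close>; \<open>M_le\<close> is the
        opposite inequality.\<close>
      case (Suc j)
      have "{1..Suc j} = insert (Suc j) {1..j}" by auto
      then have "HF l (J (Suc j)) d = K j 1 d" unfolding K_def J_def by simp
      also have "\<dots> = M j d - (if d < 1 then 0 else M j (d - 1))" using KJ[of j 1 d] Suc by simp
      also have "\<dots> \<le> M (Suc j) d" using M_ge[of j d] Suc.prems k(2) by simp
      finally show ?case using M_le[of "Suc j" d] Suc.prems by simp
    qed
    show "\<forall>d j s. j < k \<longrightarrow> 1 \<le> s \<longrightarrow> K j s d = N j s d \<and> N j s d = M j d - (if d < s then 0 else M j (d - s))"
    proof (intro allI impI)
      fix d j s :: nat assume j: "j < k" and s: "1 \<le> s"
      have "K j s d = M j d - (if d < s then 0 else M j (d - s))" using KJ[OF j s] HJ[OF j] by simp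
      moreover have "M j d - (if d < s then 0 else M j (d - s)) \<le> N j s d" using N_ge[of j d s] j k(2) by simp
      \<comment> \<open>\<open>N j s d\<close> lies between the difference and
        \<open>K j s d\<close>, which coincide.\<close>
      ultimately show "K j s d = N j s d \<and> N j s d = M j d - (if d < s then 0 else M j (d - s))"
        using N_le[OF j, of s d] by simp
    qed
  qed
qed

theorem theorem6p11:
  fixes I :: "(nat, 'k::field_char_0) mpoly set"
    and L :: "nat \<Rightarrow> (nat, 'k) mpoly"
    and k l :: nat
  assumes "homogeneous_ideal l I"
    and "1 \<le> k" and "k \<le> l"
    and "\<forall>i\<in>{1..k}. L i \<in> homog_part l 1"
  shows "k_SLP (poly_ring l Quot I) (quot_part l I) k (\<lambda>i. I +>\<^bsub>poly_ring l\<^esub> L i) \<longleftrightarrow>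
    (\<forall>d j s :: nat. j \<le> k - 1 \<longrightarrow> 1 \<le> s \<longrightarrow>
       HF l (add_gens l I (L ` {1..j} \<union> {L (j + 1) ^ s})) d =
         HF l (add_gens l (rgin l I) (Var ` {l - j + 1..l} \<union> {Var (l - j) ^ s})) d \<and>
       int (HF l (add_gens l (rgin l I) (Var ` {l - j + 1..l} \<union> {Var (l - j) ^ s})) d) =
         max (sectional_matrix_int l I (l - j) (int d)
              - sectional_matrix_int l I (l - j) (int d - int s)) 0)"
proof -
  have I: "homog_ideal l I" by (rule homogeneous_ideal_imp[OF assms(1)])
  have L: "\<And>i. i \<in> {1..k} \<Longrightarrow> L i \<in> homog_part l 1" using assms(4) by blast
  \<comment> \<open>The maximum with 0 is truncated subtraction of natural numbers; for
    \<open>d < s\<close> the subtrahend is the value 0 at a negative degree.\<close>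
  have "int n = max (sectional_matrix_int l I i (int d) - sectional_matrix_int l I i (int d - int s)) 0 \<longleftrightarrow>
    n = sectional_matrix l I i d - (if d < s then 0 else sectional_matrix l I i (d - s))" for n i d s
  proof (cases "d < s")
    case False
    then have "nat (int d - int s) = d - s" by linarith
    then show ?thesis using False by (auto simp: sectional_matrix_int_def)
  qed (auto simp: sectional_matrix_int_def)
  moreover have "j \<le> k - 1 \<longleftrightarrow> j < k" for j using assms(2) by auto
  moreover have "k_SLP (poly_ring l Quot I) (quot_part l I) k (\<lambda>i. I +>\<^bsub>poly_ring l\<^esub> L i) \<longleftrightarrow>
    (\<forall>j<k. SLP_HF l (add_gens l I (L ` {1..j})) (L (j + 1)))"
    by (rule k_SLP_iff_HF[OF I assms(2)]) (rule L)
  moreover note SLP_HF_iff_generic_HF[OF I assms(2,3), of L, unfolded last_vars_def]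
  ultimately show ?thesis using L by (simp only:)
qed

end
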